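(* Let $T$ be a tree, and let $G\le\mathrm{Aut}(T)$ have property $(\mathrm{P})$. Suppose $\Delta$ is the local action diagram of $(T,G)$. Then $\Delta$ is not a focal cycle and has no horocyclic ends, no stray half-trees and no stray leaves if and only if $G$ is geometrically dense. In particular, if $\Delta$ is not a focal cycle and has no horocyclic ends, no stray half-trees and no stray leaves, then $G^+$ is abstractly simple or trivial.
   Context: Graphs. A graph $\Gamma$ has a vertex set $V\Gamma$, an arc set $A\Gamma$, an origin map $o:A\Gamma\to V\Gamma$ and a reversal map $a\mapsto\overline a$ on $A\Gamma$ with $\overline{\overline a}=a$; $t(a):=o(\overline a)$. An arc with $o(a)=t(a)$ is a loop; for a loop both $\overline a=a$ and $\overline a\neq a$ are allowed. $o^{-1}(v)$ is the set of arcs with origin $v$; the degree of $v$ is $|o^{-1}(v)|$. A leaf is a vertex $v$ with $|o^{-1}(v)|=1$ such that the arc in $o^{-1}(v)$ is not a loop. A tree is a nonempty connected graph without loops, multiple edges or cycles; subtrees are nonempty connected subgraphs; ends of a tree are equivalence classes of one-way infinite simple paths (rays), two being equivalent if they share infinitely many vertices. $G\backslash T$ is the graph of $G$-orbits on vertices and arcs. Property $(\mathrm{P})$. For a nonempty (finite or infinite) simple path $L$ in $T$, let $\pi_L:VT\to VL$ be the closest point projection and $G_{(L)}$ the pointwise stabiliser of $L$; for $x\in VL$ let $\phi_x:G_{(L)}\to\mathrm{Sym}(\pi_L^{-1}(x))$ be given by the action. $G$ has property $(\mathrm{P})$ if for every such $L$ the homomorphism $G_{(L)}\to\prod_{x\in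 VL}\phi_x(G_{(L)})$ is surjective. $G$ is geometrically dense if it preserves no proper subtree of $T$ and fixes no end of $T$. $G^+$ is the subgroup of $G$ generated by the stabilisers in $G$ of arcs of $T$. Local action diagram of $(T,G)$: $\Delta=(\Gamma,(X_a),(G(v)))$ where $\Gamma=G\backslash T$ with quotient map $\pi$; for each $v\in V\Gamma$ a vertex $v^*\in\pi^{-1}(v)$ is chosen; for $a\in o^{-1}(v)$, $X_a=\{b\in o^{-1}(v^* ):\pi(b)=a\}$; $X_v=\bigsqcup_{a\in o^{-1}(v)}X_a=o^{-1}(v^* )$; and $G(v)$ is the closure in $\mathrm{Sym}(X_v)$ (topology of pointwise convergence) of the permutation group induced by $G_{v^*}$ on $X_v$. A cycle graph is a finite connected graph in which all vertices have degree $2$ and no arc equals its own reverse (the cycle graph of order $1$ is a vertex with a loop $a\ne\overline a$; that of order $2$ is two vertices joined by two edges). A cyclic orientation of a cycle graph is a set of arcs containing exactly one of $a,\overline a$ for each arc $a$ and exactly one element of $o^{-1}(v)$ for each vertex $v$. $\Delta$ is a focal cycle if $\Gamma$ is a cycle graph with a cyclic orientation $O$ such that $|X_a|=1$ for all $a\in O$. An end $\xi$ of $\Gamma$ is a horocyclic end of $\Delta$ if $\Gamma$ is a tree and $|X_a|=1$ for every arc $a$ of $\Gamma$ directed towards $\xi$. For $a\in A\Gamma$ such that removing the arcs $a,\overline a$ from $\Gamma$ yields a disconnected graph, let $\Gamma_a$ be the component containing $t(a)$; $\Gamma_a$ is a stray half-tree of $\Delta$ if it is a tree containing no leaves of $\Gamma$,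 and $|X_b|=1$ for all arcs $b$ of $\Gamma_a$ oriented towards $t(a)$. A stray leaf of $\Delta$ is a leaf $v$ of $\Gamma$ with $|X_v|=1$. *)

theory Defs
  imports
    "HOL-Algebra.Group_Action"
    "HOL-Algebra.Generated_Groups"
    "HOL-Analysis.Function_Topology"
begin

section \<open>Graphs with arcs and reversal\<close>

text \<open>Unlike the bidirected digraphs of the Graph-Theory entry, these graphs admit loops that
  are equal to their own reverse; such loops arise in quotients by actions with inversions.\<close>

record ('v, 'a) agraph =
  verts :: "'v set"
  arcs :: "'a set"
  orig :: "'a \<Rightarrow> 'v"
  bar :: "'a \<Rightarrow> 'a"

definition is_graph :: "('v, 'a) agraph \<Rightarrow> bool" where
  "is_graph \<Gamma> \<longleftrightarrow>
     (\<forall>a\<in>arcs \<Gamma>. orig \<Gamma> a \<in> verts \<Gamma> \<and> bar \<Gamma> a \<in> arcs \<Gamma> \<and> bar \<Gamma> (bar \<Gamma> a) = a)"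

definition targ :: "('v, 'a) agraph \<Rightarrow> 'a \<Rightarrow> 'v" where
  "targ \<Gamma> a = orig \<Gamma> (bar \<Gamma> a)"

definition star :: "('v, 'a) agraph \<Rightarrow> 'v \<Rightarrow> 'a set" where
  "star \<Gamma> v = {a \<in> arcs \<Gamma>. orig \<Gamma> a = v}"

definition is_loop :: "('v, 'a) agraph \<Rightarrow> 'a \<Rightarrow> bool" where
  "is_loop \<Gamma> a \<longleftrightarrow> orig \<Gamma> a = targ \<Gamma> a"

definition is_leaf :: "('v, 'a) agraph \<Rightarrow> 'v \<Rightarrow> bool" where
  "is_leaf \<Gamma> v \<longleftrightarrow> v \<in> verts \<Gamma> \<and> card (star \<Gamma> v) = 1 \<and> (\<forall>a\<in>star \<Gamma> v. \<not> is_loop \<Gamma> a)"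

definition adj :: "('v, 'a) agraph \<Rightarrow> 'v rel" where
  "adj \<Gamma> = {(orig \<Gamma> a, targ \<Gamma> a) | a. a \<in> arcs \<Gamma>}"

definition connected_graph :: "('v, 'a) agraph \<Rightarrow> bool" where
  "connected_graph \<Gamma> \<longleftrightarrow> (\<forall>u\<in>verts \<Gamma>. \<forall>v\<in>verts \<Gamma>. (u, v) \<in> (adj \<Gamma>)\<^sup>*)"

definition gdist :: "('v, 'a) agraph \<Rightarrow> 'v \<Rightarrow> 'v \<Rightarrow> nat" where
  "gdist \<Gamma> u v = (LEAST n. (u, v) \<in> adj \<Gamma> ^^ n)"

text \<open>Loops and multiple edges (cycles of length one and two) are excluded separately in the
  definition of a tree, so cycles have length at least three here.\<close>

definition has_cycle :: "('v, 'a) agraph \<Rightarrow> bool" where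
  "has_cycle \<Gamma> \<longleftrightarrow> (\<exists>vs. length vs \<ge> 3 \<and> distinct vs \<and> set vs \<subseteq> verts \<Gamma> \<and>
     (\<forall>i<length vs. (vs ! i, vs ! (Suc i mod length vs)) \<in> adj \<Gamma>))"

definition is_tree :: "('v, 'a) agraph \<Rightarrow> bool" where
  "is_tree \<Gamma> \<longleftrightarrow> is_graph \<Gamma> \<and> verts \<Gamma> \<noteq> {} \<and> connected_graph \<Gamma> \<and>
     (\<forall>a\<in>arcs \<Gamma>. \<not> is_loop \<Gamma> a) \<and>
     (\<forall>a\<in>arcs \<Gamma>. \<forall>b\<in>arcs \<Gamma>. orig \<Gamma> a = orig \<Gamma> b \<and> targ \<Gamma> a = targ \<Gamma> b \<longrightarrow> a = b) \<and>
     \<not> has_cycle \<Gamma>"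

definition subgraph :: "('v, 'a) agraph \<Rightarrow> 'v set \<Rightarrow> 'a set \<Rightarrow> ('v, 'a) agraph" where
  "subgraph \<Gamma> W B = \<Gamma>\<lparr>verts := W, arcs := B\<rparr>"

definition is_subgraph :: "('v, 'a) agraph \<Rightarrow> 'v set \<Rightarrow> 'a set \<Rightarrow> bool" where
  "is_subgraph \<Gamma> W B \<longleftrightarrow> W \<subseteq> verts \<Gamma> \<and> B \<subseteq> arcs \<Gamma> \<and> is_graph (subgraph \<Gamma> W B)"

definition is_subtree :: "('v, 'a) agraph \<Rightarrow> 'v set \<Rightarrow> 'a set \<Rightarrow> bool" where
  "is_subtree T W B \<longleftrightarrow> is_subgraph T W B \<and> W \<noteq> {} \<and> connected_graph (subgraph T W B)"

text \<open>Rays are recorded by their vertices; this loses nothing in a graph without multiple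
  edges, and ends are only used for trees.\<close>

definition rays :: "('v, 'a) agraph \<Rightarrow> (nat \<Rightarrow> 'v) set" where
  "rays \<Gamma> = {r. inj r \<and> (\<forall>n. (r n, r (Suc n)) \<in> adj \<Gamma>)}"

definition ends :: "('v, 'a) agraph \<Rightarrow> (nat \<Rightarrow> 'v) set set" where
  "ends \<Gamma> = rays \<Gamma> //
     {(r, s). r \<in> rays \<Gamma> \<and> s \<in> rays \<Gamma> \<and> infinite (range r \<inter> range s)}"

text \<open>In a tree, the arc a points towards an end if it is the first arc of some ray
  representing that end.\<close>

definition towards_end :: "('v, 'a) agraph \<Rightarrow> (nat \<Rightarrow> 'v) set \<Rightarrow> 'a \<Rightarrow> bool" where
  "towards_end \<Gamma> \<xi> a \<longleftrightarrow> (\<exists>r\<in>\<xi>. r 0 = orig \<Gamma> a \<and> r 1 = targ \<Gamma> a)"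

definition towards_vertex :: "('v, 'a) agraph \<Rightarrow> 'v \<Rightarrow> 'a \<Rightarrow> bool" where
  "towards_vertex \<Gamma> w a \<longleftrightarrow> gdist \<Gamma> (targ \<Gamma> a) w < gdist \<Gamma> (orig \<Gamma> a) w"

section \<open>Automorphisms\<close>

text \<open>An automorphism is a pair of a vertex bijection and an arc bijection.\<close>

definition aut :: "('v, 'a) agraph \<Rightarrow> (('v \<Rightarrow> 'v) \<times> ('a \<Rightarrow> 'a)) set" where
  "aut \<Gamma> = {(f, h). f \<in> Bij (verts \<Gamma>) \<and> h \<in> Bij (arcs \<Gamma>) \<and>
     (\<forall>a\<in>arcs \<Gamma>. f (orig \<Gamma> a) = orig \<Gamma> (h a) \<and> h (bar \<Gamma> a) = bar \<Gamma> (h a))}"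

definition aut_group :: "('v, 'a) agraph \<Rightarrow> (('v \<Rightarrow> 'v) \<times> ('a \<Rightarrow> 'a)) monoid" where
  "aut_group \<Gamma> = (BijGroup (verts \<Gamma>) \<times>\<times> BijGroup (arcs \<Gamma>))\<lparr>carrier := aut \<Gamma>\<rparr>"

abbreviation sub_group ::
  "('v, 'a) agraph \<Rightarrow> (('v \<Rightarrow> 'v) \<times> ('a \<Rightarrow> 'a)) set \<Rightarrow> (('v \<Rightarrow> 'v) \<times> ('a \<Rightarrow> 'a)) monoid" where
  "sub_group T G \<equiv> (aut_group T)\<lparr>carrier := G\<rparr>"

text \<open>Vertices and arcs of the quotient are orbits. The set of origins of the arcs in the orbit
  of a is the orbit of the origin of a, and similarly for reversal, so taking images gives the
  quotient maps.\<close>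

definition quotient_graph ::
  "('v, 'a) agraph \<Rightarrow> (('v \<Rightarrow> 'v) \<times> ('a \<Rightarrow> 'a)) set \<Rightarrow> ('v set, 'a set) agraph" where
  "quotient_graph T G =
     \<lparr>verts = orbits (sub_group T G) (verts T) fst,
      arcs = orbits (sub_group T G) (arcs T) snd,
      orig = (\<lambda>A. orig T ` A),
      bar = (\<lambda>A. bar T ` A)\<rparr>"

definition preserves_subgraph ::
  "(('v \<Rightarrow> 'v) \<times> ('a \<Rightarrow> 'a)) set \<Rightarrow> 'v set \<Rightarrow> 'a set \<Rightarrow> bool" where
  "preserves_subgraph G W B \<longleftrightarrow> (\<forall>g\<in>G. fst g ` W = W \<and> snd g ` B = B)"

definition fixes_end ::
  "(('v \<Rightarrow> 'v) \<times> ('a \<Rightarrow> 'a)) set \<Rightarrow> (nat \<Rightarrow> 'v) set \<Rightarrow> bool" where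
  "fixes_end G \<xi> \<longleftrightarrow> (\<forall>g\<in>G. (\<lambda>r. fst g \<circ> r) ` \<xi> = \<xi>)"

definition geometrically_dense ::
  "('v, 'a) agraph \<Rightarrow> (('v \<Rightarrow> 'v) \<times> ('a \<Rightarrow> 'a)) set \<Rightarrow> bool" where
  "geometrically_dense T G \<longleftrightarrow>
     \<not> (\<exists>W B. is_subtree T W B \<and> (W, B) \<noteq> (verts T, arcs T) \<and> preserves_subgraph G W B) \<and>
     \<not> (\<exists>\<xi>\<in>ends T. fixes_end G \<xi>)"

definition G_plus ::
  "('v, 'a) agraph \<Rightarrow> (('v \<Rightarrow> 'v) \<times> ('a \<Rightarrow> 'a)) set \<Rightarrow> (('v \<Rightarrow> 'v) \<times> ('a \<Rightarrow> 'a)) set" where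
  "G_plus T G = generate (aut_group T) (\<Union>a\<in>arcs T. stabilizer (sub_group T G) snd a)"

text \<open>The library locale for simple groups requires the order, a natural number that is zero
  for infinite groups, to exceed one, and so only covers finite groups.\<close>

definition abstractly_simple :: "('g, 'm) monoid_scheme \<Rightarrow> bool" where
  "abstractly_simple K \<longleftrightarrow> group K \<and> carrier K \<noteq> {\<one>\<^bsub>K\<^esub>} \<and>
     (\<forall>N. N \<lhd> K \<longrightarrow> N = {\<one>\<^bsub>K\<^esub>} \<or> N = carrier K)"

section \<open>Property (P)\<close>

text \<open>A nonempty simple path is parametrised by a nonempty interval of integers, which may be
  bounded, bounded on one side only, or all of the integers. In a tree a path is determined by
  its vertex set.\<close>

definition path_sets :: "('v, 'a) agraph \<Rightarrow> 'v set set" where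
  "path_sets \<Gamma> = {p ` I | (p :: int \<Rightarrow> 'v) I.
     I \<noteq> {} \<and> (\<forall>i\<in>I. \<forall>k\<in>I. {i..k} \<subseteq> I) \<and> inj_on p I \<and> p ` I \<subseteq> verts \<Gamma> \<and>
     (\<forall>i. i \<in> I \<and> i + 1 \<in> I \<longrightarrow> (p i, p (i + 1)) \<in> adj \<Gamma>)}"

definition closest :: "('v, 'a) agraph \<Rightarrow> 'v set \<Rightarrow> 'v \<Rightarrow> 'v" where
  "closest T L v = (THE x. x \<in> L \<and> (\<forall>y\<in>L. gdist T v x \<le> gdist T v y))"

definition fibre :: "('v, 'a) agraph \<Rightarrow> 'v set \<Rightarrow> 'v \<Rightarrow> 'v set" where
  "fibre T L x = {v \<in> verts T. closest T L v = x}"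

definition pointwise_stab ::
  "(('v \<Rightarrow> 'v) \<times> ('a \<Rightarrow> 'a)) set \<Rightarrow> 'v set \<Rightarrow> (('v \<Rightarrow> 'v) \<times> ('a \<Rightarrow> 'a)) set" where
  "pointwise_stab G L = {g \<in> G. \<forall>x\<in>L. fst g x = x}"

definition fibre_action ::
  "('v, 'a) agraph \<Rightarrow> 'v set \<Rightarrow> 'v \<Rightarrow> ('v \<Rightarrow> 'v) \<times> ('a \<Rightarrow> 'a) \<Rightarrow> 'v \<Rightarrow> 'v" where
  "fibre_action T L x g = restrict (fst g) (fibre T L x)"

definition property_P ::
  "('v, 'a) agraph \<Rightarrow> (('v \<Rightarrow> 'v) \<times> ('a \<Rightarrow> 'a)) set \<Rightarrow> bool" where
  "property_P T G \<longleftrightarrow> (\<forall>L\<in>path_sets T.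
     (\<lambda>g. \<lambda>x\<in>L. fibre_action T L x g) ` pointwise_stab G L =
     (\<Pi>\<^sub>E x\<in>L. fibre_action T L x ` pointwise_stab G L))"

section \<open>Local action diagrams\<close>

record ('v, 'a, 'x) diagram =
  base :: "('v, 'a) agraph"
  col :: "'a \<Rightarrow> 'x set"
  loc :: "'v \<Rightarrow> ('x \<Rightarrow> 'x) set"

definition colv :: "('v, 'a, 'x) diagram \<Rightarrow> 'v \<Rightarrow> 'x set" where
  "colv \<Delta> v = (\<Union>a\<in>star (base \<Delta>) v. col \<Delta> a)"

text \<open>The topology of pointwise convergence on the symmetric group of X is the subspace topology
  inherited from the product of copies of the discrete space X.\<close>

definition sym_closure :: "'x set \<Rightarrow> ('x \<Rightarrow> 'x) set \<Rightarrow> ('x \<Rightarrow> 'x) set" where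
  "sym_closure X H =
     subtopology (product_topology (\<lambda>_. discrete_topology X) X) (Bij X) closure_of H"

text \<open>The function c chooses the representatives of the vertex orbits; the diagram depends on
  this choice. Recall that a vertex or arc of the quotient is itself the orbit lying over it.\<close>

definition is_local_action_diagram ::
  "('v, 'a) agraph \<Rightarrow> (('v \<Rightarrow> 'v) \<times> ('a \<Rightarrow> 'a)) set \<Rightarrow> ('v set, 'a set, 'a) diagram \<Rightarrow> bool" where
  "is_local_action_diagram T G \<Delta> \<longleftrightarrow> base \<Delta> = quotient_graph T G \<and>
     (\<exists>c. \<forall>v\<in>verts (base \<Delta>). c v \<in> v \<and>
        (\<forall>a\<in>star (base \<Delta>) v.
           col \<Delta> a = {b \<in> star T (c v). orbit (sub_group T G) snd b = a}) \<and>
        loc \<Delta> v = sym_closure (colv \<Delta> v)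
          ((\<lambda>g. restrict (snd g) (colv \<Delta> v)) ` stabilizer (sub_group T G) fst (c v)))"

definition is_cycle_graph :: "('v, 'a) agraph \<Rightarrow> bool" where
  "is_cycle_graph \<Gamma> \<longleftrightarrow> is_graph \<Gamma> \<and> finite (verts \<Gamma>) \<and> finite (arcs \<Gamma>) \<and>
     verts \<Gamma> \<noteq> {} \<and> connected_graph \<Gamma> \<and>
     (\<forall>v\<in>verts \<Gamma>. card (star \<Gamma> v) = 2) \<and> (\<forall>a\<in>arcs \<Gamma>. bar \<Gamma> a \<noteq> a)"

definition is_cyclic_orientation :: "('v, 'a) agraph \<Rightarrow> 'a set \<Rightarrow> bool" where
  "is_cyclic_orientation \<Gamma> Or \<longleftrightarrow> Or \<subseteq> arcs \<Gamma> \<and>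
     (\<forall>a\<in>arcs \<Gamma>. a \<in> Or \<longleftrightarrow> bar \<Gamma> a \<notin> Or) \<and>
     (\<forall>v\<in>verts \<Gamma>. \<exists>!a. a \<in> Or \<and> a \<in> star \<Gamma> v)"

definition is_focal_cycle :: "('v, 'a, 'x) diagram \<Rightarrow> bool" where
  "is_focal_cycle \<Delta> \<longleftrightarrow> is_cycle_graph (base \<Delta>) \<and>
     (\<exists>Or. is_cyclic_orientation (base \<Delta>) Or \<and> (\<forall>a\<in>Or. card (col \<Delta> a) = 1))"

definition is_horocyclic_end :: "('v, 'a, 'x) diagram \<Rightarrow> (nat \<Rightarrow> 'v) set \<Rightarrow> bool" where
  "is_horocyclic_end \<Delta> \<xi> \<longleftrightarrow> \<xi> \<in> ends (base \<Delta>) \<and> is_tree (base \<Delta>) \<and>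
     (\<forall>a\<in>arcs (base \<Delta>). towards_end (base \<Delta>) \<xi> a \<longrightarrow> card (col \<Delta> a) = 1)"

definition remove_edge :: "('v, 'a) agraph \<Rightarrow> 'a \<Rightarrow> ('v, 'a) agraph" where
  "remove_edge \<Gamma> a = subgraph \<Gamma> (verts \<Gamma>) (arcs \<Gamma> - {a, bar \<Gamma> a})"

definition component :: "('v, 'a) agraph \<Rightarrow> 'v \<Rightarrow> ('v, 'a) agraph" where
  "component \<Gamma> w = subgraph \<Gamma> {v \<in> verts \<Gamma>. (w, v) \<in> (adj \<Gamma>)\<^sup>*}
     {b \<in> arcs \<Gamma>. (w, orig \<Gamma> b) \<in> (adj \<Gamma>)\<^sup>*}"

definition half_graph :: "('v, 'a) agraph \<Rightarrow> 'a \<Rightarrow> ('v, 'a) agraph" where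
  "half_graph \<Gamma> a = component (remove_edge \<Gamma> a) (targ \<Gamma> a)"

text \<open>A stray half-tree is indexed by the arc a leading into it.\<close>

definition is_stray_half_tree :: "('v, 'a, 'x) diagram \<Rightarrow> 'a \<Rightarrow> bool" where
  "is_stray_half_tree \<Delta> a \<longleftrightarrow> a \<in> arcs (base \<Delta>) \<and>
     \<not> connected_graph (remove_edge (base \<Delta>) a) \<and>
     is_tree (half_graph (base \<Delta>) a) \<and>
     (\<forall>v\<in>verts (half_graph (base \<Delta>) a). \<not> is_leaf (base \<Delta>) v) \<and>
     (\<forall>b\<in>arcs (half_graph (base \<Delta>) a).
        towards_vertex (half_graph (base \<Delta>) a) (targ (base \<Delta>) a) b \<longrightarrow> card (col \<Delta> b) = 1)"

definition is_stray_leaf :: "('v, 'a, 'x) diagram \<Rightarrow> 'v \<Rightarrow> bool" where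
  "is_stray_leaf \<Delta> v \<longleftrightarrow> is_leaf (base \<Delta>) v \<and> card (colv \<Delta> v) = 1"

end

theory Submission
  imports Defs
begin

text \<open>Call a set of arcs confluent if it contains no arc together with its reverse and if, whenever
  it contains an arc a, it contains the reverse of every other arc with the same origin as a. A
  nonempty confluent set D of arcs of the tree T either has an arc leaving every vertex, and then
  following D leads every vertex to one and the same end, or the vertices without an outgoing arc
  in D span a proper subtree; conversely, the arcs pointing towards an end or towards a proper subtree
  are confluent. So G is geometrically dense iff T has no nonempty G-invariant confluent set. Such sets
  correspond to the nonempty confluent sets of arcs a of the quotient with \<open>|X\<^sub>a| = 1\<close>. If one
  follows such a set in the quotient from a vertex that is never revisited, the vertices that lead to
  it form a half-tree which is stray or contains a stray leaf; if every vertex is revisited, the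
  quotient is a focal cycle.

  For simplicity, density yields, for every arc a, an element of G that moves the complement of the
  half-tree of a into that half-tree: otherwise the arcs whose half-tree contains a translate of
  that complement would form an invariant confluent set. If T has a branching vertex, this property
  passes to nontrivial normalised subsets, hence to nontrivial normal subgroups N of \<open>G\<^sup>+\<close>, and
  it provides in every half-tree the axis L of a translation k in N. By property (P), every element
  of the fixator of L is a commutator of k with an element of the fixator, so the fixators of L
  and hence of half-trees lie in N; property (P) for an edge then factors arc stabilisers into
  fixators of half-trees.\<close>

section \<open>Trees\<close>

text \<open>Confluence is what remains of pointing towards a goal when the goal is forgotten: if one
  edge at a vertex points outwards, all others point inwards. This is a condition on single stars,
  so it still makes sense in the quotient, where geodesics and ends are lost. Arcs of a confluent
  set never share an origin; for an invariant set this says that each of its orbits has at most one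
  arc at every vertex, which is \<open>|X_a| = 1\<close>. The contraction property quantifies over
  all arcs because a translation must later be found inside a prescribed half-tree. Passing it to a
  normal subgroup needs room: the infinite dihedral group acting on a line is geometrically dense,
  yet its normal subgroup of translations contracts nothing. A branching vertex excludes this, and
  it comes for free, because an automorphism that fixes an arc of a tree without branching is the
  identity, so that \<open>G_plus\<close> is trivial there.\<close>

locale conn_graph =
  fixes \<Gamma> :: "('v, 'a) agraph"
  assumes graph: "is_graph \<Gamma>" and conn: "connected_graph \<Gamma>"
begin

abbreviation "V \<equiv> verts \<Gamma>"
abbreviation "A \<equiv> arcs \<Gamma>"
abbreviation "E \<equiv> adj \<Gamma>"
abbreviation "src \<equiv> orig \<Gamma>"
abbreviation "tgt \<equiv> targ \<Gamma>"
abbreviation "rv \<equiv> bar \<Gamma>"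
abbreviation "d \<equiv> gdist \<Gamma>"

section \<open>Adjacency and distance in connected graphs\<close>

lemma src_in [simp]: "a \<in> A \<Longrightarrow> src a \<in> V"
  and rv_in [simp]: "a \<in> A \<Longrightarrow> rv a \<in> A"
  and rv_rv [simp]: "a \<in> A \<Longrightarrow> rv (rv a) = a"
  using graph by (auto simp: is_graph_def)

lemma tgt_in [simp]: "a \<in> A \<Longrightarrow> tgt a \<in> V"
  and src_rv [simp]: "src (rv a) = tgt a"
  and tgt_rv [simp]: "a \<in> A \<Longrightarrow> tgt (rv a) = src a"
  by (auto simp: targ_def)

lemma adjI: "a \<in> A \<Longrightarrow> (src a, tgt a) \<in> E"
  by (auto simp: adj_def)

lemma adjE:
  assumes "(u, v) \<in> E" obtains a where "a \<in> A" "src a = u" "tgt a = v"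
  using assms by (auto simp: adj_def)

lemma adj_in: "(u, v) \<in> E \<Longrightarrow> u \<in> V" "(u, v) \<in> E \<Longrightarrow> v \<in> V"
  by (auto elim!: adjE)

lemma adj_sym:
  assumes "(u, v) \<in> E" shows "(v, u) \<in> E"
proof -
  obtain a where "a \<in> A" "src a = u" "tgt a = v" using assms by (rule adjE)
  then show ?thesis using adjI[of "rv a"] by simp
qed

lemma adjI': "a \<in> A \<Longrightarrow> (tgt a, src a) \<in> E"
  by (rule adj_sym) (rule adjI)

lemma sym_remove: "sym (E - {(u, v), (v, u)})"
proof (rule symI)
  fix x y assume "(x, y) \<in> E - {(u, v), (v, u)}"
  then show "(y, x) \<in> E - {(u, v), (v, u)}" using adj_sym[of x y] by blast
qed

lemma gdist_relpow:
  assumes "u \<in> V" "v \<in> V" shows "(u, v) \<in> E ^^ d u v"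
proof -
  have "(u, v) \<in> E\<^sup>*" using conn assms by (auto simp: connected_graph_def)
  then obtain n where "(u, v) \<in> E ^^ n" by (auto simp: rtrancl_power)
  then show ?thesis unfolding gdist_def by (rule LeastI)
qed

lemma gdist_le: "(u, v) \<in> E ^^ n \<Longrightarrow> d u v \<le> n"
  unfolding gdist_def by (rule Least_le)

lemma relpow_sym: "(u, v) \<in> E ^^ n \<longleftrightarrow> (v, u) \<in> E ^^ n"
proof -
  have *: "(u, v) \<in> E ^^ n \<Longrightarrow> (v, u) \<in> E ^^ n" for u v
  proof (induction n arbitrary: v)
    case (Suc n)
    then obtain y where "(u, y) \<in> E ^^ n" "(y, v) \<in> E" by (metis relpow_Suc_E)
    then show ?case using Suc.IH adj_sym by (metis relpow_Suc_I2)
  qed simp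
  show ?thesis using *[of u v] *[of v u] by blast
qed

lemma gdist_sym: "d u v = d v u"
  unfolding gdist_def by (subst relpow_sym) (rule refl)

lemma gdist_self [simp]: "d u u = 0"
  using gdist_le[of u u 0] by simp

lemma gdist_eq_0: "\<lbrakk>u \<in> V; v \<in> V\<rbrakk> \<Longrightarrow> d u v = 0 \<longleftrightarrow> u = v"
  using gdist_relpow[of u v] by auto

lemma gdist_triangle: "\<lbrakk>u \<in> V; v \<in> V; w \<in> V\<rbrakk> \<Longrightarrow> d u w \<le> d u v + d v w"
  using gdist_relpow[of u v] gdist_relpow[of v w] by (intro gdist_le) (auto simp: relpow_add)

lemma gdist_adj_le: "\<lbrakk>(u, v) \<in> E; w \<in> V\<rbrakk> \<Longrightarrow> d w v \<le> Suc (d w u)"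
  by (metis adj_in(1) gdist_le gdist_relpow relpow_Suc_I)

lemma gdist_tgt_le: "\<lbrakk>a \<in> A; w \<in> V\<rbrakk> \<Longrightarrow> d w (tgt a) \<le> Suc (d w (src a))"
  and gdist_src_le: "\<lbrakk>a \<in> A; w \<in> V\<rbrakk> \<Longrightarrow> d w (src a) \<le> Suc (d w (tgt a))"
  using gdist_adj_le[OF adjI] gdist_adj_le[OF adjI'] by blast+

lemma closer_nbr:
  assumes "u \<in> V" "w \<in> V" "u \<noteq> w"
  obtains v where "(u, v) \<in> E" "d w u = Suc (d w v)"
proof -
  obtain n where n: "d u w = Suc n" using assms gdist_eq_0 by (metis not0_implies_Suc)
  then have "(u, w) \<in> E ^^ Suc n" using gdist_relpow[OF assms(1,2)] by simp
  then obtain v where v: "(u, v) \<in> E" "(v, w) \<in> E ^^ n"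
    by (rule relpow_Suc_E2) (rule that)
  have "d v w \<le> n" using v(2) by (rule gdist_le)
  moreover have "d w u \<le> Suc (d w v)" using gdist_adj_le[OF adj_sym[OF v(1)]] assms by blast
  ultimately show ?thesis using that v(1) n by (simp add: gdist_sym)
qed

lemma closer_arc:
  assumes "u \<in> V" "w \<in> V" "u \<noteq> w"
  obtains a where "a \<in> A" "src a = u" "d w u = Suc (d w (tgt a))"
  proof -
  obtain v where "(u, v) \<in> E" "d w u = Suc (d w v)" using closer_nbr[OF assms] .
  moreover from this(1) obtain a where "a \<in> A" "src a = u" "tgt a = v" by (rule adjE)
  ultimately show ?thesis using that by simp
qed

text \<open>Defined by distances so that automorphisms visibly carry half-trees to half-trees. In a
  tree it is the vertex set of the component of \<open>tgt a\<close> after the edge of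
  \<open>a\<close> is removed.\<close>

definition half :: "'a \<Rightarrow> 'v set" where
  "half a = {w \<in> V. d w (tgt a) < d w (src a)}"

lemma half_sub: "half a \<subseteq> V" by (auto simp: half_def)

end

text \<open>In a path of minimal length, equal vertices would allow the stretch between them to be
  cut out.\<close>

lemma shortest_path_inj:
  assumes "(u, v) \<in> R\<^sup>*"
  obtains p n where "p 0 = u" "p n = v" "\<And>i. i < n \<Longrightarrow> (p i, p (Suc i)) \<in> R"
    "inj_on p {..n::nat}"
proof -
  define n where "n = (LEAST n. (u, v) \<in> R ^^ n)"
  obtain m where "(u, v) \<in> R ^^ m" using assms by (auto simp: rtrancl_power)
  then have "(u, v) \<in> R ^^ n" unfolding n_def by (rule LeastI)
  then have "\<exists>p. p 0 = u \<and> p n = v \<and> (\<forall>i<n. (p i, p (Suc i)) \<in> R)"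
    by (simp only: relpow_fun_conv)
  then obtain p where "p 0 = u \<and> p n = v \<and> (\<forall>i<n. (p i, p (Suc i)) \<in> R)" ..
  then have p: "p 0 = u" "p n = v" "\<And>i. i < n \<Longrightarrow> (p i, p (Suc i)) \<in> R" by simp_all
  have seg: "i \<le> j \<Longrightarrow> j \<le> n \<Longrightarrow> (p i, p j) \<in> R ^^ (j - i)" for i j
    unfolding relpow_fun_conv
    by (rule exI[of _ "\<lambda>k. p (i + k)"]) (auto intro: p(3))
  have "p i \<noteq> p j" if "i < j" "j \<le> n" for i j
  proof
    assume "p i = p j"
    have "(u, p i) \<in> R ^^ i" "(p j, v) \<in> R ^^ (n - j)"
      using seg[of 0 i] seg[of j n] that p by auto
    then have "(u, v) \<in> R ^^ (i + (n - j))"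
      using \<open>p i = p j\<close> by (auto simp: relpow_add)
    then have "n \<le> i + (n - j)" unfolding n_def by (rule Least_le)
    with that show False by simp
  qed
  then have "inj_on p {..n}" by (metis (mono_tags) atMost_iff inj_onI linorder_neq_iff)
  with p that show ?thesis by blast
qed

lemma sym_reach: "sym R \<Longrightarrow> (x, y) \<in> R\<^sup>* \<Longrightarrow> (y, x) \<in> R\<^sup>*"
  by (rule symD[OF sym_rtrancl])

section \<open>Geodesics in trees\<close>

locale tree = conn_graph \<Gamma> for \<Gamma> :: "('v, 'a) agraph" +
  assumes no_loop: "a \<in> A \<Longrightarrow> src a \<noteq> tgt a"
    and arc_eqI: "\<lbrakk>a \<in> A; b \<in> A; src a = src b; tgt a = tgt b\<rbrakk> \<Longrightarrow> a = b"
    and no_cycle: "\<not> has_cycle \<Gamma>"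
    and nonempty: "V \<noteq> {}"

lemma tree_iff: "tree \<Gamma> \<longleftrightarrow> is_tree \<Gamma>"
  unfolding tree_def tree_axioms_def conn_graph_def is_tree_def is_loop_def by blast

context tree
begin

lemma adj_irrefl: "(u, v) \<in> E \<Longrightarrow> u \<noteq> v"
  using no_loop by (auto elim!: adjE)

text \<open>A path around the edge, closed up by the edge, is a cycle. It has at least three
  vertices: length 0 would make the edge a loop, and length 1 would use the removed edge
  itself.\<close>

lemma bridge:
  assumes uv: "(u, v) \<in> E" shows "(u, v) \<notin> (E - {(u, v), (v, u)})\<^sup>*"
proof
  assume "(u, v) \<in> (E - {(u, v), (v, u)})\<^sup>*"
  then obtain p n where p: "p 0 = u" "p n = v"
    and step: "\<And>i. i < n \<Longrightarrow> (p i, p (Suc i)) \<in> E - {(u, v), (v, u)}"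
    and inj: "inj_on p {..n}"
    by (rule shortest_path_inj) (rule that)
  have n0: "n \<noteq> 0" using p adj_irrefl[OF uv] by (metis)
  have n1: "n \<noteq> 1" using p(1,2) step[of 0] by auto
  let ?vs = "map p [0..<Suc n]"
  have "distinct ?vs" using inj by (auto simp: distinct_map atLeast0AtMost[symmetric] atLeastLessThanSuc_atLeastAtMost simp del: upt_Suc)
  moreover have "p i \<in> V" if "i \<le> n" for i
  proof (cases i)
    case 0 then show ?thesis using p uv adj_in by auto
  next
    case (Suc j) then show ?thesis using step[of j] that adj_in by auto
  qed
  then have "set ?vs \<subseteq> V" by auto
  moreover have "(?vs ! i, ?vs ! (Suc i mod length ?vs)) \<in> E" if "i < length ?vs" for i
  proof (cases "i = n")
    case True
    then show ?thesis using p adj_sym[OF uv] by (simp del: upt_Suc)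
  next
    case False
    then have "i < n" using that by simp
    then show ?thesis using step[of i] by (simp del: upt_Suc)
  qed
  moreover have "length ?vs \<ge> 3" using n0 n1 by (simp del: upt_Suc)
  ultimately show False using no_cycle unfolding has_cycle_def by blast
qed

text \<open>Steps towards \<open>w\<close> exist at every other vertex. The bound \<open>m\<close>
  restricts the demand on \<open>R\<close> to a ball, so that \<open>R\<close> may omit an edge that
  starts further out.\<close>

lemma descend:
  assumes w: "w \<in> V" and R: "\<And>x y. \<lbrakk>(x, y) \<in> E; d w x \<le> m; d w x = Suc (d w y)\<rbrakk> \<Longrightarrow> (x, y) \<in> R"
  shows "x \<in> V \<Longrightarrow> d w x \<le> m \<Longrightarrow> (x, w) \<in> R\<^sup>*"
proof (induction "d w x" arbitrary: x)
  case 0 then show ?case using gdist_eq_0 w by auto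
next
  case (Suc k)
  then have "x \<noteq> w" by auto
  then obtain y where y: "(x, y) \<in> E" "d w x = Suc (d w y)" 
    using closer_nbr[of x w] w Suc.prems by blast
  then have "(y, w) \<in> R\<^sup>*" using Suc adj_in by auto
  moreover have "(x, y) \<in> R" using R y Suc by auto
  ultimately show ?case by auto
qed

text \<open>If both ends were equally far from \<open>w\<close>, descending paths from them would
  avoid the edge, as each step changes the distance, and together they would bypass it.\<close>

lemma adj_gdist_neq:
  assumes uv: "(u, v) \<in> E" and w: "w \<in> V" shows "d w u \<noteq> d w v"
proof
  assume eq: "d w u = d w v"
  let ?R = "E - {(u, v), (v, u)}"
  have *: "(x, w) \<in> ?R\<^sup>*" if "x \<in> V" "d w x \<le> d w u" for x
  proof (rule descend[OF w _ that])
    fix x y assume "(x, y) \<in> E" "d w x = Suc (d w y)"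
    moreover from this(2) eq have "(x, y) \<noteq> (u, v)" "(x, y) \<noteq> (v, u)"
      by (metis n_not_Suc_n prod.inject)+
    ultimately show "(x, y) \<in> ?R" by simp
  qed
  have uw: "(u, w) \<in> ?R\<^sup>*" by (rule *[OF adj_in(1)[OF uv] order_refl])
  have "(v, w) \<in> ?R\<^sup>*" by (rule *[OF adj_in(2)[OF uv] eq_imp_le[OF eq[symmetric]]])
  from this have "(w, v) \<in> ?R\<^sup>*" by (rule sym_reach[OF sym_remove])
  with uw have "(u, v) \<in> ?R\<^sup>*" by (rule rtrancl_trans)
  with bridge[OF uv] show False by simp
qed

text \<open>Both neighbours reach \<open>w\<close> by paths that stay closer to \<open>w\<close>
  than \<open>u\<close>. Going from \<open>u\<close> through \<open>v'\<close> to \<open>w\<close>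
  and back to \<open>v\<close> would bypass the edge from \<open>u\<close> to
  \<open>v\<close>.\<close>

lemma closer_unique:
  assumes 1: "(u, v) \<in> E" "d w v < d w u" and 2: "(u, v') \<in> E" "d w v' < d w u" and w: "w \<in> V"
  shows "v = v'"
proof (rule ccontr)
  assume ne: "v \<noteq> v'"
  let ?R = "E - {(u, v), (v, u)}"
  have "(x, w) \<in> ?R\<^sup>*" if "x \<in> V" "d w x \<le> d w u - 1" for x
    by (rule descend[OF w _ that]) (use 1 in auto)
  then have "(v, w) \<in> ?R\<^sup>*" "(v', w) \<in> ?R\<^sup>*"
    using 1 2 adj_in by auto
  moreover have "(u, v') \<in> ?R" using 2 ne adj_irrefl by auto
  ultimately have "(u, v) \<in> ?R\<^sup>*"
    using sym_reach[OF sym_remove] by (blast intro: converse_rtrancl_into_rtrancl rtrancl_trans)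
  with bridge[OF 1(1)] show False by simp
qed

section \<open>Half-trees and their relative positions\<close>

lemma half_rv:
  assumes a: "a \<in> A" shows "half (rv a) = V - half a"
proof -
  have "w \<in> half (rv a) \<longleftrightarrow> w \<notin> half a" if "w \<in> V" for w
  proof -
    have "d w (src a) \<noteq> d w (tgt a)" using adj_gdist_neq[OF adjI[OF a] that] .
    then show ?thesis using that a unfolding half_def by (simp add: neq_iff) linarith
  qed
  then show ?thesis using half_sub[of a] half_sub[of "rv a"] by blast
qed

lemma in_half: "\<lbrakk>a \<in> A; w \<in> half a\<rbrakk> \<Longrightarrow> d w (src a) = Suc (d w (tgt a))"
  using gdist_src_le[of a w] by (auto simp: half_def)

lemma notin_half: "\<lbrakk>a \<in> A; w \<in> V; w \<notin> half a\<rbrakk> \<Longrightarrow> d w (tgt a) = Suc (d w (src a))"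
  using in_half[of "rv a" w] half_rv[of a] by auto

lemma tgt_in_half [simp]: "a \<in> A \<Longrightarrow> tgt a \<in> half a"
  using no_loop[of a] gdist_eq_0[of "tgt a" "src a"] by (auto simp: half_def)

lemma src_notin_half [simp]: "a \<in> A \<Longrightarrow> src a \<notin> half a"
  by (auto simp: half_def)

lemma half_disjoint:
  assumes "a \<in> A" "b \<in> A" "src a = src b" "a \<noteq> b" shows "half a \<inter> half b = {}"
proof -
  have "w \<notin> half b" if "w \<in> half a" for w
    using closer_unique[of "src a" "tgt a" w "tgt b"] adjI[of a] adjI[of b] arc_eqI[of a b] assms that
    by (auto simp: half_def)
  then show ?thesis by auto
qed

lemma half_cover:
  assumes "u \<in> V" "w \<in> V" "u \<noteq> w"
  obtains a where "a \<in> A" "src a = u" "w \<in> half a"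
proof -
  obtain a where "a \<in> A" "src a = u" "d w u = Suc (d w (tgt a))" using closer_arc[OF assms] .
  then show ?thesis using that assms by (simp add: half_def)
qed

text \<open>The distances between the ends of the two edges are forced: \<open>tgt b\<close> is at
  distance k from \<open>tgt a\<close>, and \<open>src b\<close> at distance k from
  \<open>src a\<close>. If k > 0, the step from \<open>tgt b\<close> towards \<open>tgt a\<close>
  also approaches \<open>src a\<close>, as does the step to \<open>src b\<close>; uniqueness makes
  these the same step, although \<open>src b\<close> is farther from \<open>tgt a\<close>.\<close>

lemma crossing:
  assumes a: "a \<in> A" and b: "b \<in> A" and s: "src b \<notin> half a" and t: "tgt b \<in> half a"
  shows "b = a"
proof -
  define k where "k = d (tgt b) (tgt a)"
  have ta: "d (tgt b) (src a) = Suc k" using in_half[OF a t] by (simp add: k_def)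
  have sb: "d (src b) (tgt a) = Suc (d (src b) (src a))" using notin_half a b s by auto
  have "d (src b) (src a) = k"
    using gdist_src_le[OF b, of "tgt a"] gdist_tgt_le[OF b, of "src a"] ta sb a b
    by (auto simp: k_def gdist_sym)
  show ?thesis
  proof (cases "k = 0")
    case True
    then have "tgt b = tgt a" "src b = src a"
      using gdist_eq_0 a b \<open>d (src b) (src a) = k\<close> k_def by auto
    then show ?thesis using arc_eqI a b by auto
  next
    case False
    then obtain x where x: "(tgt b, x) \<in> E" "d (tgt a) (tgt b) = Suc (d (tgt a) x)"
      using closer_nbr[of "tgt b" "tgt a"] a b k_def by (metis gdist_self tgt_in)
    have "d x (src a) \<le> k"
      using gdist_src_le[OF a, of x] adj_in(2)[OF x(1)] x k_def by (auto simp: gdist_sym)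
    then have "x = src b"
      using closer_unique[OF x(1) _ adjI'[OF b], of "src a"] ta a \<open>d (src b) (src a) = k\<close>
      by (auto simp: gdist_sym)
    then show ?thesis using x(2) sb \<open>d (src b) (src a) = k\<close> k_def by (simp add: gdist_sym)
  qed
qed

text \<open>By \<open>crossing\<close>, a shortest walk from \<open>w\<close> to \<open>x\<close>
  can leave the half-tree only along the edge of \<open>a\<close>; the induction follows this
  walk.\<close>

lemma separation:
  assumes a: "a \<in> A" and w: "w \<in> half a" and x: "x \<in> V" "x \<notin> half a"
  shows "d w x = Suc (d w (tgt a) + d (src a) x)"
  using w
proof (induction n \<equiv> "d w x" arbitrary: w)
  case 0
  then show ?case using x half_sub[of a] gdist_eq_0[of w x] by auto
next
  case (Suc k)
  have wV: "w \<in> V" "w \<noteq> x" using Suc.prems half_sub[of a] x by auto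
  then obtain b where b: "b \<in> A" "src b = w" "d x w = Suc (d x (tgt b))" using closer_arc[of w x] x by blast
  then have k: "k = d (tgt b) x" using Suc.hyps by (simp add: gdist_sym)
  show ?case
  proof (cases "tgt b \<in> half a")
    case True
    then have "d (tgt b) x = Suc (d (tgt b) (tgt a) + d (src a) x)"
      using Suc.hyps(1)[OF k] by blast
    moreover have "d w (tgt a) \<le> Suc (d (tgt b) (tgt a))"
      using gdist_src_le[OF b(1), of "tgt a"] b(2) a by (simp add: gdist_sym)
    moreover have "d w x \<le> d w (tgt a) + d (tgt a) x" "d (tgt a) x \<le> Suc (d (src a) x)"
      using gdist_triangle[of w "tgt a" x] wV a x gdist_tgt_le[OF a, of x] by (auto simp: gdist_sym)
    ultimately show ?thesis using b by (simp add: gdist_sym)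
  next
    case False
    then have "rv b = a" using crossing[of a "rv b"] a b Suc.prems by auto
    then have "w = tgt a" "tgt b = src a" using b by auto
    then show ?thesis using b by (simp add: gdist_sym)
  qed
qed

text \<open>Seen from outside \<open>half a\<close>, both ends of \<open>b\<close> lie behind
  \<open>tgt a\<close>, so which of them is nearer does not depend on the viewpoint.\<close>

lemma half_nested:
  assumes a: "a \<in> A" and b: "b \<in> A" and ends: "src b \<in> half a" "tgt b \<in> half a"
  shows "tgt a \<in> half b \<Longrightarrow> half (rv a) \<subseteq> half b"
    and "tgt a \<notin> half b \<Longrightarrow> half (rv a) \<subseteq> half (rv b)"
proof -
  have *: "d x (src b) = Suc (d (src b) (tgt a) + d (src a) x)"
    "d x (tgt b) = Suc (d (tgt b) (tgt a) + d (src a) x)" if "x \<in> half (rv a)" for x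
    using separation[OF a ends(1), of x] separation[OF a ends(2), of x] that half_rv[OF a]
    by (auto simp: gdist_sym)
  have iff: "x \<in> half b \<longleftrightarrow> tgt a \<in> half b" if "x \<in> half (rv a)" for x
    using *[OF that] that half_sub[of "rv a"] a
    by (auto simp: half_def[of b] gdist_sym[of "tgt a" "src b"] gdist_sym[of "tgt a" "tgt b"])
  show "tgt a \<in> half b \<Longrightarrow> half (rv a) \<subseteq> half b"
    using iff by auto
  show "tgt a \<notin> half b \<Longrightarrow> half (rv a) \<subseteq> half (rv b)"
    unfolding half_rv[OF b] using iff half_sub[of "rv a"] by auto
qed

text \<open>Unless the edges coincide, \<open>b\<close> lies on one side of \<open>a\<close>, and
  the other side of \<open>a\<close> is contained in one of the halves of \<open>b\<close>;
  complementing puts the opposite half of \<open>b\<close> on the side where \<open>b\<close>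
  lies.\<close>

lemma half_cases:
  assumes a: "a \<in> A" and b: "b \<in> A"
  shows "half b \<subseteq> half a \<or> half b \<subseteq> half (rv a) \<or> half (rv b) \<subseteq> half a \<or> half (rv b) \<subseteq> half (rv a)"
proof -
  have c: "half c \<subseteq> half e \<or> half (rv c) \<subseteq> half e"
    if "c \<in> A" "e \<in> A" "src c \<in> half e" "tgt c \<in> half e" for c e
    using half_nested[OF that(2,1,3,4)] half_rv that half_sub by blast
  consider "src b \<in> half a \<and> tgt b \<in> half a" | "src b \<in> half (rv a) \<and> tgt b \<in> half (rv a)"
    | "b = a" | "rv b = a"
    using crossing[of a b] crossing[of a "rv b"] a b half_rv by auto
  then show ?thesis
  proof cases
    case 1 then show ?thesis using c a b by blast
  next
    case 2 then show ?thesis using c a b rv_in by blast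
  qed (use a b in auto)
qed

text \<open>After an outward step the only closer neighbour is the vertex just left, so a path that
  never turns back keeps moving outwards. This is how local conditions yield geodesics
  below.\<close>

lemma nonbacktracking:
  assumes step: "\<And>i. i < n \<Longrightarrow> (p i, p (Suc i)) \<in> E"
    and nb: "\<And>i. Suc i < n \<Longrightarrow> p i \<noteq> p (Suc (Suc i))"
    and v: "v \<in> V" and first: "d v (p (1::nat)) = Suc (d v (p 0))"
  shows "i \<le> n \<Longrightarrow> d v (p i) = d v (p 0) + i"
proof -
  have *: "d v (p (Suc i)) = Suc (d v (p i))" if "i < n" for i
    using that
  proof (induction i)
    case 0 then show ?case using first by simp
  next
    case (Suc i)
    then have E: "(p (Suc i), p i) \<in> E" "(p (Suc i), p (Suc (Suc i))) \<in> E"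
      using step adj_sym by auto
    have "\<not> d v (p (Suc (Suc i))) < d v (p (Suc i))"
      using closer_unique[OF E(1) _ E(2) _ v] Suc nb by auto
    moreover have "d v (p (Suc (Suc i))) \<noteq> d v (p (Suc i))"
      using adj_gdist_neq[OF E(2) v] by auto
    ultimately show ?case using gdist_adj_le[OF E(2) v] by auto
  qed
  show "i \<le> n \<Longrightarrow> d v (p i) = d v (p 0) + i"
    by (induction i) (auto simp: *)
qed

end

section \<open>Confluent orientations and ends\<close>

definition confluent :: "('v, 'a) agraph \<Rightarrow> 'a set \<Rightarrow> bool" where
  "confluent \<Gamma> D \<longleftrightarrow> D \<subseteq> arcs \<Gamma> \<and>
     (\<forall>a\<in>D. bar \<Gamma> a \<notin> D \<and> (\<forall>b\<in>star \<Gamma> (orig \<Gamma> a). b \<noteq> a \<longrightarrow> bar \<Gamma> b \<in> D))"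

lemma confluentD:
  assumes "confluent \<Gamma> D" "a \<in> D"
  shows "a \<in> arcs \<Gamma>" "bar \<Gamma> a \<notin> D"
    and "\<lbrakk>b \<in> arcs \<Gamma>; orig \<Gamma> b = orig \<Gamma> a; b \<noteq> a\<rbrakk> \<Longrightarrow> bar \<Gamma> b \<in> D"
  using assms by (auto simp: confluent_def star_def)

lemma confluentI:
  assumes "D \<subseteq> arcs \<Gamma>" "\<And>a. a \<in> D \<Longrightarrow> bar \<Gamma> a \<notin> D"
    and "\<And>a b. \<lbrakk>a \<in> D; b \<in> arcs \<Gamma>; orig \<Gamma> b = orig \<Gamma> a; b \<noteq> a\<rbrakk> \<Longrightarrow> bar \<Gamma> b \<in> D"
  shows "confluent \<Gamma> D"
  using assms by (auto simp: confluent_def star_def)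

context conn_graph
begin

lemma confluent_unique:
  assumes D: "confluent \<Gamma> D" and ab: "a \<in> D" "b \<in> D" "src a = src b"
  shows "a = b"
  using confluentD[OF D ab(1)] confluentD[OF D ab(2)] ab by metis

text \<open>The flow along \<open>D\<close>. At a vertex without outgoing arc in \<open>D\<close>
  its value is arbitrary, so it is iterated only when every vertex has one.\<close>

definition nxt :: "'a set \<Rightarrow> 'v \<Rightarrow> 'v" where
  "nxt D v = tgt (THE a. a \<in> D \<and> src a = v)"

lemma nxt_src:
  assumes D: "confluent \<Gamma> D" and a: "a \<in> D" shows "nxt D (src a) = tgt a"
proof -
  have "(THE b. b \<in> D \<and> src b = src a) = a"
    using confluent_unique[OF D] a by (intro the_equality) auto
  then show ?thesis by (simp add: nxt_def)
qed

lemma confluent_arc: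
  assumes D: "confluent \<Gamma> D" and "V \<subseteq> src ` D" and a: "a \<in> A"
  shows "a \<in> D \<or> rv a \<in> D"
proof -
  have "src a \<in> src ` D" using assms(2) src_in[OF a] by blast
  then obtain b where "b \<in> D" "src b = src a" by auto
  then show ?thesis using confluentD(3)[OF D, of b a] a by auto
qed

end

context tree
begin

lemma gdist_adj:
  assumes uv: "(u, v) \<in> E" shows "d u v = 1"
  using gdist_adj_le[OF uv adj_in(1)[OF uv]] gdist_eq_0[OF adj_in(1)[OF uv] adj_in(2)[OF uv]]
    adj_irrefl[OF uv] by auto

lemma rays_in: "r \<in> rays \<Gamma> \<Longrightarrow> r n \<in> V"
  using adj_in unfolding rays_def by blast

text \<open>Injectivity excludes turning back, so \<open>nonbacktracking\<close> applies.\<close>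

lemma ray_dist:
  assumes r: "r \<in> rays \<Gamma>" shows "d (r n) (r (n + i)) = i"
proof -
  have st: "(r k, r (Suc k)) \<in> E" for k using r by (auto simp: rays_def)
  have inj: "inj r" using r by (auto simp: rays_def)
  have "d (r n) (r (Suc n)) = 1"
    by (rule gdist_adj[OF st])
  then have "d (r n) (r (n + i)) = d (r n) (r (n + 0)) + i"
    using st inj_eq[OF inj] rays_in[OF r]
    by (intro nonbacktracking[where n = i and p = "\<lambda>k. r (n + k)"]) auto
  then show ?thesis by simp
qed

lemma ray_arc:
  assumes r: "r \<in> rays \<Gamma>"
  obtains a where "a \<in> A" "src a = r n" "tgt a = r (Suc n)"
  using r adjE[of "r n" "r (Suc n)"] by (auto simp: rays_def)

lemma ray_half:
  assumes r: "r \<in> rays \<Gamma>" and a: "a \<in> A" "src a = r n" "tgt a = r (Suc n)" and m: "m > n"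
  shows "r m \<in> half a"
proof -
  obtain i where i: "m = Suc n + i" using m less_iff_Suc_add by auto
  show ?thesis
    using ray_dist[OF r, of "Suc n" i] ray_dist[OF r, of n "Suc i"] rays_in[OF r, of m]
    by (simp add: half_def a i gdist_sym)
qed

section \<open>The rays that follow a total confluent set\<close>

context
  fixes D assumes D: "confluent \<Gamma> D" and total: "V \<subseteq> src ` D"
begin

lemma out_arc:
  assumes "v \<in> V" obtains a where "a \<in> D" "a \<in> A" "src a = v" "nxt D v = tgt a"
  using assms total nxt_src[OF D] confluentD(1)[OF D] by (metis imageE subsetD)

lemma nxt_in: "v \<in> V \<Longrightarrow> nxt D v \<in> V"
  using out_arc by (metis tgt_in)

lemma nxt_pow_in: "v \<in> V \<Longrightarrow> (nxt D ^^ n) v \<in> V"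
  by (induction n) (auto simp: nxt_in)

lemma nxt_adj: "v \<in> V \<Longrightarrow> (v, nxt D v) \<in> E"
  using out_arc by (metis adjI)

lemma nxt_nxt: assumes v: "v \<in> V" shows "nxt D (nxt D v) \<noteq> v"
proof
  assume eq: "nxt D (nxt D v) = v"
  obtain a where a: "a \<in> D" "a \<in> A" "src a = v" "nxt D v = tgt a" using out_arc[OF v] .
  obtain b where b: "b \<in> D" "b \<in> A" "src b = tgt a" "nxt D (tgt a) = tgt b"
    using out_arc[OF tgt_in[OF a(2)]] .
  have "b = rv a" using a b eq by (intro arc_eqI) auto
  then show False using confluentD(2)[OF D a(1)] b by simp
qed

text \<open>A turn back would need an arc and its reverse in \<open>D\<close>; so the flow line is
  geodesic and in particular injective.\<close>

lemma nxt_ray: assumes v: "v \<in> V" shows "(\<lambda>n. (nxt D ^^ n) v) \<in> rays \<Gamma>"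
proof -
  let ?r = "\<lambda>n. (nxt D ^^ n) v"
  have st: "(?r n, ?r (Suc n)) \<in> E" for n using nxt_adj[OF nxt_pow_in[OF v]] by simp
  have nb: "?r n \<noteq> ?r (Suc (Suc n))" for n using nxt_nxt[OF nxt_pow_in[OF v, of n]] by simp
  have dist: "d (?r k) (?r (k + i)) = i" for k i
  proof -
    have "d (?r k) (?r (Suc k)) = 1" by (rule gdist_adj[OF st])
    then have "d (?r k) (?r (k + i)) = d (?r k) (?r (k + 0)) + i"
      using st nb nxt_pow_in[OF v]
      by (intro nonbacktracking[where n = i and p = "\<lambda>j. ?r (k + j)"]) auto
    then show ?thesis by simp
  qed
  have "?r k \<noteq> ?r (k + Suc i)" for k i using dist[of k "Suc i"] by (metis gdist_self nat.distinct(1))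
  then have "inj ?r" by (intro linorder_injI) (metis less_iff_Suc_add add_Suc_right)
  with st show ?thesis by (auto simp: rays_def)
qed

text \<open>A total confluent set orients every edge, so of two neighbours one flows to the other;
  merging then passes along a path.\<close>

lemma nxt_merge:
  assumes "u \<in> V" "v \<in> V" shows "\<exists>m n. (nxt D ^^ m) u = (nxt D ^^ n) v"
proof -
  have "(u, v) \<in> E\<^sup>*" using conn assms by (auto simp: connected_graph_def)
  then show ?thesis
  proof (induction rule: rtrancl_induct)
    case base then show ?case by blast
  next
    case (step y z)
    obtain m n where mn: "(nxt D ^^ m) u = (nxt D ^^ n) y" using step by blast
    obtain a where a: "a \<in> A" "src a = y" "tgt a = z" using step(2) by (rule adjE)
    then have "nxt D y = z \<or> nxt D z = y"
      using confluent_arc[OF D total a(1)] nxt_src[OF D, of a] nxt_src[OF D, of "rv a"] by auto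
    then show ?case
    proof
      assume z: "nxt D y = z"
      have "(nxt D ^^ Suc m) u = (nxt D ^^ n) z"
        using mn z by (metis funpow.simps(2) funpow_swap1 o_apply)
      then show ?thesis by blast
    next
      assume "nxt D z = y"
      then have "(nxt D ^^ m) u = (nxt D ^^ Suc n) z" using mn by (simp add: funpow_swap1)
      then show ?thesis by blast
    qed
  qed
qed

end

text \<open>Half-trees that a ray enters far enough out are never left again, so these are the arcs
  pointing towards the end of r.\<close>

definition evt :: "(nat \<Rightarrow> 'v) \<Rightarrow> 'a set" where
  "evt r = {a \<in> A. \<exists>N. \<forall>m\<ge>N. r m \<in> half a}"

text \<open>The distance to \<open>v\<close> changes by one at each step and cannot decrease
  forever; once it has increased, \<open>nonbacktracking\<close> applies.\<close>

lemma ray_receding: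
  assumes r: "r \<in> rays \<Gamma>" and v: "v \<in> V"
  obtains M where "\<And>m. m \<ge> M \<Longrightarrow> d v (r m) = d v (r M) + (m - M)"
proof -
  have st: "(r k, r (Suc k)) \<in> E" for k using r by (auto simp: rays_def)
  have inj: "inj r" using r by (auto simp: rays_def)
  have "\<exists>M. d v (r (Suc M)) = Suc (d v (r M))"
  proof (rule ccontr)
    assume no: "\<nexists>M. d v (r (Suc M)) = Suc (d v (r M))"
    have "d v (r n) + n \<le> d v (r 0)" for n
    proof (induction n)
      case (Suc n)
      have "d v (r (Suc n)) \<noteq> d v (r n)" using adj_gdist_neq[OF st v, of n] by simp
      then have "d v (r (Suc n)) < d v (r n)" using no gdist_adj_le[OF st v, of n] by (metis le_SucE linorder_neqE_nat not_less)
      then show ?case using Suc by simp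
    qed simp
    from this[of "Suc (d v (r 0))"] show False by simp
  qed
  then obtain M where M: "d v (r (Suc M)) = Suc (d v (r M))" ..
  have "d v (r (M + i)) = d v (r (M + 0)) + i" for i
    using st inj_eq[OF inj] M v
    by (intro nonbacktracking[where n = i and p = "\<lambda>j. r (M + j)"]) auto
  then have "d v (r m) = d v (r M) + (m - M)" if "m \<ge> M" for m
    using that by (metis add.right_neutral le_add_diff_inverse)
  then show ?thesis using that by blast
qed

text \<open>Leaving \<open>half a\<close> means crossing its edge backwards and so visiting
  \<open>src a\<close>, from which the ray is already receding.\<close>

lemma ray_half_mono:
  assumes r: "r \<in> rays \<Gamma>" and a: "a \<in> A"
    and M: "\<And>m. m \<ge> M \<Longrightarrow> d (src a) (r m) = d (src a) (r M) + (m - M)"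
    and m: "M \<le> m" "r m \<in> half a" and k: "m \<le> k"
  shows "r k \<in> half a"
  using k
proof (induction k rule: dec_induct)
  case base then show ?case using m by simp
next
  case (step k)
  obtain b where b: "b \<in> A" "src b = r k" "tgt b = r (Suc k)" using ray_arc[OF r] .
  show ?case
  proof (rule ccontr)
    assume "r (Suc k) \<notin> half a"
    then have "rv b = a" using crossing[OF a, of "rv b"] b step by simp
    then have "src a = r (Suc k)" using b by auto
    then show False using M[of "Suc k"] m step by simp
  qed
qed

text \<open>A single visit to the half-tree after the ray has begun to recede from
  \<open>src a\<close> is permanent.\<close>

lemma evt_criterion:
  assumes r: "r \<in> rays \<Gamma>" and a: "a \<in> A" and inf: "infinite {m. r m \<in> half a}"
  shows "a \<in> evt r"
proof -
  obtain M where M: "\<And>m. m \<ge> M \<Longrightarrow> d (src a) (r m) = d (src a) (r M) + (m - M)"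
    by (rule ray_receding[OF r src_in[OF a]]) (rule that)
  obtain m where m: "m \<ge> M" "r m \<in> half a"
    using inf by (metis (mono_tags, lifting) infinite_nat_iff_unbounded_le mem_Collect_eq)
  have "r k \<in> half a" if "k \<ge> m" for k
    using ray_half_mono[OF r a M m that] .
  then show ?thesis using a by (auto simp: evt_def)
qed

text \<open>Any two half-trees in which \<open>r\<close> finally stays meet, and each edge has a
  side in which \<open>r\<close> finally stays. So these arcs orient every edge, and no two of them
  share an origin.\<close>

lemma evt_confluent:
  assumes r: "r \<in> rays \<Gamma>"
  shows "confluent \<Gamma> (evt r)" and "V \<subseteq> src ` evt r"
proof -
  have both: "half a \<inter> half b \<noteq> {}" if ab: "a \<in> evt r" "b \<in> evt r" for a b
  proof -
    obtain N N' where "\<forall>m\<ge>N. r m \<in> half a" "\<forall>m\<ge>N'. r m \<in> half b"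
      using ab unfolding evt_def by blast
    then have "r (max N N') \<in> half a \<inter> half b" by simp
    then show ?thesis by blast
  qed
  have or: "a \<in> evt r \<or> rv a \<in> evt r" if a: "a \<in> A" for a
  proof (cases "infinite {m. r m \<in> half a}")
    case True then show ?thesis using evt_criterion[OF r a] by simp
  next
    case False
    then have "infinite (- {m. r m \<in> half a})" using infinite_UNIV_nat by (metis Compl_eq_Diff_UNIV finite_Diff2)
    moreover have "- {m. r m \<in> half a} = {m. r m \<in> half (rv a)}"
      using half_rv[OF a] rays_in[OF r] by auto
    ultimately show ?thesis using evt_criterion[OF r rv_in[OF a]] by simp
  qed
  show "confluent \<Gamma> (evt r)"
  proof (rule confluentI)
    show "evt r \<subseteq> A" by (auto simp: evt_def)
    fix a assume a: "a \<in> evt r"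
    then have aA: "a \<in> A" by (simp add: evt_def)
    show "rv a \<notin> evt r" using both[OF a, of "rv a"] half_rv[OF aA] by auto
    fix b assume b: "b \<in> A" "src b = src a" "b \<noteq> a"
    then have "b \<notin> evt r" using both[OF a, of b] half_disjoint[OF aA b(1)] by auto
    then show "rv b \<in> evt r" using or b by blast
  qed
  show "V \<subseteq> src ` evt r"
  proof
    fix v assume v: "v \<in> V"
    obtain M where M: "\<And>m. m \<ge> M \<Longrightarrow> d v (r m) = d v (r M) + (m - M)"
      by (rule ray_receding[OF r v]) (rule that)
    \<comment> \<open>At index \<open>M + 1\<close> the ray is certainly away from \<open>v\<close>,
      so a half-tree at \<open>v\<close> contains it.\<close>
    from M[of "Suc M"] have "d v (r (Suc M)) \<noteq> 0" by simp
    then have "v \<noteq> r (Suc M)" by auto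
    then obtain a where a: "a \<in> A" "src a = v" "r (Suc M) \<in> half a"
      using half_cover[OF v rays_in[OF r]] by metis
    have "r k \<in> half a" if "k \<ge> Suc M" for k
      by (rule ray_half_mono[OF r a(1) M[folded a(2)] _ a(3) that]) simp_all
    then have "a \<in> evt r" using a(1) by (auto simp: evt_def)
    with a(2)
    show "v \<in> src ` evt r" by auto
  qed
qed

lemma ends_rep:
  assumes "\<xi> \<in> ends \<Gamma>"
  obtains r where "r \<in> rays \<Gamma>" "\<xi> = {s \<in> rays \<Gamma>. infinite (range r \<inter> range s)}"
  using assms unfolding ends_def by (auto elim!: quotientE simp: Image_def)

text \<open>If \<open>a\<close> starts a ray \<open>s\<close> of the end, \<open>s\<close> stays in
  \<open>half a\<close> and meets \<open>r\<close> there infinitely often. Conversely, the required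
  ray is obtained by following \<open>evt r\<close> from \<open>src a\<close>: since
  \<open>r\<close> itself follows \<open>evt r\<close>, the two merge.\<close>

lemma towards_end_evt:
  assumes r: "r \<in> rays \<Gamma>" and xi: "\<xi> = {s \<in> rays \<Gamma>. infinite (range r \<inter> range s)}"
  shows "{a \<in> A. towards_end \<Gamma> \<xi> a} = evt r"
proof (intro equalityI subsetI)
  fix a assume "a \<in> {a \<in> A. towards_end \<Gamma> \<xi> a}"
  then obtain s where a: "a \<in> A" and s: "s \<in> rays \<Gamma>" "infinite (range r \<inter> range s)"
    "s 0 = src a" "s 1 = tgt a" by (auto simp: towards_end_def xi)
  have "s m \<in> half a" if "m > 0" for m using ray_half[OF s(1) a _ _ that] s by simp
  \<comment> \<open>\<open>s 0\<close> is \<open>src a\<close>, the only vertex of \<open>s\<close>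
    outside \<open>half a\<close>.\<close>
  then have "range r \<inter> range s \<subseteq> insert (s 0) (r ` {m. r m \<in> half a})"
    by (auto simp: image_iff) (metis gr0I)
  then have "infinite {m. r m \<in> half a}"
    using s(2) by (metis finite_imageI finite_insert finite_subset)
  then show "a \<in> evt r" using evt_criterion[OF r a] by simp
next
  fix a assume ev: "a \<in> evt r"
  then have a: "a \<in> A" by (simp add: evt_def)
  note C = evt_confluent[OF r]
  let ?f = "nxt (evt r)"
  define s where "s = (\<lambda>n. (?f ^^ n) (src a))"
  have s: "s \<in> rays \<Gamma>" unfolding s_def using nxt_ray[OF C src_in[OF a]] .
  have rf: "r (Suc n) = ?f (r n)" for n
  proof -
    obtain b where b: "b \<in> A" "src b = r n" "tgt b = r (Suc n)" using ray_arc[OF r] .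
    then have "b \<in> evt r" using ray_half[OF r b] by (auto simp: evt_def intro!: exI[of _ "Suc n"])
    then show ?thesis using nxt_src[OF C(1)] b by force
  qed
  then have rn: "r n = (?f ^^ n) (r 0)" for n by (induction n) auto
  obtain p q where "(?f ^^ p) (r 0) = (?f ^^ q) (src a)"
    using nxt_merge[OF C rays_in[OF r] src_in[OF a]] by blast
  then have "(?f ^^ i) ((?f ^^ p) (r 0)) = (?f ^^ i) ((?f ^^ q) (src a))" for i by simp
  then have "r (i + p) = s (i + q)" for i
    unfolding s_def rn[of "i + p"] by (simp add: funpow_add)
  then have "r ` {p..} \<subseteq> range r \<inter> range s"
    by (auto simp: image_iff) (metis le_add_diff_inverse2)
  moreover have "infinite (r ` {p..})"
    using r infinite_Ici[of p] by (subst finite_image_iff) (auto simp: rays_def intro: inj_on_subset)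
  ultimately have "infinite (range r \<inter> range s)" using infinite_super by blast
  moreover have "s 0 = src a" "s 1 = tgt a" using nxt_src[OF C(1) ev] by (auto simp: s_def)
  ultimately show "a \<in> {a \<in> A. towards_end \<Gamma> \<xi> a}"
    using s a by (auto simp: towards_end_def xi)
qed

end

section \<open>Automorphisms and geometric density\<close>

lemma subgraph_simps [simp]:
  "verts (subgraph \<Gamma> W B) = W" "arcs (subgraph \<Gamma> W B) = B"
  "orig (subgraph \<Gamma> W B) = orig \<Gamma>" "bar (subgraph \<Gamma> W B) = bar \<Gamma>"
  "targ (subgraph \<Gamma> W B) = targ \<Gamma>"
  by (auto simp: subgraph_def targ_def)

lemma adj_subgraph: "adj (subgraph \<Gamma> W B) = {(orig \<Gamma> a, targ \<Gamma> a) | a. a \<in> B}"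
  by (simp add: adj_def)

section \<open>The automorphism group of a graph\<close>

lemma (in conn_graph) subgroup_aut: "subgroup (aut \<Gamma>) (BijGroup V \<times>\<times> BijGroup A)"
proof -
  interpret DirProd_group: group "BijGroup V \<times>\<times> BijGroup A"
    by (intro DirProd_group group_BijGroup)
  show ?thesis
  proof (rule DirProd_group.subgroupI)
    show "aut \<Gamma> \<subseteq> carrier (BijGroup V \<times>\<times> BijGroup A)"
      by (auto simp: aut_def DirProd_def BijGroup_def)
    have "((\<lambda>x\<in>V. x), (\<lambda>x\<in>A. x)) \<in> aut \<Gamma>"
      by (auto simp: aut_def id_Bij)
    then show "aut \<Gamma> \<noteq> {}" by blast
  next
    fix x assume "x \<in> aut \<Gamma>"
    then obtain f h where x: "x = (f, h)" "f \<in> Bij V" "h \<in> Bij A"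
      and eq: "\<And>a. a \<in> A \<Longrightarrow> f (src a) = src (h a)" "\<And>a. a \<in> A \<Longrightarrow> h (rv a) = rv (h a)"
      by (auto simp: aut_def)
    have f: "inj_on f V" "f ` V = V" and h: "inj_on h A" "h ` A = A"
      using x by (auto simp: Bij_def bij_betw_def)
    let ?f = "\<lambda>v\<in>V. inv_into V f v" and ?h = "\<lambda>a\<in>A. inv_into A h a"
    have c: "f \<in> carrier (BijGroup V)" "h \<in> carrier (BijGroup A)"
      using x by (simp_all add: BijGroup_def)
    have "inv\<^bsub>BijGroup V \<times>\<times> BijGroup A\<^esub> x = (?f, ?h)"
      by (simp add: x(1) inv_DirProd[OF group_BijGroup group_BijGroup c] inv_BijGroup x(2,3))
    moreover have "(?f, ?h) \<in> aut \<Gamma>"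
    proof -
      have "?f (src a) = src (?h a) \<and> ?h (rv a) = rv (?h a)" if "a \<in> A" for a
      proof -
        have "a \<in> h ` A" using that h by simp
        then obtain b where b: "b \<in> A" "a = h b" by blast
        have eqs: "src a = f (src b)" "rv a = h (rv b)"
          using eq[OF b(1)] b(2) by simp_all
        have "?h a = b" using b h that by simp
        moreover have "?f (src a) = src b"
          using src_in[OF that] f(1) b(1) unfolding eqs(1) by simp
        moreover have "?h (rv a) = rv b"
          using rv_in[OF that] h(1) b(1) unfolding eqs(2) by simp
        ultimately show ?thesis by simp
      qed
      then show ?thesis
        using restrict_inv_into_Bij[OF x(2)] restrict_inv_into_Bij[OF x(3)] by (simp add: aut_def)
    qed
    ultimately show "inv\<^bsub>BijGroup V \<times>\<times> BijGroup A\<^esub> x \<in> aut \<Gamma>" by simp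
  next
    fix x y assume "x \<in> aut \<Gamma>" "y \<in> aut \<Gamma>"
    then show "x \<otimes>\<^bsub>BijGroup V \<times>\<times> BijGroup A\<^esub> y \<in> aut \<Gamma>"
      by (auto simp: aut_def DirProd_def BijGroup_def compose_Bij compose_eq dest!: Bij_imp_funcset[of "snd _"] simp: Pi_iff)
        (auto simp: Bij_def bij_betw_def compose_def)
  qed
qed

context conn_graph
begin

abbreviation "AutG \<equiv> aut_group \<Gamma>"

lemma group_aut: "group AutG"
  unfolding aut_group_def
  by (rule subgroup.subgroup_is_group[OF subgroup_aut]) (intro DirProd_group group_BijGroup)

lemma carrier_aut [simp]: "carrier AutG = aut \<Gamma>"
  by (simp add: aut_group_def)

lemma autD:
  assumes "g \<in> aut \<Gamma>"
  shows "fst g \<in> Bij V" "snd g \<in> Bij A"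
    and "a \<in> A \<Longrightarrow> src (snd g a) = fst g (src a)"
    and "a \<in> A \<Longrightarrow> rv (snd g a) = snd g (rv a)"
  using assms by (cases g; simp add: aut_def)+

lemma aut_vert: "\<lbrakk>g \<in> aut \<Gamma>; v \<in> V\<rbrakk> \<Longrightarrow> fst g v \<in> V"
  and aut_arc: "\<lbrakk>g \<in> aut \<Gamma>; a \<in> A\<rbrakk> \<Longrightarrow> snd g a \<in> A"
  using funcset_mem[OF Bij_imp_funcset] autD by metis+

lemmas aut_src = autD(3) and aut_rv = autD(4)

lemma aut_tgt: "\<lbrakk>g \<in> aut \<Gamma>; a \<in> A\<rbrakk> \<Longrightarrow> tgt (snd g a) = fst g (tgt a)"
  using aut_src[of g "rv a"] aut_rv[of g a] by (metis rv_in src_rv)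

lemma aut_inj: "g \<in> aut \<Gamma> \<Longrightarrow> inj_on (fst g) V"
  by (auto simp: aut_def Bij_def bij_betw_def)

lemma aut_one: "v \<in> V \<Longrightarrow> fst \<one>\<^bsub>AutG\<^esub> v = v" "a \<in> A \<Longrightarrow> snd \<one>\<^bsub>AutG\<^esub> a = a"
  by (auto simp: aut_group_def DirProd_def BijGroup_def)

lemma aut_mult:
  assumes "g \<in> aut \<Gamma>" "h \<in> aut \<Gamma>"
  shows "v \<in> V \<Longrightarrow> fst (g \<otimes>\<^bsub>AutG\<^esub> h) v = fst g (fst h v)"
    and "a \<in> A \<Longrightarrow> snd (g \<otimes>\<^bsub>AutG\<^esub> h) a = snd g (snd h a)"
  using assms by (auto simp: aut_def aut_group_def DirProd_def BijGroup_def compose_eq split: prod.splits)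

lemma aut_inv_closed: "g \<in> aut \<Gamma> \<Longrightarrow> inv\<^bsub>AutG\<^esub> g \<in> aut \<Gamma>"
  using group.inv_closed[OF group_aut] by simp

lemma aut_inv:
  assumes g: "g \<in> aut \<Gamma>"
  shows "v \<in> V \<Longrightarrow> fst (inv\<^bsub>AutG\<^esub> g) (fst g v) = v"
    and "v \<in> V \<Longrightarrow> fst g (fst (inv\<^bsub>AutG\<^esub> g) v) = v"
    and "a \<in> A \<Longrightarrow> snd (inv\<^bsub>AutG\<^esub> g) (snd g a) = a"
    and "a \<in> A \<Longrightarrow> snd g (snd (inv\<^bsub>AutG\<^esub> g) a) = a"
  using aut_mult[OF g aut_inv_closed[OF g]] aut_mult[OF aut_inv_closed[OF g] g] aut_one
    group.l_inv[OF group_aut] group.r_inv[OF group_aut] g by (metis carrier_aut)+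

lemma aut_eqI:
  assumes "g \<in> aut \<Gamma>" "h \<in> aut \<Gamma>" "\<And>v. v \<in> V \<Longrightarrow> fst g v = fst h v" "\<And>a. a \<in> A \<Longrightarrow> snd g a = snd h a"
  shows "g = h"
  using assms by (intro prod_eqI extensionalityI[of _ V] extensionalityI[of _ A])
    (auto simp: aut_def Bij_def)

lemma aut_adj: "\<lbrakk>g \<in> aut \<Gamma>; (u, v) \<in> E\<rbrakk> \<Longrightarrow> (fst g u, fst g v) \<in> E"
  by (elim adjE) (metis adjI aut_arc aut_src aut_tgt)

lemma aut_gdist:
  assumes g: "g \<in> aut \<Gamma>" and uv: "u \<in> V" "v \<in> V"
  shows "d (fst g u) (fst g v) = d u v"
proof -
  have pow: "(x, y) \<in> E ^^ n \<Longrightarrow> (fst h x, fst h y) \<in> E ^^ n" if h: "h \<in> aut \<Gamma>" for h x y n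
  proof (induction n arbitrary: y)
    case (Suc n)
    then obtain z where "(x, z) \<in> E ^^ n" "(z, y) \<in> E" by (metis relpow_Suc_E)
    then show ?case using Suc.IH aut_adj[OF h] by (metis relpow_Suc_I)
  qed simp
  have le: "d (fst h x) (fst h y) \<le> d x y" if "h \<in> aut \<Gamma>" "x \<in> V" "y \<in> V" for h x y
    using that gdist_le pow gdist_relpow by blast
  show ?thesis
    using le[OF g uv] le[OF aut_inv_closed[OF g] aut_vert[OF g uv(1)] aut_vert[OF g uv(2)]]
      aut_inv[OF g] uv by simp
qed

lemma aut_half:
  assumes g: "g \<in> aut \<Gamma>" and a: "a \<in> A"
  shows "v \<in> V \<Longrightarrow> fst g v \<in> half (snd g a) \<longleftrightarrow> v \<in> half a"
    and "half (snd g a) = fst g ` half a"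
proof -
  show iff: "v \<in> V \<Longrightarrow> fst g v \<in> half (snd g a) \<longleftrightarrow> v \<in> half a" for v
    using assms by (auto simp: half_def aut_src aut_tgt aut_gdist aut_vert)
  show "half (snd g a) = fst g ` half a"
  proof (intro equalityI subsetI)
    fix w assume w: "w \<in> half (snd g a)"
    then have wV: "w \<in> V" using half_sub by blast
    let ?u = "fst (inv\<^bsub>AutG\<^esub> g) w"
    have "?u \<in> V" "fst g ?u = w" using aut_vert[OF aut_inv_closed[OF g] wV] aut_inv(2)[OF g wV] .
    then show "w \<in> fst g ` half a" using iff[of ?u] w by force
  next
    fix w assume "w \<in> fst g ` half a"
    then show "w \<in> half (snd g a)" using iff half_sub by blast
  qed
qed

end

lemma (in tree) aut_snd_eqI:
  assumes g: "g \<in> aut \<Gamma>" and a: "a \<in> A" "b \<in> A" and "fst g (src a) = src b" "fst g (tgt a) = tgt b"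
  shows "snd g a = b"
  using assms by (intro arc_eqI) (auto simp: aut_arc aut_src aut_tgt)

text \<open>Without multiple edges an automorphism is determined by its action on vertices, so
  identities between products are checked there only.\<close>

lemma (in tree) aut_fst_eqI:
  assumes "g \<in> aut \<Gamma>" "h \<in> aut \<Gamma>" "\<And>v. v \<in> V \<Longrightarrow> fst g v = fst h v"
  shows "g = h"
  using assms by (intro aut_eqI) (auto intro!: aut_snd_eqI simp: aut_arc aut_src aut_tgt)

section \<open>Invariant subtrees and fixed ends as confluent sets\<close>

locale tree_action = tree \<Gamma> for \<Gamma> :: "('v, 'a) agraph" +
  fixes G :: "(('v \<Rightarrow> 'v) \<times> ('a \<Rightarrow> 'a)) set"
  assumes subgroup: "subgroup G (aut_group \<Gamma>)"
begin

lemma G_aut: "g \<in> G \<Longrightarrow> g \<in> aut \<Gamma>"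
  using subgroup.subset[OF subgroup] by auto

lemma G_one: "\<one>\<^bsub>AutG\<^esub> \<in> G"
  and G_mult: "\<lbrakk>g \<in> G; h \<in> G\<rbrakk> \<Longrightarrow> g \<otimes>\<^bsub>AutG\<^esub> h \<in> G"
  and G_inv: "g \<in> G \<Longrightarrow> inv\<^bsub>AutG\<^esub> g \<in> G"
  using subgroup.one_closed[OF subgroup] subgroup.m_closed[OF subgroup]
    subgroup.m_inv_closed[OF subgroup] by auto

lemma invariant_image:
  assumes "S \<subseteq> V" and "\<And>g v. \<lbrakk>g \<in> G; v \<in> S\<rbrakk> \<Longrightarrow> fst g v \<in> S" and g: "g \<in> G"
  shows "fst g ` S = S"
proof (intro equalityI subsetI)
  fix v assume v: "v \<in> S"
  have "fst (inv\<^bsub>AutG\<^esub> g) v \<in> S" using assms(2)[OF G_inv[OF g] v] .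
  moreover have "fst g (fst (inv\<^bsub>AutG\<^esub> g) v) = v" using aut_inv(2)[OF G_aut[OF g]] assms(1) v by blast
  ultimately show "v \<in> fst g ` S" by force
qed (use assms(2)[OF g] in auto)

lemma invariant_image_arcs:
  assumes "S \<subseteq> A" and "\<And>g a. \<lbrakk>g \<in> G; a \<in> S\<rbrakk> \<Longrightarrow> snd g a \<in> S" and g: "g \<in> G"
  shows "snd g ` S = S"
proof (intro equalityI subsetI)
  fix a assume a: "a \<in> S"
  have "snd (inv\<^bsub>AutG\<^esub> g) a \<in> S" using assms(2)[OF G_inv[OF g] a] .
  moreover have "snd g (snd (inv\<^bsub>AutG\<^esub> g) a) = a" using aut_inv(4)[OF G_aut[OF g]] assms(1) a by blast
  ultimately show "a \<in> snd g ` S" by force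
qed (use assms(2)[OF g] in auto)

lemma fixes_endI:
  assumes xi: "\<xi> \<subseteq> rays \<Gamma>" and "\<And>g s. \<lbrakk>g \<in> G; s \<in> \<xi>\<rbrakk> \<Longrightarrow> fst g \<circ> s \<in> \<xi>"
  shows "fixes_end G \<xi>"
  unfolding fixes_end_def
proof (intro ballI equalityI subsetI)
  fix g s assume g: "g \<in> G" and s: "s \<in> \<xi>"
  have "fst g \<circ> (fst (inv\<^bsub>AutG\<^esub> g) \<circ> s) = s"
    using aut_inv(2)[OF G_aut[OF g]] rays_in[of s] xi s by (auto simp: fun_eq_iff)
  moreover have "fst (inv\<^bsub>AutG\<^esub> g) \<circ> s \<in> \<xi>" using assms(2)[OF G_inv[OF g] s] .
  ultimately show "s \<in> (\<lambda>r. fst g \<circ> r) ` \<xi>" by (metis imageI)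
qed (use assms in auto)

text \<open>Invariance of \<open>D\<close> makes the flow commute with \<open>G\<close>. Thus each
  \<open>g\<close> sends the flow line \<open>r\<close> to another flow line, which merges with
  \<open>r\<close>.\<close>

lemma confluent_imp_fixed_end:
  assumes D: "confluent \<Gamma> D" and total: "V \<subseteq> src ` D" and inv: "\<And>g a. \<lbrakk>g \<in> G; a \<in> D\<rbrakk> \<Longrightarrow> snd g a \<in> D"
  shows "\<exists>\<xi>\<in>ends \<Gamma>. fixes_end G \<xi>"
proof -
  let ?f = "nxt D"
  obtain v0 where v0: "v0 \<in> V" using nonempty by blast
  define r where "r = (\<lambda>n. (?f ^^ n) v0)"
  have r: "r \<in> rays \<Gamma>" unfolding r_def by (rule nxt_ray[OF D total v0])
  define \<xi> where "\<xi> = {s \<in> rays \<Gamma>. infinite (range r \<inter> range s)}"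
  let ?R = "{(r, s). r \<in> rays \<Gamma> \<and> s \<in> rays \<Gamma> \<and> infinite (range r \<inter> range s)}"
  have "\<xi> = ?R `` {r}" using r by (auto simp: \<xi>_def)
  moreover have "?R `` {r} \<in> ends \<Gamma>" unfolding ends_def by (rule quotientI[OF r])
  ultimately have "\<xi> \<in> ends \<Gamma>" by (simp only:)
  moreover have "fixes_end G \<xi>"
  proof (rule fixes_endI)
    show "\<xi> \<subseteq> rays \<Gamma>" by (auto simp: \<xi>_def)
    fix g s assume g: "g \<in> G" and "s \<in> \<xi>"
    then have s: "s \<in> rays \<Gamma>" and inf: "infinite (range r \<inter> range s)" by (auto simp: \<xi>_def)
    note ga = G_aut[OF g]
    have f_eq: "?f (fst g v) = fst g (?f v)" if v: "v \<in> V" for v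
    proof -
      obtain a where a: "a \<in> D" "a \<in> A" "src a = v" "?f v = tgt a" using out_arc[OF D total v] .
      then show ?thesis using nxt_src[OF D inv[OF g a(1)]] aut_src[OF ga a(2)] aut_tgt[OF ga a(2)] by simp
    qed
    have pow: "(?f ^^ n) (fst g v) = fst g ((?f ^^ n) v)" if v: "v \<in> V" for n v
      by (induction n) (simp_all add: f_eq nxt_pow_in[OF D total v])
    obtain m p where mp: "(?f ^^ m) (fst g v0) = (?f ^^ p) v0"
      using nxt_merge[OF D total aut_vert[OF ga v0] v0] by blast
    \<comment> \<open>From index \<open>m\<close> on, \<open>g\<close> shifts \<open>r\<close> along
      itself, by \<open>p - m\<close> places, possibly backwards.\<close>
    have gr: "fst g (r (n + m)) = r (n + p)" for n
      unfolding r_def using pow[OF v0, of "n + m"] mp by (simp add: funpow_add)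
    have gs: "fst g \<circ> s \<in> rays \<Gamma>"
      using s aut_adj[OF ga] rays_in[OF s] inj_onD[OF aut_inj[OF ga]]
      unfolding rays_def by (auto simp: inj_def)
    \<comment> \<open>Dropping the finitely many vertices before index \<open>m\<close> keeps the
      intersection infinite, and \<open>g\<close> maps what is left into \<open>r\<close>.\<close>
    have "infinite (range r \<inter> range s - r ` {..<m})" using inf by simp
    then have "infinite (fst g ` (range r \<inter> range s - r ` {..<m}))"
      using rays_in[OF r] by (subst finite_image_iff) (auto intro: inj_on_subset[OF aut_inj[OF ga]])
    moreover have "fst g ` (range r \<inter> range s - r ` {..<m}) \<subseteq> range r \<inter> range (fst g \<circ> s)"
    proof
      fix x assume "x \<in> fst g ` (range r \<inter> range s - r ` {..<m})"
      then obtain y where y: "x = fst g y" "y \<in> range r" "y \<in> range s" "y \<notin> r ` {..<m}" by blast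
      then obtain n k where n: "y = r n" and k: "y = s k" by blast
      then have x: "x = fst g (r n)" "r n = s k" "n \<ge> m" using y by (auto simp: not_less[symmetric])
      then have "x = r (n - m + p)" using gr[of "n - m"] by simp
      moreover have "x = (fst g \<circ> s) k" using x by simp
      ultimately show "x \<in> range r \<inter> range (fst g \<circ> s)" by blast
    qed
    ultimately have "infinite (range r \<inter> range (fst g \<circ> s))" using infinite_super by blast
    then show "fst g \<circ> s \<in> \<xi>" using gs by (simp add: \<xi>_def)
  qed
  ultimately show ?thesis by blast
qed

end

text \<open>If the edge of \<open>a\<close> is directed out of \<open>half a\<close>, confluence at
  \<open>tgt a\<close> directs all further edges there towards \<open>tgt a\<close>, and this
  propagates through the half-tree.\<close>

lemma (in tree) confluent_half:
  assumes D: "confluent \<Gamma> D" and a: "a \<in> A" "rv a \<in> D" and w: "w \<in> half a"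
  shows "w \<in> src ` D"
  using a w
proof (induction "d w (tgt a)" arbitrary: a rule: less_induct)
  case less
  have w: "w \<in> V" using less half_sub by blast
  show ?case
  proof (cases "w = tgt a")
    case True
    then show ?thesis using less by (metis imageI src_rv)
  next
    case False
    then obtain b where b: "b \<in> A" "src b = tgt a" "w \<in> half b"
      using half_cover[of "tgt a" w] w less by (metis tgt_in)
    have "b \<noteq> rv a" using b less half_rv[of a] by auto
    then have "rv b \<in> D" using confluentD(3)[OF D less(3)] b by simp
    moreover have "d w (tgt b) < d w (tgt a)" using b by (simp add: half_def)
    ultimately show ?thesis using less(1) b by blast
  qed
qed

text \<open>The arc of \<open>D\<close> at \<open>tgt a\<close> must be \<open>rv a\<close>: any
  other would put \<open>a\<close> itself into \<open>D\<close>. So all of \<open>half a\<close>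
  drains through \<open>src a\<close>.\<close>

lemma (in tree) confluent_convex:
  assumes D: "confluent \<Gamma> D" and a: "a \<in> A" "src a \<notin> src ` D" "tgt a \<in> src ` D"
  shows "half a \<subseteq> src ` D"
proof -
  obtain c where c: "c \<in> D" "src c = tgt a" using a by auto
  have "c = rv a"
    using confluentD(3)[OF D c(1), of "rv a"] a c by force
  then show ?thesis using confluent_half[OF D a(1)] c by blast
qed

context tree_action
begin

text \<open>The vertices without outgoing arc in \<open>D\<close> are convex by
  \<open>confluent_convex\<close>, hence connected; since \<open>D\<close> is nonempty they are not
  all of \<open>V\<close>.\<close>

lemma confluent_imp_subtree:
  assumes D: "confluent \<Gamma> D" and "D \<noteq> {}" and total: "\<not> V \<subseteq> src ` D"
    and inv: "\<And>g a. \<lbrakk>g \<in> G; a \<in> D\<rbrakk> \<Longrightarrow> snd g a \<in> D"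
  shows "\<exists>W B. is_subtree \<Gamma> W B \<and> (W, B) \<noteq> (V, A) \<and> preserves_subgraph G W B"
proof -
  define W where "W = V - src ` D"
  define B where "B = {a \<in> A. src a \<in> W \<and> tgt a \<in> W}"
  have DA: "D \<subseteq> A" using D by (simp add: confluent_def)
  have inv_W: "fst g v \<in> W" if g: "g \<in> G" and v: "v \<in> W" for g v
  proof -
    have "fst g v \<notin> src ` D"
    proof
      assume "fst g v \<in> src ` D"
      then obtain a where a: "a \<in> D" "src a = fst g v" by auto
      have "src (snd (inv\<^bsub>AutG\<^esub> g) a) = v"
        using a v aut_src[OF G_aut[OF G_inv[OF g]]] DA aut_inv(1)[OF G_aut[OF g]] by (auto simp: W_def)
      then show False using inv[OF G_inv[OF g] a(1)] v unfolding W_def by blast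
    qed
    then show ?thesis using v aut_vert[OF G_aut[OF g]] by (simp add: W_def)
  qed
  have "preserves_subgraph G W B" unfolding preserves_subgraph_def
  proof (intro ballI conjI)
    fix g assume g: "g \<in> G"
    show "fst g ` W = W" by (rule invariant_image[OF _ inv_W g]) (auto simp: W_def)
    show "snd g ` B = B"
      by (rule invariant_image_arcs[OF _ _ g])
        (auto simp: B_def aut_arc[OF G_aut] aut_src[OF G_aut] aut_tgt[OF G_aut] inv_W)
  qed
  moreover have "is_subtree \<Gamma> W B" unfolding is_subtree_def is_subgraph_def
  proof (intro conjI)
    show "W \<subseteq> V" "B \<subseteq> A" by (auto simp: W_def B_def)
    show "is_graph (subgraph \<Gamma> W B)" by (auto simp: is_graph_def B_def)
    show "W \<noteq> {}" using total by (auto simp: W_def)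
    have "(u, w) \<in> (adj (subgraph \<Gamma> W B))\<^sup>*" if "u \<in> W" "w \<in> W" for u w
      using that
    proof (induction "d w u" arbitrary: u rule: less_induct)
      case less
      show ?case
      proof (cases "u = w")
        case False
        have uw: "u \<in> V" "w \<in> V" using less by (auto simp: W_def)
        obtain a where a: "a \<in> A" "src a = u" "w \<in> half a" using half_cover[OF uw False] .
        have "src a \<notin> src ` D" "w \<notin> src ` D" using a(2) less.prems by (simp_all add: W_def)
        \<comment> \<open>Otherwise \<open>confluent_convex\<close> would give \<open>w\<close> an
          outgoing arc as well.\<close>
        then have t: "tgt a \<in> W"
          using confluent_convex[OF D a(1)] a(1,3) by (auto simp: W_def)
        then have "a \<in> B" using a less by (simp add: B_def)
        then have "(u, tgt a) \<in> adj (subgraph \<Gamma> W B)"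
          using a(2) by (auto simp: adj_subgraph)
        moreover have "(tgt a, w) \<in> (adj (subgraph \<Gamma> W B))\<^sup>*"
          using less t a by (auto simp: half_def)
        ultimately show ?thesis by (rule converse_rtrancl_into_rtrancl)
      qed simp
    qed
    then show "connected_graph (subgraph \<Gamma> W B)" by (simp add: connected_graph_def)
  qed
  moreover have "W \<noteq> V"
  proof -
    obtain a where "a \<in> D" using \<open>D \<noteq> {}\<close> by blast
    then have "src a \<in> V" "src a \<notin> W" using DA by (auto simp: W_def)
    then show ?thesis by blast
  qed
  ultimately show ?thesis by blast
qed

text \<open>The arcs pointing towards the subtree are those whose half-tree contains
  \<open>W\<close>; confluence holds because half-trees at a common origin are disjoint.\<close>

lemma subtree_imp_confluent:
  assumes sub: "is_subtree \<Gamma> W B" and ne: "(W, B) \<noteq> (V, A)" and pres: "preserves_subgraph G W B"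
  shows "\<exists>D. confluent \<Gamma> D \<and> D \<noteq> {} \<and> (\<forall>g\<in>G. \<forall>a\<in>D. snd g a \<in> D)"
proof -
  let ?S = "subgraph \<Gamma> W B"
  have W: "W \<subseteq> V" "W \<noteq> {}" and B: "B \<subseteq> A" and gS: "is_graph ?S" and cS: "connected_graph ?S"
    using sub by (auto simp: is_subtree_def is_subgraph_def)
  have Bsrc: "src a \<in> W" "rv a \<in> B" if "a \<in> B" for a
    using gS that by (auto simp: is_graph_def)
  \<comment> \<open>Inside the subtree a walk cannot cross the edge of \<open>a\<close>, because
    neither \<open>a\<close> nor its reverse is among its arcs.\<close>
  have stay: "x \<in> half a" if a: "a \<in> A" and aB: "a \<notin> B" and y: "y \<in> half a" and yx: "(y, x) \<in> (adj ?S)\<^sup>*" for a x y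
    using yx
  proof (induction rule: rtrancl_induct)
    case base then show ?case using y .
  next
    case (step z x)
    then obtain b where b: "b \<in> B" "src b = z" "tgt b = x" by (auto simp: adj_subgraph)
    have "rv b \<noteq> a" using Bsrc(2)[OF b(1)] aB by blast
    then show ?case using crossing[OF a, of "rv b"] b step subsetD[OF B b(1)] by auto
  qed
  have side: "W \<subseteq> half a" if "a \<in> A" "a \<notin> B" "y \<in> half a" "y \<in> W" for a y
    using stay[OF that(1-3)] cS that(4) by (auto simp: connected_graph_def)
  \<comment> \<open>A proper subtree could in principle miss only arcs; but a missing arc has all of
    \<open>W\<close> on one side, so it has an end outside \<open>W\<close>.\<close>
  have "W \<noteq> V"
  proof
    assume WV: "W = V"
    then obtain a where a: "a \<in> A" "a \<notin> B" using ne B by blast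
    have "src a \<in> half a" using side[OF a tgt_in_half[OF a(1)]] src_in[OF a(1)] tgt_in[OF a(1)] WV by blast
    then show False using a by simp
  qed
  then obtain v where v: "v \<in> V" "v \<notin> W" using W by blast
  obtain w where w: "w \<in> W" using W by blast
  define D where "D = {a \<in> A. W \<subseteq> half a}"
  have "confluent \<Gamma> D"
  proof (rule confluentI)
    show "D \<subseteq> A" by (auto simp: D_def)
    fix a assume a: "a \<in> D"
    then have aA: "a \<in> A" "W \<subseteq> half a" by (auto simp: D_def)
    show "rv a \<notin> D" using aA half_rv[OF aA(1)] w by (auto simp: D_def)
    fix b assume b: "b \<in> A" "src b = src a" "b \<noteq> a"
    then have "half a \<inter> half b = {}" using half_disjoint aA by metis
    then show "rv b \<in> D" using b aA half_rv[OF b(1)] W by (auto simp: D_def)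
  qed
  moreover have "D \<noteq> {}"
  proof -
    have "(v, w) \<in> E\<^sup>*" using conn v w W by (auto simp: connected_graph_def)
    then have "\<exists>a. a \<in> A \<and> src a \<notin> W \<and> tgt a \<in> W"
      using v
    proof (induction rule: converse_rtrancl_induct)
      case base then show ?case using w by simp
    next
      case (step y z)
      then show ?case by (cases "z \<in> W") (auto elim!: adjE)
    qed
    then obtain a where a: "a \<in> A" "src a \<notin> W" "tgt a \<in> W" by blast
    then have "a \<notin> B" using Bsrc(1) by blast
    then have "W \<subseteq> half a" using side[OF a(1) _ tgt_in_half[OF a(1)] a(3)] by blast
    then show ?thesis using a by (auto simp: D_def)
  qed
  moreover have "snd g a \<in> D" if g: "g \<in> G" and a: "a \<in> D" for g a
  proof -
    have "fst g ` W = W" using pres g by (auto simp: preserves_subgraph_def)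
    moreover have aA: "a \<in> A" "W \<subseteq> half a" using a by (auto simp: D_def)
    ultimately have "W \<subseteq> half (snd g a)" using aut_half(2)[OF G_aut[OF g] aA(1)] by (metis image_mono)
    then show ?thesis using aut_arc[OF G_aut[OF g] aA(1)] by (simp add: D_def)
  qed
  ultimately show ?thesis by blast
qed

lemma end_imp_confluent:
  assumes xi: "\<xi> \<in> ends \<Gamma>" and fxd: "fixes_end G \<xi>"
  shows "\<exists>D. confluent \<Gamma> D \<and> D \<noteq> {} \<and> (\<forall>g\<in>G. \<forall>a\<in>D. snd g a \<in> D)"
proof -
  obtain r where r: "r \<in> rays \<Gamma>" "\<xi> = {s \<in> rays \<Gamma>. infinite (range r \<inter> range s)}"
    using ends_rep[OF xi] .
  let ?D = "{a \<in> A. towards_end \<Gamma> \<xi> a}"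
  have "confluent \<Gamma> ?D" "V \<subseteq> src ` ?D"
    unfolding towards_end_evt[OF r] by (rule evt_confluent[OF r(1)])+
  moreover have "snd g a \<in> ?D" if g: "g \<in> G" and a: "a \<in> ?D" for g a
  proof -
    obtain s where s: "s \<in> \<xi>" "s 0 = src a" "s 1 = tgt a" using a by (auto simp: towards_end_def)
    have "fst g \<circ> s \<in> \<xi>" using fxd g s unfolding fixes_end_def by blast
    moreover have "(fst g \<circ> s) 0 = src (snd g a)" "(fst g \<circ> s) 1 = tgt (snd g a)"
      using s a aut_src[OF G_aut[OF g]] aut_tgt[OF G_aut[OF g]] by auto
    ultimately show ?thesis using a aut_arc[OF G_aut[OF g]] unfolding towards_end_def by blast
  qed
  ultimately show ?thesis using nonempty by blast
qed

theorem geometrically_dense_iff: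
  "geometrically_dense \<Gamma> G \<longleftrightarrow> \<not> (\<exists>D. confluent \<Gamma> D \<and> D \<noteq> {} \<and> (\<forall>g\<in>G. \<forall>a\<in>D. snd g a \<in> D))"
proof
  assume dense: "geometrically_dense \<Gamma> G"
  show "\<not> (\<exists>D. confluent \<Gamma> D \<and> D \<noteq> {} \<and> (\<forall>g\<in>G. \<forall>a\<in>D. snd g a \<in> D))"
  proof (intro notI, elim exE conjE)
    fix D assume D: "confluent \<Gamma> D" "D \<noteq> {}" "\<forall>g\<in>G. \<forall>a\<in>D. snd g a \<in> D"
    show False
    proof (cases "V \<subseteq> src ` D")
      case True
      then show False
        using confluent_imp_fixed_end[OF D(1)] D(3) dense by (simp add: geometrically_dense_def)
    next
      case False
      then show False
        using confluent_imp_subtree[OF D(1,2)] D(3) dense by (simp add: geometrically_dense_def)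
    qed
  qed
next
  assume "\<not> (\<exists>D. confluent \<Gamma> D \<and> D \<noteq> {} \<and> (\<forall>g\<in>G. \<forall>a\<in>D. snd g a \<in> D))"
  then show "geometrically_dense \<Gamma> G"
    unfolding geometrically_dense_def using subtree_imp_confluent end_imp_confluent by blast
qed

end

section \<open>Orientations of the quotient\<close>

context tree_action
begin

section \<open>Orbits and the quotient graph\<close>

definition orb_v :: "'v \<Rightarrow> 'v set" where "orb_v v = orbit (sub_group \<Gamma> G) fst v"
definition orb_a :: "'a \<Rightarrow> 'a set" where "orb_a a = orbit (sub_group \<Gamma> G) snd a"

abbreviation "Q \<equiv> quotient_graph \<Gamma> G"

lemma orb_v_eq: "orb_v v = (\<lambda>g. fst g v) ` G"
  and orb_a_eq: "orb_a a = (\<lambda>g. snd g a) ` G"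
  unfolding orb_v_def orb_a_def orbit_def image_def by (simp_all add: Bex_def conj_commute)

lemma orb_v_iff:
  assumes uv: "u \<in> V" "v \<in> V" shows "orb_v u = orb_v v \<longleftrightarrow> (\<exists>g\<in>G. fst g u = v)"
proof
  assume "orb_v u = orb_v v"
  moreover have "v \<in> orb_v v" using aut_one(1)[OF uv(2)] G_one unfolding orb_v_eq by force
  ultimately have "v \<in> orb_v u" by simp
  then show "\<exists>g\<in>G. fst g u = v" unfolding orb_v_eq by blast
next
  assume "\<exists>g\<in>G. fst g u = v"
  then obtain g where g: "g \<in> G" "fst g u = v" ..
  note ga = G_aut[OF g(1)]
  have "fst h u \<in> orb_v v" if h: "h \<in> G" for h
  proof -
    have "fst (h \<otimes>\<^bsub>AutG\<^esub> inv\<^bsub>AutG\<^esub> g) v = fst h u"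
      using aut_mult(1)[OF G_aut[OF h] aut_inv_closed[OF ga] uv(2)] aut_inv(1)[OF ga uv(1)] g(2) by simp
    then show ?thesis unfolding orb_v_eq using G_mult[OF h G_inv[OF g(1)]] by force
  qed
  moreover have "fst h v \<in> orb_v u" if h: "h \<in> G" for h
  proof -
    have "fst (h \<otimes>\<^bsub>AutG\<^esub> g) u = fst h v"
      using aut_mult(1)[OF G_aut[OF h] ga uv(1)] g(2) by simp
    then show ?thesis unfolding orb_v_eq using G_mult[OF h g(1)] by force
  qed
  ultimately show "orb_v u = orb_v v" unfolding orb_v_eq by blast
qed

lemma orb_a_iff:
  assumes ab: "a \<in> A" "b \<in> A" shows "orb_a a = orb_a b \<longleftrightarrow> (\<exists>g\<in>G. snd g a = b)"
proof
  assume "orb_a a = orb_a b"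
  moreover have "b \<in> orb_a b" using aut_one(2)[OF ab(2)] G_one unfolding orb_a_eq by force
  ultimately have "b \<in> orb_a a" by simp
  then show "\<exists>g\<in>G. snd g a = b" unfolding orb_a_eq by blast
next
  assume "\<exists>g\<in>G. snd g a = b"
  then obtain g where g: "g \<in> G" "snd g a = b" ..
  note ga = G_aut[OF g(1)]
  have "snd h a \<in> orb_a b" if h: "h \<in> G" for h
  proof -
    have "snd (h \<otimes>\<^bsub>AutG\<^esub> inv\<^bsub>AutG\<^esub> g) b = snd h a"
      using aut_mult(2)[OF G_aut[OF h] aut_inv_closed[OF ga] ab(2)] aut_inv(3)[OF ga ab(1)] g(2) by simp
    then show ?thesis unfolding orb_a_eq using G_mult[OF h G_inv[OF g(1)]] by force
  qed
  moreover have "snd h b \<in> orb_a a" if h: "h \<in> G" for h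
  proof -
    have "snd (h \<otimes>\<^bsub>AutG\<^esub> g) a = snd h b"
      using aut_mult(2)[OF G_aut[OF h] ga ab(1)] g(2) by simp
    then show ?thesis unfolding orb_a_eq using G_mult[OF h g(1)] by force
  qed
  ultimately show "orb_a a = orb_a b" unfolding orb_a_eq by blast
qed

lemma Q_simps:
  "verts Q = orb_v ` V" "arcs Q = orb_a ` A"
  "a \<in> A \<Longrightarrow> orig Q (orb_a a) = orb_v (src a)"
  "a \<in> A \<Longrightarrow> bar Q (orb_a a) = orb_a (rv a)"
  "a \<in> A \<Longrightarrow> targ Q (orb_a a) = orb_v (tgt a)"
proof -
  show "verts Q = orb_v ` V" "arcs Q = orb_a ` A"
    by (auto simp: quotient_graph_def orbits_def orb_v_def orb_a_def)
  show o: "a \<in> A \<Longrightarrow> orig Q (orb_a a) = orb_v (src a)" for a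
    by (auto simp: quotient_graph_def orb_v_eq orb_a_eq image_image aut_src[OF G_aut])
  show b: "a \<in> A \<Longrightarrow> bar Q (orb_a a) = orb_a (rv a)" for a
    by (auto simp: quotient_graph_def orb_v_eq orb_a_eq image_image aut_rv[OF G_aut])
  show "a \<in> A \<Longrightarrow> targ Q (orb_a a) = orb_v (tgt a)" for a
    using b[of a] o[of "rv a"] by (simp add: targ_def[of Q])
qed

lemma conn_graph_Q: "conn_graph Q"
proof
  show "is_graph Q" by (auto simp: is_graph_def Q_simps)
  have "(orb_v u, orb_v v) \<in> (adj Q)\<^sup>*" if "u \<in> V" "v \<in> V" for u v
  proof -
    have "(u, v) \<in> E\<^sup>*" using conn that by (auto simp: connected_graph_def)
    then show ?thesis
    proof (induction rule: rtrancl_induct)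
      case (step y z)
      then obtain a where a: "a \<in> A" "src a = y" "tgt a = z" by (auto elim: adjE)
      then have "(orb_v y, orb_v z) \<in> adj Q"
        unfolding adj_def using Q_simps by (force intro!: exI[of _ "orb_a a"])
      with step show ?case by simp
    qed simp
  qed
  then show "connected_graph Q" by (auto simp: connected_graph_def Q_simps)
qed

text \<open>Any representative of \<open>\<beta>\<close> starts in the orbit of \<open>v\<close>,
  and a group element carries it to \<open>v\<close> itself.\<close>

lemma arc_lift:
  assumes b: "\<beta> \<in> arcs Q" and v: "v \<in> V" "orig Q \<beta> = orb_v v"
  obtains a where "a \<in> A" "src a = v" "orb_a a = \<beta>"
proof -
  obtain b where b: "b \<in> A" "\<beta> = orb_a b" using b by (auto simp: Q_simps)
  then have "orb_v (src b) = orb_v v" using v by (simp add: Q_simps)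
  then obtain g where g: "g \<in> G" "fst g (src b) = v" using orb_v_iff b v by auto
  have "snd g b \<in> A" "src (snd g b) = v"
    using aut_arc[OF G_aut[OF g(1)] b(1)] aut_src[OF G_aut[OF g(1)] b(1)] g by auto
  moreover have "orb_a (snd g b) = \<beta>" using orb_a_iff[of b "snd g b"] calculation b g by auto
  ultimately show ?thesis using that by blast
qed

text \<open>\<open>col\<close> is read off at the chosen representative of the vertex orbit. An
  element of \<open>G\<close> carrying \<open>src a\<close> there gives a bijection with the arcs at
  \<open>src a\<close>, so the condition no longer depends on the choice.\<close>

lemma card_col:
  assumes diag: "is_local_action_diagram \<Gamma> G \<Delta>" and a: "a \<in> A"
  shows "card (col \<Delta> (orb_a a)) = 1 \<longleftrightarrow> (\<forall>b\<in>A. src b = src a \<and> orb_a b = orb_a a \<longrightarrow> b = a)"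
proof -
  obtain c where base: "base \<Delta> = Q"
    and c: "\<And>v \<alpha>. \<lbrakk>v \<in> verts Q; \<alpha> \<in> star Q v\<rbrakk> \<Longrightarrow>
      c v \<in> v \<and> col \<Delta> \<alpha> = {b \<in> star \<Gamma> (c v). orb_a b = \<alpha>}"
    using diag unfolding is_local_action_diagram_def orb_a_def by fastforce
  define v where "v = orb_v (src a)"
  have "v \<in> verts Q" "orb_a a \<in> star Q v" using a by (auto simp: v_def star_def Q_simps)
  from c[OF this] have cv: "c v \<in> orb_v (src a)" and col: "col \<Delta> (orb_a a) = {b \<in> star \<Gamma> (c v). orb_a b = orb_a a}"
    by (auto simp: v_def)
  obtain g where g: "g \<in> G" "c v = fst g (src a)" using cv by (auto simp: orb_v_eq)
  note ga = G_aut[OF g(1)]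
  let ?S = "{b \<in> A. src b = src a \<and> orb_a b = orb_a a}"
  have orb_g: "orb_a (snd h b) = orb_a b" if "h \<in> G" "b \<in> A" for h b
    using orb_a_iff[of b "snd h b"] that aut_arc[OF G_aut] by blast
  have "col \<Delta> (orb_a a) = snd g ` ?S"
  proof (intro equalityI subsetI)
    fix b assume "b \<in> col \<Delta> (orb_a a)"
    then have b: "b \<in> A" "src b = fst g (src a)" "orb_a b = orb_a a" by (auto simp: col star_def g)
    let ?b = "snd (inv\<^bsub>AutG\<^esub> g) b"
    note gi = aut_inv_closed[OF ga]
    have "?b \<in> ?S"
      using aut_arc[OF gi b(1)] aut_src[OF gi b(1)] aut_inv(1)[OF ga src_in[OF a]] b orb_g[OF G_inv[OF g(1)] b(1)]
      by simp
    moreover have "b = snd g ?b" using aut_inv(4)[OF ga b(1)] by simp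
    ultimately show "b \<in> snd g ` ?S" by blast
  next
    fix b assume "b \<in> snd g ` ?S"
    then show "b \<in> col \<Delta> (orb_a a)"
      using orb_g[OF g(1)] aut_arc[OF ga] aut_src[OF ga] by (auto simp: col star_def g)
  qed
  moreover have "inj_on (snd g) ?S"
    using aut_inv(3)[OF ga] by (intro inj_on_inverseI[of _ "snd (inv\<^bsub>AutG\<^esub> g)"]) auto
  ultimately have "card (col \<Delta> (orb_a a)) = card ?S" by (simp add: card_image)
  moreover have "card ?S = 1 \<longleftrightarrow> (\<forall>b\<in>?S. b = a)"
  proof
    assume "card ?S = 1"
    then obtain x where x: "?S = {x}" by (rule card_1_singletonE)
    moreover have "a \<in> ?S" using a by simp
    ultimately show "\<forall>b\<in>?S. b = a" by (metis singletonD)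
  next
    assume "\<forall>b\<in>?S. b = a"
    then have "?S = {a}" using a by blast
    then show "card ?S = 1" by simp
  qed
  ultimately show ?thesis by auto
qed

section \<open>Transfer of confluent sets between tree and quotient\<close>

lemma confluent_project:
  assumes D: "confluent \<Gamma> D" and inv: "\<And>g a. \<lbrakk>g \<in> G; a \<in> D\<rbrakk> \<Longrightarrow> snd g a \<in> D"
    and diag: "is_local_action_diagram \<Gamma> G \<Delta>"
  shows "confluent Q (orb_a ` D)" and "\<forall>\<beta>\<in>orb_a ` D. card (col \<Delta> \<beta>) = 1"
proof -
  have DA: "D \<subseteq> A" using D by (simp add: confluent_def)
  \<comment> \<open>An invariant set is a union of orbits, so membership can be tested in the
    quotient.\<close>
  have mem: "a \<in> D" if a: "a \<in> A" "orb_a a \<in> orb_a ` D" for a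
  proof -
    obtain b where "b \<in> D" "orb_a b = orb_a a" using a by force
    then show ?thesis using orb_a_iff[of b a] a DA inv by blast
  qed
  show "confluent Q (orb_a ` D)"
  proof (rule confluentI)
    show "orb_a ` D \<subseteq> arcs Q" using DA by (auto simp: Q_simps)
    fix \<alpha> assume "\<alpha> \<in> orb_a ` D"
    then obtain a where a: "a \<in> D" "\<alpha> = orb_a a" "a \<in> A" using DA by blast
    show "bar Q \<alpha> \<notin> orb_a ` D"
      using mem[of "rv a"] confluentD(2)[OF D a(1)] a by (auto simp: Q_simps)
    fix \<beta> assume b: "\<beta> \<in> arcs Q" "orig Q \<beta> = orig Q \<alpha>" "\<beta> \<noteq> \<alpha>"
    then obtain b where b': "b \<in> A" "src b = src a" "orb_a b = \<beta>"
      using arc_lift[OF b(1) src_in[OF a(3)]] a by (auto simp: Q_simps)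
    then have "rv b \<in> D" using confluentD(3)[OF D a(1)] b a by auto
    then show "bar Q \<beta> \<in> orb_a ` D" using b' by (auto simp: Q_simps)
  qed
  show "\<forall>\<beta>\<in>orb_a ` D. card (col \<Delta> \<beta>) = 1"
  proof
    fix \<beta> assume "\<beta> \<in> orb_a ` D"
    then obtain a where a: "a \<in> D" "\<beta> = orb_a a" "a \<in> A" using DA by blast
    have "b = a" if b: "b \<in> A" "src b = src a" "orb_a b = orb_a a" for b
      using mem[of b] confluent_unique[OF D _ a(1) b(2)] b a by auto
    then show "card (col \<Delta> \<beta>) = 1" using card_col[OF diag a(3)] a by simp
  qed
qed

text \<open>An arc \<open>b\<close> at the origin of \<open>a\<close> and in the same orbit would
  escape confluence in the quotient, which speaks only of different orbits; \<open>|X_a| = 1\<close>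
  excludes such a \<open>b\<close>.\<close>

lemma confluent_lift:
  assumes D: "confluent Q D" and single: "\<And>\<beta>. \<beta> \<in> D \<Longrightarrow> card (col \<Delta> \<beta>) = 1"
    and diag: "is_local_action_diagram \<Gamma> G \<Delta>"
  shows "confluent \<Gamma> {a \<in> A. orb_a a \<in> D}"
proof (rule confluentI)
  fix a assume "a \<in> {a \<in> A. orb_a a \<in> D}"
  then have a: "a \<in> A" "orb_a a \<in> D" by auto
  show "rv a \<notin> {a \<in> A. orb_a a \<in> D}"
    using confluentD(2)[OF D a(2)] a by (simp add: Q_simps)
  fix b assume b: "b \<in> A" "src b = src a" "b \<noteq> a"
  then have "orb_a b \<noteq> orb_a a" using card_col[OF diag a(1)] single[OF a(2)] by auto
  then have "bar Q (orb_a b) \<in> D"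
    using confluentD(3)[OF D a(2), of "orb_a b"] a b by (simp add: Q_simps)
  then show "rv b \<in> {a \<in> A. orb_a a \<in> D}" using b by (simp add: Q_simps)
qed auto

theorem geometrically_dense_iff_quotient:
  assumes diag: "is_local_action_diagram \<Gamma> G \<Delta>"
  shows "geometrically_dense \<Gamma> G \<longleftrightarrow>
    \<not> (\<exists>D. confluent Q D \<and> D \<noteq> {} \<and> (\<forall>\<beta>\<in>D. card (col \<Delta> \<beta>) = 1))"
proof -
  have "(\<exists>D. confluent \<Gamma> D \<and> D \<noteq> {} \<and> (\<forall>g\<in>G. \<forall>a\<in>D. snd g a \<in> D)) \<longleftrightarrow>
    (\<exists>D. confluent Q D \<and> D \<noteq> {} \<and> (\<forall>\<beta>\<in>D. card (col \<Delta> \<beta>) = 1))"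
  proof (intro iffI; elim exE conjE)
    fix D assume "confluent \<Gamma> D" "D \<noteq> {}" "\<forall>g\<in>G. \<forall>a\<in>D. snd g a \<in> D"
    then show "\<exists>D. confluent Q D \<and> D \<noteq> {} \<and> (\<forall>\<beta>\<in>D. card (col \<Delta> \<beta>) = 1)"
      using confluent_project[OF _ _ diag, of D] by blast
  next
    fix D assume D: "confluent Q D" "D \<noteq> {}" "\<forall>\<beta>\<in>D. card (col \<Delta> \<beta>) = 1"
    let ?D = "{a \<in> A. orb_a a \<in> D}"
    have "confluent \<Gamma> ?D" using confluent_lift[OF D(1) _ diag] D(3) by simp
    moreover have "?D \<noteq> {}" using D by (auto simp: confluent_def Q_simps)
    moreover have "snd g a \<in> ?D" if "g \<in> G" "a \<in> ?D" for g a
      using that aut_arc[OF G_aut] orb_a_iff[of a "snd g a"] by auto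
    ultimately show "\<exists>D. confluent \<Gamma> D \<and> D \<noteq> {} \<and> (\<forall>g\<in>G. \<forall>a\<in>D. snd g a \<in> D)" by blast
  qed
  then show ?thesis by (simp add: geometrically_dense_iff)
qed

end

section \<open>Focal cycles, stray half-trees and stray leaves\<close>

text \<open>A vertex of maximal height on a cycle would have two lower neighbours.\<close>

lemma no_cycleI:
  fixes h :: "'v \<Rightarrow> nat"
  assumes G: "is_graph \<Gamma>"
    and neq: "\<And>u v. (u, v) \<in> adj \<Gamma> \<Longrightarrow> h u \<noteq> h v"
    and unique: "\<And>u v w. \<lbrakk>(u, v) \<in> adj \<Gamma>; (u, w) \<in> adj \<Gamma>; h v < h u; h w < h u\<rbrakk> \<Longrightarrow> v = w"
  shows "\<not> has_cycle \<Gamma>"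
proof
  assume "has_cycle \<Gamma>"
  then obtain vs where vs: "length vs \<ge> 3" "distinct vs"
    and cyc: "\<And>i. i < length vs \<Longrightarrow> (vs ! i, vs ! (Suc i mod length vs)) \<in> adj \<Gamma>"
    unfolding has_cycle_def by blast
  let ?n = "length vs"
  have sym: "(v, u) \<in> adj \<Gamma>" if "(u, v) \<in> adj \<Gamma>" for u v
    using that G by (force simp: adj_def is_graph_def targ_def)
  have fin: "finite ((\<lambda>i. h (vs ! i)) ` {..<?n})" and ne: "(\<lambda>i. h (vs ! i)) ` {..<?n} \<noteq> {}"
    using vs(1) by (auto simp: lessThan_empty_iff)
  obtain i where i: "i < ?n" and "h (vs ! i) = Max ((\<lambda>i. h (vs ! i)) ` {..<?n})"
    using Max_in[OF fin ne] by auto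
  then have max: "h (vs ! j) \<le> h (vs ! i)" if "j < ?n" for j
    using Max_ge[OF fin, of "h (vs ! j)"] that by auto
  define j where "j = Suc i mod ?n"
  define k where "k = (if i = 0 then ?n - 1 else i - 1)"
  have k: "k < ?n" "Suc k mod ?n = i" using i vs(1) by (auto simp: k_def)
  have "0 < ?n" using vs(1) by linarith
  then have j: "j < ?n" unfolding j_def by (rule mod_less_divisor)
  have "j \<noteq> k"
  proof (cases "Suc i = ?n")
    case True then show ?thesis using vs(1) by (auto simp: j_def k_def)
  next
    case False
    then have "Suc i < ?n" using i by simp
    then show ?thesis using vs(1) by (auto simp: j_def k_def)
  qed
  moreover have adj: "(vs ! i, vs ! j) \<in> adj \<Gamma>" "(vs ! i, vs ! k) \<in> adj \<Gamma>"
    using cyc[OF i] cyc[OF k(1)] k sym by (auto simp: j_def)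
  then have "vs ! j = vs ! k"
    using neq[OF adj(1)] neq[OF adj(2)] max[OF j] max[OF k(1)] by (intro unique[OF adj]) auto
  ultimately show False using vs(2) j k(1) nth_eq_iff_index_eq by blast
qed

section \<open>Edge removal and half-graphs\<close>

lemma remove_edge_simps [simp]:
  "verts (remove_edge \<Gamma> a) = verts \<Gamma>" "arcs (remove_edge \<Gamma> a) = arcs \<Gamma> - {a, bar \<Gamma> a}"
  "orig (remove_edge \<Gamma> a) = orig \<Gamma>" "bar (remove_edge \<Gamma> a) = bar \<Gamma>"
  "targ (remove_edge \<Gamma> a) = targ \<Gamma>"
  by (simp_all add: remove_edge_def)

lemma half_graph_simps [simp]:
  "orig (half_graph \<Gamma> a) = orig \<Gamma>" "bar (half_graph \<Gamma> a) = bar \<Gamma>"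
  "targ (half_graph \<Gamma> a) = targ \<Gamma>"
  by (simp_all add: half_graph_def component_def)

lemma half_graph_verts:
  "verts (half_graph \<Gamma> a) = {v \<in> verts \<Gamma>. (targ \<Gamma> a, v) \<in> (adj (remove_edge \<Gamma> a))\<^sup>*}"
  and half_graph_arcs: "arcs (half_graph \<Gamma> a) =
    {b \<in> arcs \<Gamma> - {a, bar \<Gamma> a}. (targ \<Gamma> a, orig \<Gamma> b) \<in> (adj (remove_edge \<Gamma> a))\<^sup>*}"
  by (simp_all add: half_graph_def component_def)

context conn_graph
begin

lemma adj_remove: "adj (remove_edge \<Gamma> a) = {(src c, tgt c) | c. c \<in> A - {a, rv a}}"
  by (simp add: adj_def)

lemma rv_remove: "\<lbrakk>a \<in> A; c \<in> A - {a, rv a}\<rbrakk> \<Longrightarrow> rv c \<in> A - {a, rv a}"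
  by (auto dest: arg_cong[of _ _ rv])

lemma adj_removeI:
  assumes "a \<in> A" "c \<in> A" "c \<noteq> a" "c \<noteq> rv a"
  shows "(src c, tgt c) \<in> adj (remove_edge \<Gamma> a)" "(tgt c, src c) \<in> adj (remove_edge \<Gamma> a)"
proof -
  show "(src c, tgt c) \<in> adj (remove_edge \<Gamma> a)" using assms by (auto simp: adj_remove)
  have "rv c \<in> A - {a, rv a}" using rv_remove[of a c] assms by simp
  then have "(src (rv c), tgt (rv c)) \<in> adj (remove_edge \<Gamma> a)" unfolding adj_remove by blast
  then show "(tgt c, src c) \<in> adj (remove_edge \<Gamma> a)" using assms by simp
qed

lemma sym_adj_remove: "a \<in> A \<Longrightarrow> sym (adj (remove_edge \<Gamma> a))"
  using adj_removeI(2)[of a] by (intro symI) (auto simp: adj_remove)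

section \<open>Confluent sets from the special configurations\<close>

lemma stray_leaf_imp_confluent:
  assumes base: "base \<Delta> = \<Gamma>" and leaf: "is_stray_leaf \<Delta> v"
  shows "\<exists>D. confluent \<Gamma> D \<and> D \<noteq> {} \<and> (\<forall>a\<in>D. card (col \<Delta> a) = 1)"
proof -
  have l: "card (star \<Gamma> v) = 1" "\<forall>a\<in>star \<Gamma> v. \<not> is_loop \<Gamma> a" "card (colv \<Delta> v) = 1"
    using leaf by (auto simp: is_stray_leaf_def is_leaf_def base)
  obtain b where b: "star \<Gamma> v = {b}" using l(1) by (rule card_1_singletonE)
  have bA: "b \<in> A" "src b = v" using b by (auto simp: star_def)
  have nl: "src b \<noteq> tgt b" using l(2) b by (simp add: is_loop_def)
  have "confluent \<Gamma> {b}"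
  proof (rule confluentI)
    fix a assume "a \<in> {b}"
    then show "rv a \<notin> {b}" using nl by (auto simp flip: src_rv)
    fix c assume "c \<in> A" "src c = src a" "c \<noteq> a"
    then have "c \<in> star \<Gamma> v" using \<open>a \<in> {b}\<close> bA by (auto simp: star_def)
    then show "rv c \<in> {b}" using b \<open>a \<in> {b}\<close> \<open>c \<noteq> a\<close> by auto
  qed (use bA in auto)
  moreover have "colv \<Delta> v = col \<Delta> b" using b by (simp add: colv_def base)
  ultimately show ?thesis using l(3) by (intro exI[of _ "{b}"]) auto
qed

lemma cyclic_orientation_confluent:
  assumes ori: "is_cyclic_orientation \<Gamma> D"
  shows "confluent \<Gamma> D"
proof (rule confluentI)
  have ex: "\<exists>!a. a \<in> D \<and> a \<in> star \<Gamma> v" if "v \<in> V" for v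
    using ori that unfolding is_cyclic_orientation_def by blast
  have x: "a \<in> D \<longleftrightarrow> rv a \<notin> D" if "a \<in> A" for a
    using ori that unfolding is_cyclic_orientation_def by blast
  show DA: "D \<subseteq> A" using ori by (simp add: is_cyclic_orientation_def)
  fix a assume a: "a \<in> D"
  then show "rv a \<notin> D" using DA x by blast
  fix b assume b: "b \<in> A" "src b = src a" "b \<noteq> a"
  then have "b \<notin> D" using ex[OF src_in[of a]] a DA by (auto simp: star_def)
  then show "rv b \<in> D" using x b by blast
qed

lemma focal_imp_confluent:
  assumes base: "base \<Delta> = \<Gamma>" and focal: "is_focal_cycle \<Delta>"
  shows "\<exists>D. confluent \<Gamma> D \<and> D \<noteq> {} \<and> (\<forall>a\<in>D. card (col \<Delta> a) = 1)"
proof -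
  obtain D where D: "is_cyclic_orientation \<Gamma> D" "\<forall>a\<in>D. card (col \<Delta> a) = 1" and "V \<noteq> {}"
    using focal by (auto simp: is_focal_cycle_def is_cycle_graph_def base)
  moreover from this obtain v where "v \<in> V" by blast
  then have "D \<noteq> {}" using D(1) unfolding is_cyclic_orientation_def by blast
  ultimately show ?thesis using cyclic_orientation_confluent by blast
qed

lemma horocyclic_imp_confluent:
  assumes base: "base \<Delta> = \<Gamma>" and horo: "is_horocyclic_end \<Delta> \<xi>"
  shows "\<exists>D. confluent \<Gamma> D \<and> D \<noteq> {} \<and> (\<forall>a\<in>D. card (col \<Delta> a) = 1)"
proof -
  have tr: "is_tree \<Gamma>" and xi: "\<xi> \<in> ends \<Gamma>"
    and one: "\<forall>a\<in>A. towards_end \<Gamma> \<xi> a \<longrightarrow> card (col \<Delta> a) = 1"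
    using horo by (auto simp: is_horocyclic_end_def base)
  interpret tree \<Gamma> using tr by (simp add: tree_iff)
  obtain r where r: "r \<in> rays \<Gamma>" "\<xi> = {s \<in> rays \<Gamma>. infinite (range r \<inter> range s)}"
    using ends_rep[OF xi] .
  have "confluent \<Gamma> {a \<in> A. towards_end \<Gamma> \<xi> a}" "V \<subseteq> src ` {a \<in> A. towards_end \<Gamma> \<xi> a}"
    unfolding towards_end_evt[OF r] by (rule evt_confluent[OF r(1)])+
  moreover from this(2) nonempty have "{a \<in> A. towards_end \<Gamma> \<xi> a} \<noteq> {}" by auto
  ultimately show ?thesis using one by blast
qed

text \<open>Take the arcs of the half-tree that point to its root. The arc \<open>rv a\<close>,
  which leads out of the root, is left out, since nothing is known about its colour set.\<close>

lemma half_tree_imp_confluent: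
  assumes base: "base \<Delta> = \<Gamma>" and stray: "is_stray_half_tree \<Delta> a"
  shows "\<exists>D. confluent \<Gamma> D \<and> D \<noteq> {} \<and> (\<forall>a\<in>D. card (col \<Delta> a) = 1)"
proof -
  let ?H = "half_graph \<Gamma> a" and ?R = "adj (remove_edge \<Gamma> a)"
  have a: "a \<in> A" and dis: "\<not> connected_graph (remove_edge \<Gamma> a)" and tr: "is_tree ?H"
    and noleaf: "\<And>v. v \<in> verts ?H \<Longrightarrow> \<not> is_leaf \<Gamma> v"
    and one: "\<And>b. \<lbrakk>b \<in> arcs ?H; towards_vertex ?H (tgt a) b\<rbrakk> \<Longrightarrow> card (col \<Delta> b) = 1"
    using stray by (auto simp: is_stray_half_tree_def base)
  interpret H: tree ?H using tr by (simp only: tree_iff)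
  have symR: "sym ?R" by (rule sym_adj_remove[OF a])
  \<comment> \<open>If the removed edge could be bypassed, removing it would not disconnect the
    graph.\<close>
  have far: "(tgt a, src a) \<notin> ?R\<^sup>*"
  proof
    assume ta: "(tgt a, src a) \<in> ?R\<^sup>*"
    have step: "(u, v) \<in> ?R\<^sup>*" if uv: "(u, v) \<in> E" for u v
    proof -
      obtain c where c: "c \<in> A" "src c = u" "tgt c = v" using uv by (rule adjE)
      consider "c = a" | "c = rv a" | "c \<noteq> a" "c \<noteq> rv a" by blast
      then show ?thesis
      proof cases
        case 1 then show ?thesis using sym_reach[OF symR ta] c by simp
      next
        case 2 then show ?thesis using ta c a by simp
      next
        case 3 then show ?thesis using adj_removeI(1)[OF a c(1)] c by auto
      qed
    qed
    have "(u, v) \<in> ?R\<^sup>*" if "(u, v) \<in> E\<^sup>*" for u v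
      using that by (induction rule: rtrancl_induct) (auto intro: step rtrancl_trans)
    then show False using conn dis by (auto simp: connected_graph_def)
  qed
  have root: "tgt a \<in> verts ?H" using a by (simp add: half_graph_verts)
  define D where "D = {b \<in> arcs ?H. towards_vertex ?H (tgt a) b}"
  have D_half: "D = {b \<in> arcs ?H. tgt a \<in> H.half b}"
    using root by (auto simp: D_def towards_vertex_def H.half_def H.gdist_sym[of "tgt a"])
  have "confluent \<Gamma> D"
  proof (rule confluentI)
    show "D \<subseteq> A" by (auto simp: D_def half_graph_arcs)
    fix b assume b: "b \<in> D"
    then have bH: "b \<in> arcs ?H" "tgt a \<in> H.half b" by (auto simp: D_half)
    show "rv b \<notin> D" using H.half_rv[OF bH(1)] bH by (simp add: D_half)
    fix c assume c: "c \<in> A" "src c = src b" "c \<noteq> b"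
    \<comment> \<open>Only the two ends of the removed edge lose an arc by the removal, and
      \<open>b\<close> starts at neither.\<close>
    have "src b \<noteq> tgt a" using bH(2) H.src_notin_half[OF bH(1)] by auto
    moreover have "src b \<noteq> src a" using bH(1) far by (auto simp: half_graph_arcs)
    ultimately have cH: "c \<in> arcs ?H" using c bH(1) a by (auto simp: half_graph_arcs)
    have "tgt a \<notin> H.half c" using H.half_disjoint[OF bH(1) cH] c bH(2) by auto
    then have "tgt a \<in> H.half (rv c)" using H.half_rv[OF cH] root by simp
    then show "rv c \<in> D" using H.rv_in[OF cH] by (simp add: D_half)
  qed
  \<comment> \<open>Not being a leaf, the root has an arc besides \<open>rv a\<close>, and the
    reverse of that arc points to the root.\<close>
  moreover have "D \<noteq> {}"
  proof -
    have "rv a \<in> star \<Gamma> (tgt a)" using a by (simp add: star_def)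
    have "star \<Gamma> (tgt a) \<noteq> {rv a}"
    proof
      assume "star \<Gamma> (tgt a) = {rv a}"
      moreover have "src a \<noteq> tgt a" using far by auto
      ultimately have "is_leaf \<Gamma> (tgt a)" using a by (auto simp: is_leaf_def is_loop_def)
      then show False using noleaf[OF root] by simp
    qed
    then obtain b where b: "b \<in> A" "src b = tgt a" "b \<noteq> rv a"
      using \<open>rv a \<in> star \<Gamma> (tgt a)\<close> by (auto simp: star_def)
    have "b \<noteq> a" using b far by auto
    then have bH: "b \<in> arcs ?H" using b by (simp add: half_graph_arcs)
    have "rv b \<in> D"
      using H.rv_in[OF bH] H.tgt_in_half[OF H.rv_in[OF bH]] b by (simp add: D_half)
    then show ?thesis by blast
  qed
  ultimately show ?thesis using one unfolding D_def by blast
qed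

end

section \<open>Following a confluent set in the quotient\<close>

lemma single_valued_relpow_eq:
  assumes sv: "single_valued R" and 1: "(x, y) \<in> R ^^ n" and 2: "(x, z) \<in> R ^^ (n + m)"
  shows "(y, z) \<in> R ^^ m"
  using 1 2
proof (induction n arbitrary: x)
  case (Suc n)
  obtain x1 where x1: "(x, x1) \<in> R" "(x1, y) \<in> R ^^ n" using Suc.prems(1) by (rule relpow_Suc_E2)
  obtain x2 where x2: "(x, x2) \<in> R" "(x2, z) \<in> R ^^ (n + m)"
    using Suc.prems(2) unfolding add_Suc by (rule relpow_Suc_E2)
  have "x1 = x2" using sv x1(1) x2(1) by (rule single_valuedD)
  then show ?case using Suc.IH x1 x2 by simp
qed simp

context conn_graph
begin

context
  fixes D assumes D: "confluent \<Gamma> D"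
begin

text \<open>A relation rather than the function \<open>nxt\<close>, because the flow may stop at
  vertices without outgoing arc in \<open>D\<close>.\<close>

definition flow :: "'v rel" where "flow = {(src a, tgt a) | a. a \<in> D}"

lemma flowE:
  assumes "(x, y) \<in> flow" obtains a where "a \<in> D" "a \<in> A" "src a = x" "tgt a = y"
  using assms confluentD(1)[OF D] by (auto simp: flow_def)

lemma single_valued_flow: "single_valued flow"
  using confluent_unique[OF D] by (intro single_valuedI) (auto simp: flow_def)

lemma flow_out:
  assumes "(y, src a) \<in> flow\<^sup>*" "a \<in> D" shows "\<exists>b\<in>D. src b = y"
  using assms(1)
proof (cases rule: converse_rtranclE)
  case base
  then show ?thesis using assms(2) by blast
next
  case (step z)
  then show ?thesis by (auto simp: flow_def)
qed

text \<open>Let \<open>K\<close> be the set of vertices that lead to \<open>src a\<close>. Every arc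
  at a vertex of \<open>K\<close> belongs to \<open>D\<close> or is the reverse of one that does,
  and in either case stays in \<open>K\<close> unless it is \<open>a\<close>; so \<open>K\<close>
  spans the half-graph of \<open>rv a\<close>. As \<open>src a\<close> does not recur, the number of
  steps to it is a height function that makes this half-graph a tree.\<close>

lemma stray_half_graph:
  assumes base: "base \<Delta> = \<Gamma>" and one: "\<forall>a\<in>D. card (col \<Delta> a) = 1"
    and a: "a \<in> D" and aper: "(src a, src a) \<notin> flow\<^sup>+"
  shows "is_stray_half_tree \<Delta> (rv a) \<or> (\<exists>v. is_stray_leaf \<Delta> v)"
proof -
  define x where "x = src a"
  have aA: "a \<in> A" and rva: "rv a \<notin> D" using confluentD[OF D a] by auto
  have sv: "single_valued flow" by (rule single_valued_flow)
  let ?e = "rv a"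
  let ?R = "adj (remove_edge \<Gamma> ?e)" and ?H = "half_graph \<Gamma> ?e"
  have te: "tgt ?e = x" using aA by (simp add: x_def)
  have eA: "?e \<in> A" and re: "rv ?e = a" using aA by auto
  have Radj: "?R = {(src c, tgt c) | c. c \<in> A - {a, ?e}}"
    unfolding adj_remove re by (simp add: insert_commute)
  have xV: "x \<in> V" using aA by (simp add: x_def)
  define K where "K = {y. (y, x) \<in> flow\<^sup>*}"
  have xK: "x \<in> K" by (simp add: K_def)
  have out: "\<exists>b\<in>D. src b = y" if "y \<in> K" for y
    using flow_out[OF _ a] that by (simp add: K_def x_def)
  have out_K: "tgt b \<in> K" if b: "b \<in> D" "src b \<in> K" "b \<noteq> a" for b
  proof -
    have "src b \<noteq> x" using confluent_unique[OF D b(1) a] b(3) by (auto simp: x_def)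
    then obtain z where z: "(src b, z) \<in> flow" "(z, x) \<in> flow\<^sup>*"
      using b(2) by (auto simp: K_def elim: converse_rtranclE)
    then have "z = tgt b" using sv b(1) by (auto simp: flow_def dest: confluent_unique[OF D])
    then show ?thesis using z by (simp add: K_def)
  qed
  have into_K: "tgt c \<in> K" if c: "rv c \<in> D" "c \<in> A" "src c \<in> K" for c
  proof -
    have "(tgt c, src c) \<in> flow" using c by (force simp: flow_def)
    then show ?thesis using c(3) by (simp add: K_def)
  qed
  \<comment> \<open>At a vertex with an outgoing arc in \<open>D\<close>, confluence orients every
    edge.\<close>
  have dichotomy: "c \<in> D \<or> rv c \<in> D" if c: "c \<in> A" "src c \<in> K" for c
  proof -
    obtain b where "b \<in> D" "src b = src c" using out[OF c(2)] by blast
    then show ?thesis using confluentD(3)[OF D, of b c] c(1) by auto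
  qed
  have K_V: "K \<subseteq> V"
  proof
    fix y assume "y \<in> K"
    then obtain b where "b \<in> D" "src b = y" using out by blast
    then show "y \<in> V" using src_in[OF confluentD(1)[OF D]] by blast
  qed
  have reach: "(x, y) \<in> ?R\<^sup>*" if "y \<in> K" for y
    using that[unfolded K_def mem_Collect_eq]
  proof (induction rule: converse_rtrancl_induct)
    case (step y z)
    show ?case
    proof (cases "y = x")
      case False
      obtain b where b: "b \<in> D" "b \<in> A" "src b = y" "tgt b = z" using step(1) by (rule flowE)
      have "b \<noteq> a" "b \<noteq> ?e" using b False rva by (auto simp: x_def)
      then have "(z, y) \<in> ?R" using adj_removeI(2)[OF eA b(2)] re b by simp
      with step show ?thesis by simp
    qed simp
  qed simp
  have stay: "y \<in> K" if "(x, y) \<in> ?R\<^sup>*" for y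
    using that
  proof (induction rule: rtrancl_induct)
    case (step y z)
    then obtain c where c: "c \<in> A" "c \<noteq> a" "c \<noteq> ?e" "src c = y" "tgt c = z" by (auto simp: Radj)
    then show ?case using dichotomy[of c] out_K[of c] into_K[of c] step by auto
  qed (rule xK)
  have vH: "verts ?H = K" using reach stay K_V by (auto simp: half_graph_verts te)
  have aH: "arcs ?H = {c \<in> A - {a, ?e}. src c \<in> K}"
    using reach stay by (auto simp: half_graph_arcs te re)
  \<comment> \<open>Otherwise the flow would return to \<open>x\<close> through
    \<open>a\<close>.\<close>
  have far: "tgt a \<notin> K"
  proof
    assume "tgt a \<in> K"
    then have "(tgt a, x) \<in> flow\<^sup>*" by (simp add: K_def)
    moreover have "(x, tgt a) \<in> flow" using a by (auto simp: flow_def x_def)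
    ultimately show False using aper by (metis rtrancl_into_trancl2 x_def)
  qed
  have dis: "\<not> connected_graph (remove_edge \<Gamma> ?e)"
  proof
    assume "connected_graph (remove_edge \<Gamma> ?e)"
    then have "(x, tgt a) \<in> ?R\<^sup>*" using xV tgt_in[OF aA] unfolding connected_graph_def by simp
    then show False using far stay by blast
  qed
  define h where "h y = (LEAST n. (y, x) \<in> flow ^^ n)" for y
  have h: "(y, x) \<in> flow ^^ h y" if y: "y \<in> K" for y
  proof -
    obtain n where "(y, x) \<in> flow ^^ n" using y by (auto simp: K_def rtrancl_power)
    then show ?thesis unfolding h_def by (rule LeastI)
  qed
  \<comment> \<open>Two flow paths from \<open>y\<close> to \<open>x\<close> of different length
    would, by determinism, differ by a closed flow path at \<open>x\<close>.\<close>
  have h_unique: "n = h y" if n: "(y, x) \<in> flow ^^ n" for y n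
  proof -
    have le: "h y \<le> n" unfolding h_def using n by (rule Least_le)
    have "y \<in> K" using n by (auto simp: K_def rtrancl_power)
    then have "(y, x) \<in> flow ^^ h y" by (rule h)
    moreover have "(y, x) \<in> flow ^^ (h y + (n - h y))" using n le by simp
    ultimately have "(x, x) \<in> flow ^^ (n - h y)" by (rule single_valued_relpow_eq[OF sv])
    moreover have "(x, x) \<notin> flow\<^sup>+" using aper by (simp add: x_def)
    ultimately have "\<not> 0 < n - h y" by (auto simp only: trancl_power)
    then show ?thesis using le by simp
  qed
  have hx: "h x = 0" using h_unique[of x 0] by simp
  have h_step: "h (src c) = Suc (h (tgt c))" if c: "c \<in> D" "tgt c \<in> K" for c
  proof -
    have "(src c, x) \<in> flow ^^ Suc (h (tgt c))"
      using h[OF c(2)] c(1) by (intro relpow_Suc_I2[of _ "tgt c"]) (auto simp: flow_def)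
    then show ?thesis using h_unique by metis
  qed
  have H_step: "(c \<in> D \<and> tgt c \<in> K \<and> h (src c) = Suc (h (tgt c))) \<or>
      (rv c \<in> D \<and> tgt c \<in> K \<and> h (tgt c) = Suc (h (src c)))" if c: "c \<in> arcs ?H" for c
  proof -
    have cA: "c \<in> A" "c \<noteq> a" "src c \<in> K" using c by (auto simp: aH)
    show ?thesis
      using dichotomy[OF cA(1,3)] out_K[OF _ cA(3,2)] into_K[OF _ cA(1,3)] h_step[of c] h_step[of "rv c"] cA
      by auto
  qed
  have gH: "is_graph ?H"
  proof -
    have "src c \<in> K \<and> rv c \<in> arcs ?H" if c: "c \<in> arcs ?H" for c
    proof -
      have "c \<in> A - {?e, rv ?e}" "src c \<in> K" using c by (auto simp: aH re)
      moreover have "tgt c \<in> K" using H_step[OF c] by blast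
      ultimately show ?thesis using rv_remove[OF eA, of c] by (auto simp: aH re)
    qed
    moreover have "rv (rv c) = c" if "c \<in> arcs ?H" for c using that by (auto simp: aH)
    ultimately show ?thesis unfolding is_graph_def vH by simp
  qed
  have adjH: "adj ?H = {(src c, tgt c) | c. c \<in> arcs ?H}" by (simp add: adj_def)
  have adjHE: "\<exists>c. c \<in> arcs ?H \<and> src c = u \<and> tgt c = v" if "(u, v) \<in> adj ?H" for u v
    using that unfolding adjH by blast
  have flowH: "(y, z) \<in> adj ?H" if b: "b \<in> D" "b \<in> A" "src b = y" "tgt b = z" "y \<noteq> x" "y \<in> K" for b y z
  proof -
    have "b \<in> arcs ?H" using b rva by (auto simp: aH x_def)
    then show ?thesis using b unfolding adjH by blast
  qed
  have to_x: "(y, x) \<in> adj ?H ^^ h y" if y: "y \<in> K" for y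
    using y
  proof (induction "h y" arbitrary: y)
    case 0
    then show ?case using h[of y] by simp
  next
    case (Suc n)
    then have "y \<noteq> x" using hx by auto
    obtain b where b: "b \<in> D" "src b = y" using out[OF Suc.prems] by blast
    have bA: "b \<in> A" using confluentD(1)[OF D b(1)] .
    have "b \<noteq> a" using b \<open>y \<noteq> x\<close> by (auto simp: x_def)
    then have tK: "tgt b \<in> K" using out_K[OF b(1)] b(2) Suc.prems by simp
    then have n: "n = h (tgt b)" using h_step[OF b(1)] b(2) Suc.hyps(2) by simp
    have "(y, tgt b) \<in> adj ?H" using flowH[OF b(1) bA b(2) refl \<open>y \<noteq> x\<close> Suc.prems] .
    then have "(y, x) \<in> adj ?H ^^ Suc n" using Suc.hyps(1)[OF n tK] unfolding n[symmetric] by (rule relpow_Suc_I2)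
    then show ?case using Suc.hyps(2) by simp
  qed
  have symH: "sym (adj ?H)"
  proof (rule symI)
    fix u v assume "(u, v) \<in> adj ?H"
    then obtain c where c: "c \<in> arcs ?H" "src c = u" "tgt c = v" unfolding adjH by blast
    then have "rv c \<in> arcs ?H" using gH unfolding is_graph_def by simp
    have "c \<in> A" using c(1) by (simp add: aH)
    have "(src (rv c), tgt (rv c)) \<in> adj ?H" unfolding adjH using \<open>rv c \<in> arcs ?H\<close> by blast
    then show "(v, u) \<in> adj ?H" using c \<open>c \<in> A\<close> by simp
  qed
  have cH: "connected_graph ?H"
    unfolding connected_graph_def vH
  proof (intro ballI)
    fix u v assume "u \<in> K" "v \<in> K"
    then have "(u, x) \<in> (adj ?H)\<^sup>*" "(v, x) \<in> (adj ?H)\<^sup>*" using to_x by (meson relpow_imp_rtrancl)+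
    then show "(u, v) \<in> (adj ?H)\<^sup>*" using sym_reach[OF symH] by (meson rtrancl_trans)
  qed
  have down: "c \<in> D" if "c \<in> arcs ?H" "h (tgt c) < h (src c)" for c
    using H_step[OF that(1)] that(2) by auto
  have treeH: "tree ?H"
  proof
    show "is_graph ?H" "connected_graph ?H" by (rule gH, rule cH)
    show "verts ?H \<noteq> {}" unfolding vH using xK by blast
    show "orig ?H c \<noteq> targ ?H c" if "c \<in> arcs ?H" for c using H_step[OF that] by auto
    \<comment> \<open>The height \<open>h\<close> changes along each edge, and the only lower
      neighbour of a vertex is reached by its arc in \<open>D\<close>.\<close>
    show "\<not> has_cycle ?H"
    proof (rule no_cycleI[of _ h])
      show "is_graph ?H" by (rule gH)
      show "h u \<noteq> h v" if uv: "(u, v) \<in> adj ?H" for u v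
      proof -
        obtain c where "c \<in> arcs ?H" "src c = u" "tgt c = v" using uv unfolding adjH by blast
        then show ?thesis using H_step[of c] by auto
      qed
      fix u v w assume uv: "(u, v) \<in> adj ?H" and uw: "(u, w) \<in> adj ?H" and lt: "h v < h u" "h w < h u"
      obtain b where b: "b \<in> arcs ?H" "src b = u" "tgt b = v" using adjHE[OF uv] by blast
      obtain c where c: "c \<in> arcs ?H" "src c = u" "tgt c = w" using adjHE[OF uw] by blast
      have "b = c" using down[OF b(1)] down[OF c(1)] b c lt by (intro confluent_unique[OF D]) auto
      then show "v = w" using b c by simp
    qed
    fix b c assume bc: "b \<in> arcs ?H" "c \<in> arcs ?H" "orig ?H b = orig ?H c" "targ ?H b = targ ?H c"
    then have bcA: "b \<in> A" "c \<in> A" and eq: "src b = src c" "tgt b = tgt c" by (auto simp: aH)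
    from H_step[OF bc(1)] show "b = c"
    proof (elim disjE conjE)
      assume "b \<in> D" "h (src b) = Suc (h (tgt b))"
      then show ?thesis using down[OF bc(2)] eq by (intro confluent_unique[OF D]) auto
    next
      assume b: "rv b \<in> D" "h (tgt b) = Suc (h (src b))"
      then have "rv c \<in> D" using H_step[OF bc(2)] eq by auto
      then have "rv b = rv c" using b(1) eq by (intro confluent_unique[OF D]) auto
      then show ?thesis using bcA by (metis rv_rv)
    qed
  qed
  interpret H: tree ?H by (rule treeH)
  \<comment> \<open>Heights differ by at most one along an edge, so no path to \<open>x\<close> is
    shorter than the flow path. Hence \<open>h\<close> is the distance to the root, and arcs towards
    the root are those in \<open>D\<close>.\<close>
  have h_le: "h u \<le> h v + n" if "(u, v) \<in> adj ?H ^^ n" for u v n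
    using that
  proof (induction n arbitrary: v)
    case (Suc n)
    obtain w where w: "(u, w) \<in> adj ?H ^^ n" "(w, v) \<in> adj ?H" using Suc.prems by (rule relpow_Suc_E)
    obtain c where "c \<in> arcs ?H" "src c = w" "tgt c = v" using w(2) unfolding adjH by blast
    then have "h w \<le> Suc (h v)" using H_step[of c] by auto
    then show ?case using Suc.IH[OF w(1)] by simp
  qed simp
  have gd: "H.d y x = h y" if y: "y \<in> K" for y
  proof (rule antisym)
    show "H.d y x \<le> h y" using to_x[OF y] by (rule H.gdist_le)
    show "h y \<le> H.d y x" using h_le[OF H.gdist_relpow[of y x]] y xK hx by (simp add: vH)
  qed
  show ?thesis
  proof (cases "\<exists>v\<in>verts ?H. is_leaf \<Gamma> v")
    case True
    then obtain v where v: "v \<in> K" "is_leaf \<Gamma> v" unfolding vH by blast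
    \<comment> \<open>The only arc at the leaf is the one in \<open>D\<close>, so its colour set has
      one element.\<close>
    obtain b where b: "b \<in> D" "src b = v" using out[OF v(1)] by blast
    have "b \<in> star \<Gamma> v" using b confluentD(1)[OF D b(1)] by (simp add: star_def)
    moreover have "card (star \<Gamma> v) = 1" using v(2) by (simp add: is_leaf_def)
    ultimately have "star \<Gamma> v = {b}" by (metis card_1_singletonE singletonD)
    then have "colv \<Delta> v = col \<Delta> b" by (simp add: colv_def base)
    then have "is_stray_leaf \<Delta> v" using v(2) one b(1) by (simp add: is_stray_leaf_def base)
    then show ?thesis by blast
  next
    case False
    have "card (col \<Delta> c) = 1" if c: "c \<in> arcs ?H" "towards_vertex ?H x c" for c
    proof -
      have "src c \<in> K" "tgt c \<in> K" using c(1) H_step[OF c(1)] by (auto simp: aH)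
      then have "h (tgt c) < h (src c)"
        using c(2) gd by (simp add: towards_vertex_def)
      then show ?thesis using down[OF c(1)] one by blast
    qed
    then have "is_stray_half_tree \<Delta> ?e"
      using False eA dis treeH unfolding is_stray_half_tree_def base te tree_iff by blast
    then show ?thesis by blast
  qed
qed

text \<open>If every flow line returns, the flow is a permutation of \<open>V\<close>: each vertex
  has one arc of \<open>D\<close> leaving it and one entering it, and by confluence it lies on no
  other edges. A single flow orbit is then closed under adjacency.\<close>

lemma focal_cycle:
  assumes base: "base \<Delta> = \<Gamma>" and one: "\<forall>a\<in>D. card (col \<Delta> a) = 1" and "D \<noteq> {}"
    and per: "\<And>a. a \<in> D \<Longrightarrow> (src a, src a) \<in> flow\<^sup>+"
  shows "is_focal_cycle \<Delta>"
proof -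
  let ?f = "nxt D"
  have DA: "D \<subseteq> A" using confluentD(1)[OF D] by blast
  have tD: "tgt a \<in> src ` D" if a: "a \<in> D" for a
  proof -
    obtain z where z: "(src a, z) \<in> flow" "(z, src a) \<in> flow\<^sup>*" using per[OF a] by (metis tranclD)
    have "z = tgt a" using z(1) a single_valued_flow by (auto simp: flow_def dest: confluent_unique[OF D])
    then obtain b where "b \<in> D" "src b = tgt a" using flow_out[OF z(2) a] by blast
    then show ?thesis by force
  qed
  obtain a0 where a0: "a0 \<in> D" using \<open>D \<noteq> {}\<close> by blast
  have closed: "v \<in> src ` D" if uD: "u \<in> src ` D" and uv: "(u, v) \<in> E" for u v
  proof -
    obtain a where a: "a \<in> D" "src a = u" using uD by auto
    obtain c where c: "c \<in> A" "src c = u" "tgt c = v" using uv by (rule adjE)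
    show ?thesis
    proof (cases "c = a")
      case True then show ?thesis using tD a c by auto
    next
      case False
      then have "rv c \<in> D" using confluentD(3)[OF D a(1)] a c by simp
      then show ?thesis using c by force
    qed
  qed
  have total: "V \<subseteq> src ` D"
  proof
    fix v assume "v \<in> V"
    then have "(src a0, v) \<in> E\<^sup>*" using conn a0 DA by (auto simp: connected_graph_def)
    then show "v \<in> src ` D" by (induction rule: rtrancl_induct) (use a0 closed in auto)
  qed
  have flow_iff: "(u, v) \<in> flow \<longleftrightarrow> u \<in> V \<and> ?f u = v" for u v
    using nxt_src[OF D] total DA by (auto simp: flow_def image_iff subset_iff) (metis)
  have pow: "(?f ^^ n) u = v" if "(u, v) \<in> flow ^^ n" for u v n
    using that by (induction n arbitrary: v) (auto simp: flow_iff)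
  have period: "\<exists>n>0. (?f ^^ n) v = v" if v: "v \<in> V" for v
  proof -
    obtain a where "a \<in> D" "src a = v" using v total by auto
    then show ?thesis using per[of a] pow by (auto simp: trancl_power)
  qed
  \<comment> \<open>After \<open>m * n\<close> steps, a common multiple of both periods, each origin
    is reached again; but the two flow lines agree after the first step.\<close>
  have inj: "a = b" if ab: "a \<in> D" "b \<in> D" "tgt a = tgt b" for a b
  proof -
    have "src a \<in> V" "src b \<in> V" using ab(1,2) DA by auto
    obtain m where m: "m > 0" "(?f ^^ m) (src a) = src a" using period[OF \<open>src a \<in> V\<close>] by blast
    obtain n where n: "n > 0" "(?f ^^ n) (src b) = src b" using period[OF \<open>src b \<in> V\<close>] by blast
    have "(?f ^^ (m * n)) (src a) = src a" "(?f ^^ (m * n)) (src b) = src b"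
      using funpow_mod_eq[OF m(2), of "m * n"] funpow_mod_eq[OF n(2), of "m * n"] by simp_all
    moreover obtain k where "m * n = Suc k" using m n by (metis gr0_implies_Suc nat_0_less_mult_iff)
    ultimately have "src a = src b"
      using nxt_src[OF D] ab by (metis comp_apply funpow_Suc_right)
    then show ?thesis using confluent_unique[OF D] ab by blast
  qed
  have pred: "\<exists>p\<in>D. tgt p = v" if v: "v \<in> V" for v
  proof -
    obtain n where n: "n > 0" "(?f ^^ n) v = v" using period[OF v] by blast
    then obtain k where k: "n = Suc k" by (metis gr0_implies_Suc)
    have "(?f ^^ i) v \<in> V" for i
      by (induction i) (use v total DA nxt_src[OF D] in \<open>force simp: subset_iff image_iff\<close>)+
    then obtain p where "p \<in> D" "src p = (?f ^^ k) v" using total by (metis imageE subsetD)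
    then show ?thesis using nxt_src[OF D, of p] n k by auto
  qed
  have star: "\<exists>a b. a \<noteq> b \<and> star \<Gamma> v = {a, b}" if v: "v \<in> V" for v
  proof -
    obtain a where a: "a \<in> D" "src a = v" using v total by auto
    obtain p where p: "p \<in> D" "tgt p = v" using pred[OF v] by blast
    have "c = a \<or> c = rv p" if c: "c \<in> A" "src c = v" for c
    proof (cases "c = a")
      case False
      then have "rv c \<in> D" using confluentD(3)[OF D a(1)] a c by simp
      then have "rv c = p" using inj[OF _ p(1)] p c by simp
      then show ?thesis using c(1) by (metis rv_rv)
    qed simp
    moreover have "a \<noteq> rv p" using confluentD(2)[OF D p(1)] a by auto
    moreover have "rv p \<in> A" "src (rv p) = v" using p DA by auto
    ultimately have "a \<noteq> rv p \<and> star \<Gamma> v = {a, rv p}" using a DA by (auto simp: star_def)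
    then show ?thesis by blast
  qed
  have ori: "a \<in> D \<longleftrightarrow> rv a \<notin> D" if "a \<in> A" for a
    using confluent_arc[OF D total that] confluentD(2)[OF D, of a] by blast
  have finV: "finite V"
  proof -
    let ?v = "src a0"
    have v: "?v \<in> V" using a0 DA by auto
    obtain n where n: "n > 0" "(?f ^^ n) ?v = ?v" using period[OF v] by blast
    define C where "C = (\<lambda>i. (?f ^^ i) ?v) ` {..<n}"
    have C: "(?f ^^ i) ?v \<in> C" for i
      unfolding C_def using n funpow_mod_eq[OF n(2), of i] by (intro image_eqI[of _ _ "i mod n"]) auto
    have step: "z \<in> C" if yC: "y \<in> C" and yz: "(y, z) \<in> E" for y z
    proof -
      obtain i where i: "y = (?f ^^ i) ?v" using yC by (auto simp: C_def)
      obtain c where c: "c \<in> A" "src c = y" "tgt c = z" using yz by (rule adjE)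
      show ?thesis
      proof (cases "c \<in> D")
        case True
        then have "z = (?f ^^ Suc i) ?v" using nxt_src[OF D True] c i by simp
        then show ?thesis using C by blast
      next
        case False
        then have rc: "rv c \<in> D" using ori c by blast
        \<comment> \<open>\<open>k\<close> is \<open>i + n - 1\<close>: going once round the period
          replaces a step back.\<close>
        obtain k where k: "i + n = Suc k" using n by (metis add_gr_0 gr0_implies_Suc)
        have "(?f ^^ (i + n)) ?v = y" using n i by (simp add: funpow_add)
        then have y: "?f ((?f ^^ k) ?v) = y" unfolding k by simp
        have "(?f ^^ j) ?v \<in> V" for j
          by (induction j) (use v total DA nxt_src[OF D] in \<open>force simp: subset_iff image_iff\<close>)+
        then obtain p where p: "p \<in> D" "src p = (?f ^^ k) ?v" using total by (metis imageE subsetD)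
        then have "tgt p = y" using nxt_src[OF D p(1)] y by simp
        then have "rv c = p" using inj[OF rc p(1)] c by simp
        then have "z = (?f ^^ k) ?v" using p c by auto
        then show ?thesis using C by blast
      qed
    qed
    have "V \<subseteq> C"
    proof
      fix w assume "w \<in> V"
      then have "(?v, w) \<in> E\<^sup>*" using conn v by (auto simp: connected_graph_def)
      then show "w \<in> C" by (induction rule: rtrancl_induct) (use C[of 0] step in auto)
    qed
    then show ?thesis using finite_subset unfolding C_def by blast
  qed
  have "src ` D \<subseteq> V" using DA by auto
  then have "finite (src ` D)" using finV by (rule finite_subset)
  then have "finite D" by (rule finite_imageD) (use confluent_unique[OF D] in \<open>auto intro: inj_onI\<close>)
  moreover have "A \<subseteq> D \<union> rv ` D"
    using confluent_arc[OF D total] by (auto simp: image_iff) (metis rv_rv)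
  ultimately have "finite A" by (meson finite_UnI finite_imageI finite_subset)
  moreover have "rv c \<noteq> c" if "c \<in> A" for c using ori[OF that] by auto
  moreover have "card (star \<Gamma> v) = 2" if "v \<in> V" for v using star[OF that] by auto
  moreover have "V \<noteq> {}" using a0 total \<open>src ` D \<subseteq> V\<close> by blast
  ultimately have "is_cycle_graph \<Gamma>" using graph conn finV by (auto simp: is_cycle_graph_def)
  moreover have "is_cyclic_orientation \<Gamma> D"
    unfolding is_cyclic_orientation_def
  proof (intro conjI ballI)
    show "D \<subseteq> A" by (rule DA)
    show "c \<in> D \<longleftrightarrow> rv c \<notin> D" if "c \<in> A" for c using ori[OF that] .
    fix v assume "v \<in> V"
    then obtain a where "a \<in> D" "src a = v" using total by auto
    then show "\<exists>!a. a \<in> D \<and> a \<in> star \<Gamma> v"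
      using confluent_unique[OF D] DA by (intro ex1I[of _ a]) (auto simp: star_def)
  qed
  ultimately show ?thesis using one by (auto simp: is_focal_cycle_def base)
qed

end

theorem confluent_iff_special:
  assumes base: "base \<Delta> = \<Gamma>"
  shows "(\<exists>D. confluent \<Gamma> D \<and> D \<noteq> {} \<and> (\<forall>a\<in>D. card (col \<Delta> a) = 1)) \<longleftrightarrow>
    is_focal_cycle \<Delta> \<or> (\<exists>\<xi>. is_horocyclic_end \<Delta> \<xi>) \<or>
    (\<exists>a. is_stray_half_tree \<Delta> a) \<or> (\<exists>v. is_stray_leaf \<Delta> v)"
proof
  assume "\<exists>D. confluent \<Gamma> D \<and> D \<noteq> {} \<and> (\<forall>a\<in>D. card (col \<Delta> a) = 1)"
  then obtain D where D: "confluent \<Gamma> D" "D \<noteq> {}" "\<forall>a\<in>D. card (col \<Delta> a) = 1" by blast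
  \<comment> \<open>Either every origin of an arc in \<open>D\<close> recurs, or some origin does
    not. The flow to a horocyclic end never returns, so it falls under the second case.\<close>
  then show "is_focal_cycle \<Delta> \<or> (\<exists>\<xi>. is_horocyclic_end \<Delta> \<xi>) \<or>
    (\<exists>a. is_stray_half_tree \<Delta> a) \<or> (\<exists>v. is_stray_leaf \<Delta> v)"
    using stray_half_graph[OF D(1) base D(3)] focal_cycle[OF D(1) base D(3,2)] by blast
qed (use focal_imp_confluent[OF base] horocyclic_imp_confluent[OF base]
      half_tree_imp_confluent[OF base] stray_leaf_imp_confluent[OF base] in blast)

end

section \<open>Half-trees and translations\<close>

context conn_graph
begin

sublocale AutG: group AutG by (rule group_aut)

lemma subgroup_aut_mem:
  assumes K: "subgroup K AutG"
  shows "g \<in> K \<Longrightarrow> g \<in> aut \<Gamma>" "\<one>\<^bsub>AutG\<^esub> \<in> K"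
    and "\<lbrakk>g \<in> K; h \<in> K\<rbrakk> \<Longrightarrow> g \<otimes>\<^bsub>AutG\<^esub> h \<in> K" "g \<in> K \<Longrightarrow> inv\<^bsub>AutG\<^esub> g \<in> K"
  using subgroup.subset[OF K] subgroup.one_closed[OF K] subgroup.m_closed[OF K] subgroup.m_inv_closed[OF K]
  by auto

lemma aut_mult_closed: "\<lbrakk>g \<in> aut \<Gamma>; h \<in> aut \<Gamma>\<rbrakk> \<Longrightarrow> g \<otimes>\<^bsub>AutG\<^esub> h \<in> aut \<Gamma>"
  using AutG.m_closed by simp

section \<open>Contraction and branching\<close>

definition contracts :: "(('v \<Rightarrow> 'v) \<times> ('a \<Rightarrow> 'a)) set \<Rightarrow> bool" where
  "contracts K \<longleftrightarrow> (\<forall>a\<in>A. \<exists>g\<in>K. fst g ` half (rv a) \<subseteq> half a)"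

text \<open>Three distinct arcs are named instead of bounding \<open>card\<close>, which is 0 on
  infinite stars.\<close>

definition branching :: "'v \<Rightarrow> bool" where
  "branching z \<longleftrightarrow> (\<exists>p\<in>A. \<exists>q\<in>A. \<exists>r\<in>A. src p = z \<and> src q = z \<and> src r = z \<and> p \<noteq> q \<and> p \<noteq> r \<and> q \<noteq> r)"

lemma branching_aut:
  assumes g: "g \<in> aut \<Gamma>" and z: "branching z" shows "branching (fst g z)"
proof -
  obtain p q r where A: "p \<in> A" "q \<in> A" "r \<in> A" and s: "src p = z" "src q = z" "src r = z"
    and ne: "p \<noteq> q" "p \<noteq> r" "q \<noteq> r"
    using z unfolding branching_def by blast
  have inj: "snd g a \<noteq> snd g b" if "a \<in> A" "b \<in> A" "a \<noteq> b" for a b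
    using that aut_inv(3)[OF g] by metis
  show ?thesis
    unfolding branching_def
    by (rule bexI[of _ "snd g p"], rule bexI[of _ "snd g q"], rule bexI[of _ "snd g r"])
      (simp_all add: aut_arc[OF g] aut_src[OF g] A s inj ne)
qed

end

context tree
begin

text \<open>In each of the four relative positions, at most one push out of \<open>half b\<close>
  followed by one push into \<open>half a\<close> suffices.\<close>

lemma contracts_all:
  assumes K: "subgroup K AutG" and con: "contracts K" and a: "a \<in> A" and b: "b \<in> A"
  shows "\<exists>g\<in>K. fst g ` half b \<subseteq> half a"
proof -
  obtain g where g: "g \<in> K" "fst g ` half (rv a) \<subseteq> half a" using con a unfolding contracts_def by blast
  obtain h where "h \<in> K" "fst h ` half (rv (rv b)) \<subseteq> half (rv b)"
    using con rv_in[OF b] unfolding contracts_def by blast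
  then have h: "h \<in> K" "fst h ` half b \<subseteq> half (rv b)" using b by auto
  consider "half b \<subseteq> half a" | "half b \<subseteq> half (rv a)" | "half (rv b) \<subseteq> half a" | "half (rv b) \<subseteq> half (rv a)"
    using half_cases[OF a b] by blast
  then show ?thesis
  proof cases
    case 1
    then have "fst \<one>\<^bsub>AutG\<^esub> ` half b \<subseteq> half a" using aut_one(1) half_sub[of b] by force
    then show ?thesis using subgroup_aut_mem(2)[OF K] by blast
  next
    case 2 then show ?thesis using g by blast
  next
    case 3 then show ?thesis using h by blast
  next
    case 4
    have "fst (g \<otimes>\<^bsub>AutG\<^esub> h) ` half b \<subseteq> half a"
    proof (intro image_subsetI)
      fix x assume x: "x \<in> half b"
      then have "fst h x \<in> half (rv a)" using h(2) 4 by blast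
      then have "fst g (fst h x) \<in> half a" using g(2) by blast
      then show "fst (g \<otimes>\<^bsub>AutG\<^esub> h) x \<in> half a"
        using aut_mult(1) subgroup_aut_mem(1)[OF K] g(1) h(1) x half_sub by (metis subsetD)
    qed
    then show ?thesis using subgroup_aut_mem(3)[OF K g(1) h(1)] by blast
  qed
qed

lemma branching_in_half:
  assumes K: "subgroup K AutG" and con: "contracts K" and z: "branching z" and a: "a \<in> A"
  shows "\<exists>y\<in>half a. branching y"
proof (cases "z \<in> half a")
  case False
  obtain g where g: "g \<in> K" "fst g ` half (rv a) \<subseteq> half a" using con a unfolding contracts_def by blast
  have "z \<in> V" using z by (auto simp: branching_def)
  then have "fst g z \<in> half a" using g(2) False half_rv[OF a] by blast
  then show ?thesis using branching_aut[OF subgroup_aut_mem(1)[OF K g(1)] z] by blast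
qed (use z in blast)

text \<open>At most one of three disjoint half-trees at \<open>y\<close> contains
  \<open>src a\<close>; the others lie inside \<open>half a\<close>.\<close>

lemma two_halves:
  assumes y: "y \<in> half a" "branching y" and a: "a \<in> A"
  obtains p q where "p \<in> A" "q \<in> A" "src p = y" "src q = y" "p \<noteq> q" "half p \<subseteq> half a" "half q \<subseteq> half a"
proof -
  have sub: "half p \<subseteq> half a" if p: "p \<in> A" "src p = y" "src a \<notin> half p" for p
  proof -
    have t: "tgt p \<in> half a"
    proof (rule ccontr)
      assume "tgt p \<notin> half a"
      then have "rv p = a" using crossing[OF a, of "rv p"] p y by simp
      then have "tgt p = src a" using p(1) by auto
      then show False using tgt_in_half[OF p(1)] p(3) by simp
    qed
    have "half (rv a) \<subseteq> half p \<or> half (rv a) \<subseteq> half (rv p)"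
      using half_nested[OF a p(1)] p(2) y(1) t by blast
    moreover have "src a \<in> half (rv a)" using a half_rv[OF a] by simp
    ultimately have "half (rv a) \<subseteq> half (rv p)" using p(3) by blast
    then show ?thesis using half_rv[OF a] half_rv[OF p(1)] half_sub[of p] by blast
  qed
  obtain p q r where pqr: "p \<in> A" "q \<in> A" "r \<in> A" "src p = y" "src q = y" "src r = y" "p \<noteq> q" "p \<noteq> r" "q \<noteq> r"
    using y(2) unfolding branching_def by blast
  have dis: "half p \<inter> half q = {}" "half p \<inter> half r = {}" "half q \<inter> half r = {}"
    using half_disjoint pqr by auto
  consider "src a \<notin> half p" "src a \<notin> half q" | "src a \<notin> half p" "src a \<notin> half r"
    | "src a \<notin> half q" "src a \<notin> half r"
    using dis by blast
  then show ?thesis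
    using that[of p q] that[of p r] that[of q r] sub pqr by cases blast+
qed

text \<open>If n moves the branching vertex w, it displaces a half-tree at w, and conjugating n by K yields
  elements that displace any given half-tree.\<close>

lemma contracts_normalised:
  assumes K: "subgroup K AutG" and con: "contracts K" and z: "branching z"
    and M: "M \<subseteq> aut \<Gamma>" and n: "n \<in> M" "n \<noteq> \<one>\<^bsub>AutG\<^esub>"
    and conj: "\<And>g m. \<lbrakk>g \<in> K; m \<in> M\<rbrakk> \<Longrightarrow> g \<otimes>\<^bsub>AutG\<^esub> m \<otimes>\<^bsub>AutG\<^esub> inv\<^bsub>AutG\<^esub> g \<in> M"
  shows "contracts M"
proof -
  have na: "n \<in> aut \<Gamma>" using M n by blast
  \<comment> \<open>If \<open>n\<close> moves \<open>v\<close>, a branching vertex in the half-tree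
    behind \<open>v\<close>, as seen from \<open>fst n v\<close>, is nearer to \<open>v\<close> than
    to \<open>fst n v\<close>, so \<open>n\<close> cannot fix it.\<close>
  have "\<exists>w. branching w \<and> fst n w \<noteq> w"
  proof (rule ccontr)
    assume no: "\<not> ?thesis"
    have "fst n v = v" if v: "v \<in> V" for v
    proof (rule ccontr)
      assume "fst n v \<noteq> v"
      then obtain a where a: "a \<in> A" "src a = v" "fst n v \<in> half a"
        using half_cover[OF v aut_vert[OF na v]] by metis
      obtain w where w: "w \<in> half (rv a)" "branching w"
        using branching_in_half[OF K con z rv_in[OF a(1)]] by blast
      then have wV: "w \<in> V" "w \<notin> half a" using half_rv[OF a(1)] by auto
      have "d (fst n v) w = d v w" using aut_gdist[OF na v wV(1)] w(2) no by auto
      then show False using separation[OF a(1,3) wV] a(2) by simp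
    qed
    then have "n = \<one>\<^bsub>AutG\<^esub>"
      using aut_one(1) na AutG.one_closed by (intro aut_fst_eqI) auto
    then show False using n by simp
  qed
  then obtain w where w: "branching w" "fst n w \<noteq> w" by blast
  have wV: "w \<in> V" using w(1) by (auto simp: branching_def)
  note ni = aut_inv_closed[OF na]
  let ?w = "fst (inv\<^bsub>AutG\<^esub> n) w"
  have w'V: "?w \<in> V" using aut_vert[OF ni wV] .
  have w'w: "?w \<noteq> w" using aut_inv(2)[OF na wV] w(2) by metis
  obtain p where p: "p \<in> A" "src p = w" "fst n w \<in> half p"
    using half_cover[OF wV aut_vert[OF na wV]] w(2) by metis
  obtain q where q: "q \<in> A" "src q = w" "?w \<in> half q"
    using half_cover[OF wV w'V] w'w by metis
  \<comment> \<open>\<open>b\<close> points neither towards \<open>fst n w\<close> nor towards the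
    preimage of \<open>w\<close>; this makes \<open>half b\<close> and its image under
    \<open>n\<close> disjoint.\<close>
  obtain b where b: "b \<in> A" "src b = w" "b \<noteq> p" "b \<noteq> q"
    using w(1) unfolding branching_def by metis
  have nb: "fst n w \<notin> half b" "?w \<notin> half b"
    using half_disjoint[OF p(1) b(1)] half_disjoint[OF q(1) b(1)] p q b by auto
  define c where "c = snd n b"
  have c: "c \<in> A" "src c = fst n w" using aut_arc[OF na b(1)] aut_src[OF na b(1)] b by (auto simp: c_def)
  have wc: "w \<notin> half c"
    using aut_half(1)[OF na b(1) w'V] aut_inv(2)[OF na wV] nb(2) by (simp add: c_def)
  have tc: "tgt c \<notin> half b"
  proof
    assume "tgt c \<in> half b"
    then have "c = b" using crossing[OF b(1) c(1)] c(2) nb(1) by simp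
    then show False using c(2) b(2) w(2) by simp
  qed
  have "half (rv (rv b)) \<subseteq> half (rv c)"
    using half_nested(2)[OF rv_in[OF b(1)] c(1)] half_rv[OF b(1)] c nb(1) tc wc b aut_vert[OF na wV] by simp
  then have bc: "half c \<subseteq> half (rv b)" using half_rv[OF b(1)] half_rv[OF c(1)] half_sub[of c] b(1) by auto
  show ?thesis unfolding contracts_def
  proof
    fix a assume a: "a \<in> A"
    \<comment> \<open>\<open>g\<close> pushes the complement of \<open>half b\<close> into
      \<open>half a\<close>, so conjugating by \<open>g\<close> turns the displacement of
      \<open>half b\<close> into one of the complement of \<open>half a\<close>.\<close>
    obtain g where g: "g \<in> K" "fst g ` half (rv b) \<subseteq> half a"
      using contracts_all[OF K con a rv_in[OF b(1)]] by blast
    note ga = subgroup_aut_mem(1)[OF K g(1)]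
    let ?m = "g \<otimes>\<^bsub>AutG\<^esub> n \<otimes>\<^bsub>AutG\<^esub> inv\<^bsub>AutG\<^esub> g"
    have "fst ?m x \<in> half a" if x: "x \<in> half (rv a)" for x
    proof -
      have xV: "x \<in> V" "x \<notin> half a" using x half_rv[OF a] by auto
      let ?x = "fst (inv\<^bsub>AutG\<^esub> g) x"
      have x': "?x \<in> V" "fst g ?x = x" using aut_vert[OF aut_inv_closed[OF ga] xV(1)] aut_inv(2)[OF ga xV(1)] .
      have "?x \<in> half b"
      proof (rule ccontr)
        assume "?x \<notin> half b"
        then have "?x \<in> half (rv b)" using x'(1) half_rv[OF b(1)] by simp
        then show False using g(2) x'(2) xV(2) by force
      qed
      then have "fst n ?x \<in> half (rv b)" using aut_half(2)[OF na b(1)] bc by (auto simp: c_def)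
      then have "fst g (fst n ?x) \<in> half a" using g(2) by blast
      then show ?thesis
        using aut_mult(1)[OF aut_mult_closed[OF ga na] aut_inv_closed[OF ga] xV(1)] aut_mult(1)[OF ga na x'(1)]
        by simp
    qed
    then show "\<exists>g\<in>M. fst g ` half (rv a) \<subseteq> half a" using conj[OF g(1) n(1)] by blast
  qed
qed

section \<open>Translations and their axes\<close>

lemma half_convex:
  assumes a: "a \<in> A" and u: "u \<in> half a" and w: "w \<in> half a" and x: "x \<in> V" "d u x + d x w = d u w"
  shows "x \<in> half a"
proof (rule ccontr)
  assume "x \<notin> half a"
  then have "d u x = Suc (d u (tgt a) + d (src a) x)" "d w x = Suc (d w (tgt a) + d (src a) x)"
    using separation[OF a] u w x(1) by auto
  moreover have "d u w \<le> d u (tgt a) + d (tgt a) w"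
    using gdist_triangle u w half_sub tgt_in[OF a] by blast
  ultimately show False using x(2) by (simp add: gdist_sym)
qed

text \<open>Only unit steps and the absence of backtracking are required;
  \<open>nonbacktracking\<close> makes such a path a bi-infinite geodesic.\<close>

definition axis :: "(int \<Rightarrow> 'v) \<Rightarrow> bool" where
  "axis P \<longleftrightarrow> (\<forall>i. (P i, P (i + 1)) \<in> E) \<and> (\<forall>i. P i \<noteq> P (i + 2))"

lemma axis_in: "axis P \<Longrightarrow> P i \<in> V"
  using adj_in unfolding axis_def by blast

lemma axis_recede:
  assumes P: "axis P" and v: "v \<in> V" and 1: "d v (P (i + 1)) = Suc (d v (P i))"
  shows "d v (P (i + int n)) = d v (P i) + n"
proof -
  have s1: "i + int (Suc k) = (i + int k) + 1" and s2: "i + int (Suc (Suc k)) = (i + int k) + 2" for k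
    by simp_all
  have "d v (P (i + int n)) = d v (P (i + int 0)) + n"
  proof (rule nonbacktracking[where n = n and p = "\<lambda>k. P (i + int k)", OF _ _ v])
    show "(P (i + int k), P (i + int (Suc k))) \<in> E" for k
      unfolding s1 using P unfolding axis_def by blast
    show "P (i + int k) \<noteq> P (i + int (Suc (Suc k)))" for k
      unfolding s2 using P unfolding axis_def by blast
  qed (use 1 in simp_all)
  then show ?thesis by simp
qed

lemma axis_dist:
  assumes P: "axis P" shows "d (P i) (P (i + int n)) = n"
proof -
  have "d (P i) (P (i + 1)) = 1" using P by (intro gdist_adj) (simp add: axis_def)
  then show ?thesis using axis_recede[OF P axis_in[OF P], of i i n] by simp
qed

lemma axis_dist': "axis P \<Longrightarrow> i \<le> j \<Longrightarrow> d (P i) (P j) = nat (j - i)"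
  using axis_dist[of P i "nat (j - i)"] by simp

lemma axis_inj: assumes P: "axis P" shows "inj P"
proof (rule linorder_injI)
  fix i j :: int assume "i < j"
  then have "d (P i) (P j) \<noteq> 0" using axis_dist'[OF P, of i j] by simp
  then show "P i \<noteq> P j" by auto
qed

text \<open>The geodesic from \<open>src e\<close> to its image starts with \<open>e\<close>, and
  its translates by powers of \<open>k\<close> are joined end to end. The last hypothesis says that
  the image of \<open>e\<close> leads further away from \<open>src e\<close>, so there is no
  backtracking at the joints.\<close>

lemma translation_axis:
  assumes k: "k \<in> aut \<Gamma>" and e: "e \<in> A" and ke: "fst k (src e) \<in> half e"
    and bk: "src e \<notin> half (snd k e)"
  obtains P D where "axis P" "D > 0" "\<And>i. fst k (P i) = P (i + D)" "P 0 = src e" "P 1 = tgt e"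
proof -
  define D where "D = d (src e) (fst k (src e))"
  have kV: "fst k (src e) \<in> V" using aut_vert[OF k src_in[OF e]] .
  have "src e \<noteq> fst k (src e)" using ke src_notin_half[OF e] by auto
  then have D0: "D > 0" using gdist_eq_0[OF src_in[OF e] kV] by (simp add: D_def)
  have "\<exists>p. p 0 = src e \<and> p D = fst k (src e) \<and> (\<forall>i<D. (p i, p (Suc i)) \<in> E)"
    using gdist_relpow[OF src_in[OF e] kV] unfolding D_def by (simp only: relpow_fun_conv)
  then obtain p where "p 0 = src e \<and> p D = fst k (src e) \<and> (\<forall>i<D. (p i, p (Suc i)) \<in> E)" ..
  then have p: "p 0 = src e" "p D = fst k (src e)" "\<And>i. i < D \<Longrightarrow> (p i, p (Suc i)) \<in> E" by simp_all
  have pV: "p i \<in> V" if "i \<le> D" for i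
  proof (cases i)
    case 0 then show ?thesis using p(1) e by simp
  next
    case (Suc j) then show ?thesis using adj_in(2)[OF p(3)[of j]] that by simp
  qed
  have up: "d (src e) (p i) \<le> i" if "i \<le> D" for i
    using that
  proof (induction i)
    case (Suc i)
    then show ?case using gdist_adj_le[OF p(3)[of i] src_in[OF e]] by simp
  qed (simp add: p)
  have down: "d (p (D - j)) (fst k (src e)) \<le> j" if "j \<le> D" for j
    using that
  proof (induction j)
    case (Suc j)
    then have "(p (D - Suc j), p (D - j)) \<in> E" using p(3)[of "D - Suc j"] by (simp add: Suc_diff_Suc)
    then show ?case using gdist_adj_le[OF adj_sym kV] Suc by (force simp: gdist_sym)
  qed (simp add: p)
  have pd: "d (src e) (p i) = i" "d (p i) (fst k (src e)) = D - i" if i: "i \<le> D" for i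
    using up[OF i] down[of "D - i"] i gdist_triangle[OF src_in[OF e] pV[OF i] kV] by (auto simp: D_def[symmetric])
  have p1: "p 1 = tgt e"
  proof (rule closer_unique[of "src e"])
    show "(src e, p 1) \<in> E" using p(3)[of 0] D0 p(1) by simp
    show "d (fst k (src e)) (p 1) < d (fst k (src e)) (src e)"
      using pd(2)[of 1] D0 by (simp add: gdist_sym D_def[symmetric])
    show "(src e, tgt e) \<in> E" using adjI[OF e] .
    show "d (fst k (src e)) (tgt e) < d (fst k (src e)) (src e)" using ke by (simp add: half_def)
  qed (rule kV)
  \<comment> \<open>Division by \<open>D\<close> selects the translate, the remainder the position
    in it.\<close>
  define P where "P i = fst (k [^]\<^bsub>AutG\<^esub> (i div int D)) (p (nat (i mod int D)))" for i :: int
  have kp: "k [^]\<^bsub>AutG\<^esub> (n :: int) \<in> aut \<Gamma>" for n using AutG.int_pow_closed k by simp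
  have kS: "fst (k [^]\<^bsub>AutG\<^esub> (n + 1 :: int)) v = fst k (fst (k [^]\<^bsub>AutG\<^esub> n) v)"
    "fst (k [^]\<^bsub>AutG\<^esub> (n + 1 :: int)) v = fst (k [^]\<^bsub>AutG\<^esub> n) (fst k v)" if "v \<in> V" for n v
  proof -
    have 1: "k [^]\<^bsub>AutG\<^esub> (1 + n) = k \<otimes>\<^bsub>AutG\<^esub> k [^]\<^bsub>AutG\<^esub> n"
      and 2: "k [^]\<^bsub>AutG\<^esub> (n + 1) = k [^]\<^bsub>AutG\<^esub> n \<otimes>\<^bsub>AutG\<^esub> k"
      using k AutG.int_pow_mult[of k 1 n] AutG.int_pow_mult[of k n 1] by (simp_all add: AutG.int_pow_1)
    show "fst (k [^]\<^bsub>AutG\<^esub> (n + 1 :: int)) v = fst k (fst (k [^]\<^bsub>AutG\<^esub> n) v)"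
      "fst (k [^]\<^bsub>AutG\<^esub> (n + 1 :: int)) v = fst (k [^]\<^bsub>AutG\<^esub> n) (fst k v)"
      using aut_mult(1)[OF k kp that, of n] aut_mult(1)[OF kp k that, of n]
      by (simp_all only: 1[symmetric] 2[symmetric] add.commute[of 1])
  qed
  \<comment> \<open>Allowing \<open>m = D\<close> makes both descriptions of a joint
    available.\<close>
  have Pm: "P (n * int D + int m) = fst (k [^]\<^bsub>AutG\<^esub> n) (p m)" if m: "m \<le> D" for n m
  proof (cases "m = D")
    case True
    have "n * int D + int m = (n + 1) * int D" using True by (simp add: algebra_simps)
    then have "P (n * int D + int m) = fst (k [^]\<^bsub>AutG\<^esub> (n + 1)) (p 0)" using D0 by (simp add: P_def)
    also have "\<dots> = fst (k [^]\<^bsub>AutG\<^esub> n) (p m)" using kS(2) e p True by simp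
    finally show ?thesis .
  next
    case False
    then have "m < D" using m by simp
    then show ?thesis unfolding P_def by simp
  qed
  have rep: "\<exists>n m. m < D \<and> i = n * int D + int m" for i
    using D0 by (intro exI[of _ "i div int D"] exI[of _ "nat (i mod int D)"]) (simp add: nat_less_iff)
  have "axis P" unfolding axis_def
  proof (intro conjI allI)
    fix i
    obtain n m where m: "m < D" and i: "i = n * int D + int m" using rep by blast
    have i1: "i + 1 = n * int D + int (Suc m)" by (simp add: i)
    show "(P i, P (i + 1)) \<in> E"
      unfolding i1 unfolding i using Pm[of m n] Pm[of "Suc m" n] m aut_adj[OF kp p(3)[OF m]] by simp
    show "P i \<noteq> P (i + 2)"
    proof (cases "Suc (Suc m) \<le> D")
      case True
      have i2: "i + 2 = n * int D + int (Suc (Suc m))" by (simp add: i)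
      have "p m \<noteq> p (Suc (Suc m))" using pd(1)[of m] pd(1)[of "Suc (Suc m)"] True by auto
      then have "fst (k [^]\<^bsub>AutG\<^esub> n) (p m) \<noteq> fst (k [^]\<^bsub>AutG\<^esub> n) (p (Suc (Suc m)))"
        using inj_onD[OF aut_inj[OF kp]] pV True by (metis Suc_leD)
      then show ?thesis unfolding i2 unfolding i using Pm[of m n] Pm[of "Suc (Suc m)" n] True by simp
    next
      case False
      \<comment> \<open>Up to a power of \<open>k\<close>, the vertices before and after a joint lie
        at distances \<open>D - 1\<close> and \<open>D + 1\<close> from
        \<open>src e\<close>.\<close>
      then have mD: "Suc m = D" using m by simp
      have i2: "i + 2 = (n + 1) * int D + int 1" using mD by (auto simp: i algebra_simps)
      have ks: "src (snd k e) = fst k (src e)" "tgt (snd k e) = fst k (tgt e)"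
        using aut_src[OF k e] aut_tgt[OF k e] by auto
      have "d (src e) (fst k (tgt e)) = Suc D"
        using notin_half[OF aut_arc[OF k e] src_in[OF e] bk] ks by (simp add: D_def)
      moreover have "d (src e) (p m) = m" using pd(1) m by simp
      ultimately have "p m \<noteq> fst k (p 1)" using mD p1 by auto
      then have "fst (k [^]\<^bsub>AutG\<^esub> n) (p m) \<noteq> fst (k [^]\<^bsub>AutG\<^esub> n) (fst k (p 1))"
        using inj_onD[OF aut_inj[OF kp[of n]], of "p m" "fst k (p 1)"] pV[of m] pV[of 1] m D0 aut_vert[OF k] by auto
      also have "fst (k [^]\<^bsub>AutG\<^esub> n) (fst k (p 1)) = P (i + 2)"
        unfolding i2 using Pm[of 1 "n + 1"] kS(2)[OF pV[of 1]] D0 by simp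
      finally show ?thesis unfolding i using Pm[of m n] m by simp
    qed
  qed
  moreover have "fst k (P i) = P (i + int D)" for i
  proof -
    obtain n m where m: "m < D" and i: "i = n * int D + int m" using rep by blast
    have iD: "i + int D = (n + 1) * int D + int m" by (simp add: i algebra_simps)
    show ?thesis unfolding iD unfolding i using Pm[of m n] Pm[of m "n + 1"] m kS(1)[OF pV[of m]] by simp
  qed
  moreover have "P 0 = src e" "P 1 = tgt e"
    using Pm[of 0 0] Pm[of 1 0] D0 p1 p(1) e aut_one(1) by auto
  ultimately show ?thesis using that[of P "int D"] D0 by simp
qed

text \<open>Ping-pong between two disjoint half-trees \<open>half p\<close> and
  \<open>half q\<close> inside \<open>half a\<close>: one end of the axis of \<open>k\<close> runs
  into the first, the other into the second, and convexity of \<open>half a\<close> takes care of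
  the part between.\<close>

lemma axis_in_half:
  assumes K: "subgroup K AutG" and con: "contracts K" and z: "branching z" and a: "a \<in> A"
  obtains k P D where "k \<in> K" "axis P" "D > 0" "\<And>i. fst k (P i) = P (i + D)" "range P \<subseteq> half a"
proof -
  obtain y where y: "y \<in> half a" "branching y" using branching_in_half[OF K con z a] by blast
  obtain p q where pq: "p \<in> A" "q \<in> A" "src p = y" "src q = y" "p \<noteq> q" "half p \<subseteq> half a" "half q \<subseteq> half a"
    using two_halves[OF y a] .
  have dis: "half p \<inter> half q = {}" using half_disjoint pq by simp
  obtain g where g: "g \<in> K" "fst g ` half (rv p) \<subseteq> half p" using con pq(1) unfolding contracts_def by blast
  obtain h where h: "h \<in> K" "fst h ` half (rv q) \<subseteq> half q" using con pq(2) unfolding contracts_def by blast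
  note ga = subgroup_aut_mem(1)[OF K g(1)] and ha = subgroup_aut_mem(1)[OF K h(1)]
  \<comment> \<open>This \<open>k\<close> takes the arc \<open>snd g p\<close>, the half-tree of
    whose reverse lies in \<open>half p\<close>, to \<open>snd h p\<close>, whose own half-tree lies
    in \<open>half q\<close>.\<close>
  define k where "k = h \<otimes>\<^bsub>AutG\<^esub> inv\<^bsub>AutG\<^esub> g"
  have kK: "k \<in> K" unfolding k_def using subgroup_aut_mem(3,4)[OF K] g h by simp
  note ka = subgroup_aut_mem(1)[OF K kK]
  define e where "e = snd g p"
  have e: "e \<in> A" using aut_arc[OF ga pq(1)] by (simp add: e_def)
  have ke: "snd k e = snd h p"
    using aut_mult(2)[OF ha aut_inv_closed[OF ga] e] aut_inv(3)[OF ga pq(1)] by (simp add: k_def e_def)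
  have half_e: "half (rv e) \<subseteq> half p"
    using aut_half(2)[OF ga rv_in[OF pq(1)]] aut_rv[OF ga pq(1)] g(2) by (simp add: e_def)
  have half_ke: "half (snd k e) \<subseteq> half q"
  proof -
    have "half p \<subseteq> half (rv q)" using dis half_rv[OF pq(2)] half_sub[of p] by blast
    then show ?thesis unfolding ke aut_half(2)[OF ha pq(1)] using h(2) by blast
  qed
  have keA: "snd k e \<in> A" using aut_arc[OF ka e] .
  have se: "src e \<in> half p" using half_e tgt_in_half[OF rv_in[OF e]] e by auto
  have te: "tgt (snd k e) \<in> half q" using half_ke tgt_in_half[OF keA] by blast
  have kse: "fst k (src e) = src (snd k e)" using aut_src[OF ka e] by simp
  have ksV: "src (snd k e) \<in> V" using keA by simp
  have nsp: "src (snd k e) \<notin> half p"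
  proof
    assume sp: "src (snd k e) \<in> half p"
    have "tgt (snd k e) \<notin> half p" using te dis by blast
    then have "rv (snd k e) = p" using crossing[OF pq(1) rv_in[OF keA]] sp keA by simp
    then have "tgt (snd k e) = src q" using pq(3,4) by auto
    then show False using te src_notin_half[OF pq(2)] by simp
  qed
  have "fst k (src e) \<in> half e" using nsp half_e half_rv[OF e] ksV kse by auto
  moreover have "src e \<notin> half (snd k e)" using se half_ke dis by blast
  ultimately obtain P D where P: "axis P" "D > 0" "\<And>i. fst k (P i) = P (i + D)" "P 0 = src e" "P 1 = tgt e"
    by (rule translation_axis[OF ka e]) blast
  have pos: "P i \<in> half e" if "i \<ge> 1" for i
    using axis_dist'[OF P(1), of 0 i] axis_dist'[OF P(1), of 1 i] that P(4,5) axis_in[OF P(1)]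
    by (auto simp: half_def gdist_sym)
  have neg: "P i \<in> half a" if "i \<le> 0" for i
  proof -
    have "d (P i) (tgt e) = Suc (d (P i) (src e))"
      using axis_dist'[OF P(1), of i 0] axis_dist'[OF P(1), of i 1] that P(4,5) by auto
    then have "P i \<in> half (rv e)" using half_rv[OF e] axis_in[OF P(1)] by (auto simp: half_def)
    then show ?thesis using half_e pq by blast
  qed
  have far: "P i \<in> half a" if "i \<ge> D + 1" for i
  proof -
    have "fst k (P (i - D)) \<in> half (snd k e)"
      using aut_half(1)[OF ka e axis_in[OF P(1)]] pos that by simp
    then show ?thesis using P(3)[of "i - D"] half_ke pq by auto
  qed
  have "P i \<in> half a" for i
  proof -
    consider "i \<le> 0" | "i \<ge> D + 1" | "0 < i" "i < D + 1" by linarith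
    then show ?thesis
    proof cases
      case 3
      have "d (P 0) (P i) + d (P i) (P (D + 1)) = d (P 0) (P (D + 1))"
        using axis_dist'[OF P(1)] 3 by (simp add: nat_add_distrib[symmetric])
      then show ?thesis using half_convex[OF a neg far axis_in[OF P(1)], of 0 "D + 1" i] by simp
    qed (use neg far in auto)
  qed
  then show ?thesis using that[OF kK P(1,2,3)] by blast
qed

end

section \<open>Property (P) and simplicity\<close>

context tree
begin

section \<open>Prescribing group elements along a path\<close>

lemma closest_eqI:
  assumes "x \<in> L" "\<And>y. y \<in> L \<Longrightarrow> d v x \<le> d v y" "\<And>y. \<lbrakk>y \<in> L; y \<noteq> x\<rbrakk> \<Longrightarrow> d v x < d v y"
  shows "closest \<Gamma> L v = x"
  unfolding closest_def
proof (rule the_equality)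
  fix y assume y: "y \<in> L \<and> (\<forall>z\<in>L. d v y \<le> d v z)"
  then have "d v y \<le> d v x" using assms(1) by blast
  then show "y = x" using assms(3)[of y] y by (metis not_less)
qed (use assms in blast)

text \<open>On either side of a minimum, \<open>axis_recede\<close> makes the distance grow
  strictly.\<close>

lemma axis_closest:
  assumes P: "axis P" and v: "v \<in> V"
  obtains i where "closest \<Gamma> (range P) v = P i" "\<And>j. j \<noteq> i \<Longrightarrow> d v (P i) < d v (P j)"
proof -
  obtain i where i: "\<And>j. d v (P i) \<le> d v (P j)"
    using ex_has_least_nat[of "\<lambda>_. True" 0 "\<lambda>i. d v (P i)"] by blast
  have E: "(P j, P (j + 1)) \<in> E" for j using P by (simp add: axis_def)
  have less: "d v (P i) < d v (P j)" if "j \<noteq> i" for j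
  proof (cases "j > i")
    case True
    have "d v (P (i + 1)) = Suc (d v (P i))"
      using i[of "i + 1"] adj_gdist_neq[OF E v, of i] gdist_adj_le[OF E v, of i] by linarith
    then have "d v (P (i + int (nat (j - i)))) = d v (P i) + nat (j - i)"
      by (rule axis_recede[OF P v])
    then show ?thesis using True by simp
  next
    case False
    show ?thesis
    proof (rule ccontr)
      assume "\<not> ?thesis"
      then have eq: "d v (P j) = d v (P i)" using i[of j] by simp
      \<comment> \<open>\<open>axis_recede\<close> runs to the right only, so it is applied from
        \<open>j\<close>, where the distance would also be minimal, up to \<open>i\<close>.\<close>
      have "d v (P (j + 1)) = Suc (d v (P j))"
        using i[of "j + 1"] eq adj_gdist_neq[OF E v, of j] gdist_adj_le[OF E v, of j] by linarith
      then have "d v (P (j + int (nat (i - j)))) = d v (P j) + nat (i - j)"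
        by (rule axis_recede[OF P v])
      then show False using False that eq \<open>j \<noteq> i\<close> by simp
    qed
  qed
  have "closest \<Gamma> (range P) v = P i"
    by (rule closest_eqI) (auto simp: i intro!: less)
  then show ?thesis using that less by blast
qed

lemma axis_path_sets: "axis P \<Longrightarrow> range P \<in> path_sets \<Gamma>"
  unfolding path_sets_def using axis_inj[of P] axis_in[of P]
  by (intro CollectI exI[of _ P] exI[of _ UNIV]) (auto simp: axis_def)

lemma arc_path_sets:
  assumes a: "a \<in> A" shows "{src a, tgt a} \<in> path_sets \<Gamma>"
proof -
  let ?p = "\<lambda>i::int. if i = 0 then src a else tgt a"
  have "?p ` {0, 1} = {src a, tgt a}" by auto
  moreover have "\<forall>i\<in>{0, 1}. \<forall>k\<in>{0, 1}. {i..k} \<subseteq> {0, 1 :: int}" by auto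
  moreover have "inj_on ?p {0, 1}" using no_loop[OF a] by (auto simp: inj_on_def)
  moreover have "\<forall>i. i \<in> {0, 1} \<and> i + 1 \<in> {0, 1} \<longrightarrow> (?p i, ?p (i + 1)) \<in> E"
    using adjI[OF a] by auto
  ultimately show ?thesis unfolding path_sets_def using a
    by (intro CollectI exI[of _ ?p] exI[of _ "{0, 1}"]) auto
qed

lemma closest_arc:
  assumes a: "a \<in> A" and v: "v \<in> V"
  shows "closest \<Gamma> {src a, tgt a} v = (if v \<in> half a then tgt a else src a)"
  using in_half[OF a, of v] notin_half[OF a v] by (auto intro!: closest_eqI)

end

context tree_action
begin

text \<open>The reading of (P) used below: elements of the fixator can be chosen independently over
  the vertices of \<open>L\<close>.\<close>

lemma property_P_glue:
  assumes PP: "property_P \<Gamma> G" and L: "L \<in> path_sets \<Gamma>"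
    and s: "\<And>x. x \<in> L \<Longrightarrow> s x \<in> pointwise_stab G L"
    and cl: "\<And>v. v \<in> V \<Longrightarrow> closest \<Gamma> L v \<in> L"
  obtains g where "g \<in> pointwise_stab G L"
    "\<And>v. v \<in> V \<Longrightarrow> fst g v = fst (s (closest \<Gamma> L v)) v"
proof -
  have "(\<lambda>x\<in>L. fibre_action \<Gamma> L x (s x)) \<in> (\<Pi>\<^sub>E x\<in>L. fibre_action \<Gamma> L x ` pointwise_stab G L)"
    using s by auto
  then have "(\<lambda>x\<in>L. fibre_action \<Gamma> L x (s x)) \<in> (\<lambda>g. \<lambda>x\<in>L. fibre_action \<Gamma> L x g) ` pointwise_stab G L"
    using PP L unfolding property_P_def by blast
  then obtain g where g: "g \<in> pointwise_stab G L"
    and eq: "(\<lambda>x\<in>L. fibre_action \<Gamma> L x (s x)) = (\<lambda>x\<in>L. fibre_action \<Gamma> L x g)" by blast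
  have "fst g v = fst (s (closest \<Gamma> L v)) v" if v: "v \<in> V" for v
  proof -
    let ?x = "closest \<Gamma> L v"
    have "fibre_action \<Gamma> L ?x (s ?x) = fibre_action \<Gamma> L ?x g"
      using fun_cong[OF eq, of ?x] cl[OF v] by simp
    from fun_cong[OF this, of v] show ?thesis
      using v by (simp add: fibre_action_def fibre_def)
  qed
  then show ?thesis using that g by blast
qed

lemma pointwise_stab_subgroup:
  assumes L: "L \<subseteq> V" shows "subgroup (pointwise_stab G L) AutG"
proof (rule AutG.subgroupI)
  show "pointwise_stab G L \<subseteq> carrier AutG" using G_aut by (auto simp: pointwise_stab_def)
  have "\<one>\<^bsub>AutG\<^esub> \<in> pointwise_stab G L"
    using G_one aut_one(1) L by (auto simp: pointwise_stab_def)
  then show "pointwise_stab G L \<noteq> {}" by blast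
  fix g assume "g \<in> pointwise_stab G L"
  then have g: "g \<in> G" "\<And>x. x \<in> L \<Longrightarrow> fst g x = x" by (auto simp: pointwise_stab_def)
  have "fst (inv\<^bsub>AutG\<^esub> g) x = x" if "x \<in> L" for x
    using aut_inv(1)[OF G_aut[OF g(1)], of x] g(2)[OF that] that L by auto
  then show "inv\<^bsub>AutG\<^esub> g \<in> pointwise_stab G L" using G_inv[OF g(1)] by (simp add: pointwise_stab_def)
  fix h assume "h \<in> pointwise_stab G L"
  then have h: "h \<in> G" "\<And>x. x \<in> L \<Longrightarrow> fst h x = x" by (auto simp: pointwise_stab_def)
  have "fst (g \<otimes>\<^bsub>AutG\<^esub> h) x = x" if "x \<in> L" for x
    using aut_mult(1)[OF G_aut[OF g(1)] G_aut[OF h(1)], of x] g(2)[OF that] h(2)[OF that] that L by auto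
  then show "g \<otimes>\<^bsub>AutG\<^esub> h \<in> pointwise_stab G L"
    using G_mult[OF g(1) h(1)] by (simp add: pointwise_stab_def)
qed

text \<open>Tits' argument. The equation \<open>k s k^-1 = g s\<close> determines \<open>s\<close>
  over \<open>P (i + D)\<close> from its values over \<open>P i\<close>. Taking \<open>s\<close> to
  be the identity over \<open>P 0\<close>, ..., \<open>P (D - 1)\<close> and solving in both
  directions gives elements of the fixator fibre by fibre, which (P) assembles.\<close>

lemma pointwise_stab_commutator:
  assumes PP: "property_P \<Gamma> G" and P: "axis P" and k: "k \<in> G" and D: "D > 0"
    and kP: "\<And>i. fst k (P i) = P (i + D)" and g: "g \<in> pointwise_stab G (range P)"
  shows "\<exists>s\<in>pointwise_stab G (range P). g = k \<otimes>\<^bsub>AutG\<^esub> s \<otimes>\<^bsub>AutG\<^esub> inv\<^bsub>AutG\<^esub> k \<otimes>\<^bsub>AutG\<^esub> inv\<^bsub>AutG\<^esub> s"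
proof -
  let ?L = "range P"
  have gG: "g \<in> G" and gL: "fst g (P i) = P i" for i using g by (auto simp: pointwise_stab_def)
  note ga = G_aut[OF gG] and ka = G_aut[OF k]
  define h where "h = inv\<^bsub>AutG\<^esub> g \<otimes>\<^bsub>AutG\<^esub> k"
  have hG: "h \<in> G" unfolding h_def using G_mult G_inv gG k by blast
  note ha = G_aut[OF hG]
  have hP: "fst h (P i) = P (i + D)" for i
    using aut_mult(1)[OF aut_inv_closed[OF ga] ka axis_in[OF P]] kP aut_inv(1)[OF ga axis_in[OF P], of "i + D"] gL
    by (simp add: h_def)
  have pow_G: "x [^]\<^bsub>AutG\<^esub> (n :: int) \<in> G" if "x \<in> G" for x n
    using AutG.subgroup_int_pow_closed[OF subgroup that] .
  have pow_S: "x [^]\<^bsub>AutG\<^esub> (n + 1 :: int) = x [^]\<^bsub>AutG\<^esub> n \<otimes>\<^bsub>AutG\<^esub> x"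
    "x [^]\<^bsub>AutG\<^esub> (n + 1 :: int) = x \<otimes>\<^bsub>AutG\<^esub> x [^]\<^bsub>AutG\<^esub> n" if "x \<in> aut \<Gamma>" for x n
    using that AutG.int_pow_mult[of x n 1] AutG.int_pow_mult[of x 1 n] by (simp_all add: add.commute)
  have pow_P: "fst (x [^]\<^bsub>AutG\<^esub> (n :: int)) (P i) = P (i + n * D)"
    if x: "x \<in> G" and xP: "\<And>i. fst x (P i) = P (i + D)" for x n i
  proof (induction n arbitrary: i rule: int_induct[of _ 0])
    case base
    then show ?case using aut_one(1)[OF axis_in[OF P]] by simp
  next
    case (step1 n)
    have "fst (x [^]\<^bsub>AutG\<^esub> (n + 1)) (P i) = fst (x [^]\<^bsub>AutG\<^esub> n) (P (i + D))"
      using pow_S(1)[OF G_aut[OF x]] aut_mult(1)[OF G_aut[OF pow_G[OF x]] G_aut[OF x] axis_in[OF P]] xP by simp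
    then show ?case using step1 by (simp add: algebra_simps)
  next
    case (step2 n)
    have "fst (x [^]\<^bsub>AutG\<^esub> n) (P (i - D)) = fst (x [^]\<^bsub>AutG\<^esub> (n - 1)) (P i)"
      using pow_S(1)[OF G_aut[OF x], of "n - 1"] aut_mult(1)[OF G_aut[OF pow_G[OF x]] G_aut[OF x] axis_in[OF P]] xP by simp
    then show ?case using step2(2)[of "i - D"] by (simp add: algebra_simps)
  qed
  \<comment> \<open>The restrictions \<open>s\<^sub>i\<close> of s to the fibres over \<open>P i\<close> have to satisfy
    \<open>g s\<^sub>i = k s\<^sub>i\<^sub>-\<^sub>D k\<^sup>-\<^sup>1\<close>, that is \<open>s\<^sub>i = h s\<^sub>i\<^sub>-\<^sub>D k\<^sup>-\<^sup>1\<close>.\<close>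
  define c where "c n = h [^]\<^bsub>AutG\<^esub> n \<otimes>\<^bsub>AutG\<^esub> k [^]\<^bsub>AutG\<^esub> (- n)" for n :: int
  have cG: "c n \<in> G" for n unfolding c_def using G_mult pow_G hG k by blast
  have c_stab: "c n \<in> pointwise_stab G ?L" for n
  proof -
    have "fst (c n) (P i) = P i" for i
      unfolding c_def using aut_mult(1)[OF G_aut[OF pow_G[OF hG]] G_aut[OF pow_G[OF k]] axis_in[OF P]]
        pow_P[OF hG hP] pow_P[OF k kP] by simp
    then show ?thesis using cG by (auto simp: pointwise_stab_def)
  qed
  \<comment> \<open>Since \<open>g h = k\<close>, multiplying by \<open>g\<close> turns one
    \<open>h\<close> into \<open>k\<close>, which is the recursion between consecutive blocks of
    \<open>D\<close> fibres.\<close>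
  have c_rec: "g \<otimes>\<^bsub>AutG\<^esub> c n = k \<otimes>\<^bsub>AutG\<^esub> c (n - 1) \<otimes>\<^bsub>AutG\<^esub> inv\<^bsub>AutG\<^esub> k" for n
  proof -
    let ?hn = "h [^]\<^bsub>AutG\<^esub> (n - 1)" and ?kn = "k [^]\<^bsub>AutG\<^esub> (- n)"
    have cl: "?hn \<in> carrier AutG" "?kn \<in> carrier AutG" "g \<in> carrier AutG" "k \<in> carrier AutG" "h \<in> carrier AutG"
      using ga ka ha by (auto intro: AutG.int_pow_closed simp del: carrier_aut simp: carrier_aut[symmetric])
    have gh: "g \<otimes>\<^bsub>AutG\<^esub> h = k"
      using cl by (simp add: h_def AutG.m_assoc[symmetric] del: carrier_aut)
    have "h [^]\<^bsub>AutG\<^esub> n = h \<otimes>\<^bsub>AutG\<^esub> ?hn" using pow_S(2)[OF ha, of "n - 1"] by simp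
    then have "g \<otimes>\<^bsub>AutG\<^esub> c n = k \<otimes>\<^bsub>AutG\<^esub> ?hn \<otimes>\<^bsub>AutG\<^esub> ?kn"
      using cl gh by (simp add: c_def AutG.m_assoc[symmetric] del: carrier_aut)
    also have "?kn = k [^]\<^bsub>AutG\<^esub> (- n + 1) \<otimes>\<^bsub>AutG\<^esub> inv\<^bsub>AutG\<^esub> k"
      using cl pow_S(1)[OF ka, of "- n"] by (simp add: AutG.m_assoc del: carrier_aut)
    finally show ?thesis using cl by (simp add: c_def AutG.m_assoc del: carrier_aut)
  qed
  define idx where "idx x = (THE i. P i = x)" for x
  have idx [simp]: "idx (P i) = i" for i
    unfolding idx_def using axis_inj[OF P] by (auto simp: inj_eq)
  have cl_in: "closest \<Gamma> ?L v \<in> ?L" if "v \<in> V" for v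
    using axis_closest[OF P that] by (metis rangeI)
  \<comment> \<open>The fibres over \<open>P i\<close> with the same \<open>i div D\<close> form one
    block and use the same element.\<close>
  obtain s where s: "s \<in> pointwise_stab G ?L"
    and sv: "\<And>v. v \<in> V \<Longrightarrow> fst s v = fst (c (idx (closest \<Gamma> ?L v) div D)) v"
    using property_P_glue[OF PP axis_path_sets[OF P], of "\<lambda>x. c (idx x div D)"] c_stab cl_in by blast
  have sG: "s \<in> G" using s by (auto simp: pointwise_stab_def)
  note sa = G_aut[OF sG]
  have k_inv_V: "fst (inv\<^bsub>AutG\<^esub> k) v \<in> V" if "v \<in> V" for v using aut_vert[OF aut_inv_closed[OF ka] that] .
  have main: "k \<otimes>\<^bsub>AutG\<^esub> s \<otimes>\<^bsub>AutG\<^esub> inv\<^bsub>AutG\<^esub> k = g \<otimes>\<^bsub>AutG\<^esub> s"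
  proof (rule aut_fst_eqI)
    show "k \<otimes>\<^bsub>AutG\<^esub> s \<otimes>\<^bsub>AutG\<^esub> inv\<^bsub>AutG\<^esub> k \<in> aut \<Gamma>" "g \<otimes>\<^bsub>AutG\<^esub> s \<in> aut \<Gamma>"
      using ka sa ga aut_mult_closed aut_inv_closed by auto
    fix v assume v: "v \<in> V"
    let ?v = "fst (inv\<^bsub>AutG\<^esub> k) v"
    have kv: "fst k ?v = v" using aut_inv(2)[OF ka v] .
    obtain i where i: "closest \<Gamma> ?L v = P i" "\<And>j. j \<noteq> i \<Longrightarrow> d v (P i) < d v (P j)"
      using axis_closest[OF P v] by metis
    have dk: "d ?v (P j) = d v (P (j + D))" for j
      using aut_gdist[OF ka k_inv_V[OF v] axis_in[OF P]] kv kP by metis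
    \<comment> \<open>\<open>k\<close> shifts nearest points along the axis by \<open>D\<close>,
      that is, by one block.\<close>
    have cl: "closest \<Gamma> ?L ?v = P (i - D)"
    proof (rule closest_eqI)
      fix y assume "y \<in> ?L"
      then obtain j where j: "y = P j" by blast
      show "d ?v (P (i - D)) < d ?v y" if "y \<noteq> P (i - D)"
      proof -
        have "j \<noteq> i - D" using that j by auto
        then have "j + D \<noteq> i" by auto
        then show ?thesis using i(2)[of "j + D"] by (simp add: j dk)
      qed
      then show "d ?v (P (i - D)) \<le> d ?v y" by (cases "y = P (i - D)") auto
    qed simp
    have "(i - D) div D = i div D - 1" using D div_mult_self1[of D i "- 1"] by simp
    then have s1: "fst s ?v = fst (c (i div D - 1)) ?v" using sv[OF k_inv_V[OF v]] cl by simp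
    have s2: "fst s v = fst (c (i div D)) v" using sv[OF v] i(1) by simp
    have "fst (k \<otimes>\<^bsub>AutG\<^esub> s \<otimes>\<^bsub>AutG\<^esub> inv\<^bsub>AutG\<^esub> k) v = fst k (fst s ?v)"
      using aut_mult(1)[OF aut_mult_closed[OF ka sa] aut_inv_closed[OF ka] v] aut_mult(1)[OF ka sa k_inv_V[OF v]] by simp
    also have "\<dots> = fst (k \<otimes>\<^bsub>AutG\<^esub> c (i div D - 1) \<otimes>\<^bsub>AutG\<^esub> inv\<^bsub>AutG\<^esub> k) v"
      using aut_mult(1)[OF aut_mult_closed[OF ka G_aut[OF cG]] aut_inv_closed[OF ka] v]
        aut_mult(1)[OF ka G_aut[OF cG] k_inv_V[OF v]] s1 by simp
    also have "\<dots> = fst (g \<otimes>\<^bsub>AutG\<^esub> s) v"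
      unfolding c_rec[symmetric] using aut_mult(1)[OF ga G_aut[OF cG] v] aut_mult(1)[OF ga sa v] s2 by simp
    finally show "fst (k \<otimes>\<^bsub>AutG\<^esub> s \<otimes>\<^bsub>AutG\<^esub> inv\<^bsub>AutG\<^esub> k) v = fst (g \<otimes>\<^bsub>AutG\<^esub> s) v" .
  qed
  have "g = k \<otimes>\<^bsub>AutG\<^esub> s \<otimes>\<^bsub>AutG\<^esub> inv\<^bsub>AutG\<^esub> k \<otimes>\<^bsub>AutG\<^esub> inv\<^bsub>AutG\<^esub> s"
  proof -
    have "g \<in> carrier AutG" "s \<in> carrier AutG" using ga sa by simp_all
    then show ?thesis unfolding main by (simp add: AutG.m_assoc del: carrier_aut)
  qed
  then show ?thesis using s by blast
qed

section \<open>The subgroup generated by the arc stabilisers\<close>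

abbreviation "Gp \<equiv> G_plus \<Gamma> G"

lemma stabilizer_arc: "stabilizer (sub_group \<Gamma> G) snd a = {g \<in> G. snd g a = a}"
  by (simp add: stabilizer_def)

lemma Gp_subgroup: "subgroup Gp AutG"
  unfolding G_plus_def using G_aut by (intro AutG.generate_is_subgroup) (auto simp: stabilizer_arc)

lemma Gp_incl: "\<lbrakk>a \<in> A; g \<in> G; snd g a = a\<rbrakk> \<Longrightarrow> g \<in> Gp"
  unfolding G_plus_def by (intro generate.incl) (auto simp: stabilizer_arc)

lemma Gp_least:
  assumes "subgroup N AutG" and "\<And>a g. \<lbrakk>a \<in> A; g \<in> G; snd g a = a\<rbrakk> \<Longrightarrow> g \<in> N"
  shows "Gp \<subseteq> N"
  unfolding G_plus_def using assms by (intro AutG.generate_subgroup_incl) (auto simp: stabilizer_arc)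

lemma Gp_G: "Gp \<subseteq> G"
  by (rule Gp_least[OF subgroup])

text \<open>The elements whose conjugate by \<open>g\<close> lies in \<open>Gp\<close> form a
  subgroup, and it contains the generators since the stabiliser of \<open>a\<close> is conjugated to
  that of \<open>snd g a\<close>.\<close>

lemma Gp_normalised:
  assumes g: "g \<in> G" and s: "s \<in> Gp" shows "g \<otimes>\<^bsub>AutG\<^esub> s \<otimes>\<^bsub>AutG\<^esub> inv\<^bsub>AutG\<^esub> g \<in> Gp"
proof -
  note ga = G_aut[OF g]
  let ?c = "\<lambda>s. g \<otimes>\<^bsub>AutG\<^esub> s \<otimes>\<^bsub>AutG\<^esub> inv\<^bsub>AutG\<^esub> g"
  have gc: "g \<in> carrier AutG" using ga by simp
  define N where "N = {s \<in> aut \<Gamma>. ?c s \<in> Gp}"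
  have "subgroup N AutG"
  proof (rule AutG.subgroupI)
    show "N \<subseteq> carrier AutG" by (auto simp: N_def)
    have "\<one>\<^bsub>AutG\<^esub> \<in> N" using gc subgroup_aut_mem(2)[OF Gp_subgroup] AutG.one_closed by (simp add: N_def)
    then show "N \<noteq> {}" by blast
    fix x assume x: "x \<in> N"
    then have xc: "x \<in> carrier AutG" "?c x \<in> Gp" by (auto simp: N_def)
    have "?c (inv\<^bsub>AutG\<^esub> x) = inv\<^bsub>AutG\<^esub> (?c x)"
      using gc xc(1) by (simp add: AutG.inv_mult_group AutG.m_assoc del: carrier_aut)
    then show "inv\<^bsub>AutG\<^esub> x \<in> N"
      using subgroup_aut_mem(4)[OF Gp_subgroup xc(2)] AutG.inv_closed[OF xc(1)] by (simp add: N_def)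
    fix y assume y: "y \<in> N"
    then have yc: "y \<in> carrier AutG" "?c y \<in> Gp" by (auto simp: N_def)
    have "?c (x \<otimes>\<^bsub>AutG\<^esub> y) = ?c x \<otimes>\<^bsub>AutG\<^esub> ?c y"
    proof -
      have "inv\<^bsub>AutG\<^esub> g \<otimes>\<^bsub>AutG\<^esub> (g \<otimes>\<^bsub>AutG\<^esub> z) = z" if "z \<in> carrier AutG" for z
        using gc that by (simp add: AutG.m_assoc[symmetric] del: carrier_aut)
      then show ?thesis using gc xc(1) yc(1) by (simp add: AutG.m_assoc del: carrier_aut)
    qed
    then show "x \<otimes>\<^bsub>AutG\<^esub> y \<in> N"
      using subgroup_aut_mem(3)[OF Gp_subgroup xc(2) yc(2)] AutG.m_closed[OF xc(1) yc(1)] by (simp add: N_def)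
  qed
  moreover have "h \<in> N" if a: "a \<in> A" and h: "h \<in> G" "snd h a = a" for a h
  proof -
    note ha = G_aut[OF h(1)]
    have "snd (?c h) (snd g a) = snd g a"
      using aut_mult(2)[OF aut_mult_closed[OF ga ha] aut_inv_closed[OF ga] aut_arc[OF ga a]]
        aut_mult(2)[OF ga ha a] aut_inv(3)[OF ga a] h(2) by simp
    then have "?c h \<in> Gp"
      by (rule Gp_incl[OF aut_arc[OF ga a] G_mult[OF G_mult[OF g h(1)] G_inv[OF g]]])
    then show ?thesis using ha by (simp add: N_def)
  qed
  ultimately have "Gp \<subseteq> N" by (rule Gp_least)
  then show ?thesis using s by (auto simp: N_def)
qed

lemma dense_contracts:
  assumes dense: "geometrically_dense \<Gamma> G" shows "contracts G"
proof (rule ccontr)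
  assume "\<not> contracts G"
  then obtain a where a: "a \<in> A" and no: "\<And>g. g \<in> G \<Longrightarrow> \<not> fst g ` half (rv a) \<subseteq> half a"
    unfolding contracts_def by blast
  \<comment> \<open>If the translates by \<open>g\<close> and \<open>h\<close> were disjoint, the
    inverse of \<open>g\<close> times \<open>h\<close> would move the complement of
    \<open>half a\<close> into \<open>half a\<close>. Meeting translates keep an arc and its reverse
    from both lying in \<open>D\<close>.\<close>
  have meet: "fst g ` half (rv a) \<inter> fst h ` half (rv a) \<noteq> {}" if g: "g \<in> G" and h: "h \<in> G" for g h
  proof
    assume dis: "fst g ` half (rv a) \<inter> fst h ` half (rv a) = {}"
    note ga = G_aut[OF g] and ha = G_aut[OF h]
    let ?k = "inv\<^bsub>AutG\<^esub> g \<otimes>\<^bsub>AutG\<^esub> h"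
    have "fst ?k x \<in> half a" if x: "x \<in> half (rv a)" for x
    proof -
      have xV: "x \<in> V" using x half_sub by blast
      have eq: "fst ?k x = fst (inv\<^bsub>AutG\<^esub> g) (fst h x)" using aut_mult(1)[OF aut_inv_closed[OF ga] ha xV] .
      have kV: "fst ?k x \<in> V" using eq aut_vert[OF aut_inv_closed[OF ga]] aut_vert[OF ha xV] by simp
      have "fst g (fst ?k x) = fst h x" using eq aut_inv(2)[OF ga aut_vert[OF ha xV]] by simp
      then have "fst ?k x \<notin> half (rv a)" using dis x by force
      then show ?thesis using kV half_rv[OF a] by blast
    qed
    moreover have "?k \<in> G" using G_mult G_inv g h by blast
    ultimately show False using no by blast
  qed
  define D where "D = {b \<in> A. \<exists>g\<in>G. fst g ` half (rv a) \<subseteq> half b}"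
  have "confluent \<Gamma> D"
  proof (rule confluentI)
    show "D \<subseteq> A" by (auto simp: D_def)
    fix b assume "b \<in> D"
    then obtain g where b: "b \<in> A" and g: "g \<in> G" "fst g ` half (rv a) \<subseteq> half b" by (auto simp: D_def)
    show "rv b \<notin> D"
    proof
      assume "rv b \<in> D"
      then obtain h where "h \<in> G" "fst h ` half (rv a) \<subseteq> half (rv b)" by (auto simp: D_def)
      then show False using meet[OF g(1), of h] g(2) half_rv[OF b] by blast
    qed
    fix c assume c: "c \<in> A" "src c = src b" "c \<noteq> b"
    \<comment> \<open>Half-trees at a common origin are disjoint, so the translate inside
      \<open>half b\<close> also lies in \<open>half (rv c)\<close>.\<close>
    have "half b \<subseteq> half (rv c)" using half_disjoint[OF b c(1)] c half_rv[OF c(1)] half_sub[of b] by auto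
    then show "rv c \<in> D" using g c(1) by (auto simp: D_def)
  qed
  moreover have "D \<noteq> {}"
  proof -
    have "fst \<one>\<^bsub>AutG\<^esub> ` half (rv a) \<subseteq> half (rv a)" using aut_one(1) half_sub[of "rv a"] by force
    then have "rv a \<in> D" using G_one rv_in[OF a] unfolding D_def by blast
    then show ?thesis by blast
  qed
  moreover have "snd g b \<in> D" if g: "g \<in> G" and b: "b \<in> D" for g b
  proof -
    obtain h where h: "h \<in> G" "fst h ` half (rv a) \<subseteq> half b" and bA: "b \<in> A" using b by (auto simp: D_def)
    have "fst (g \<otimes>\<^bsub>AutG\<^esub> h) ` half (rv a) \<subseteq> half (snd g b)"
    proof (intro image_subsetI)
      fix x assume x: "x \<in> half (rv a)"
      then have "x \<in> V" using half_sub by blast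
      then show "fst (g \<otimes>\<^bsub>AutG\<^esub> h) x \<in> half (snd g b)"
        using aut_mult(1)[OF G_aut[OF g] G_aut[OF h(1)]] aut_half(2)[OF G_aut[OF g] bA] h(2) x by auto
    qed
    then show ?thesis using G_mult[OF g h(1)] aut_arc[OF G_aut[OF g] bA] by (auto simp: D_def)
  qed
  ultimately show False using dense unfolding geometrically_dense_iff by blast
qed

text \<open>Let an automorphism fix a vertex and one of its neighbours. Without branching at most
  one further arc starts there, so it is fixed as well, and this spreads over the tree.\<close>

lemma stabilizer_branching:
  assumes a: "a \<in> A" and g: "g \<in> G" "snd g a = a" "g \<noteq> \<one>\<^bsub>AutG\<^esub>"
  shows "\<exists>z. branching z"
proof (rule ccontr)
  assume no: "\<nexists>z. branching z"
  note ga = G_aut[OF g(1)]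
  \<comment> \<open>A fixed neighbour is carried through the induction because at a fixed vertex
    alone two arcs could be swapped.\<close>
  have "fst g w = w \<and> (\<exists>b\<in>A. src b = w \<and> fst g (tgt b) = tgt b)" if "(src a, w) \<in> E\<^sup>*" for w
    using that
  proof (induction rule: rtrancl_induct)
    case base
    then show ?case using aut_src[OF ga a] aut_tgt[OF ga a] g(2) a by auto
  next
    case (step y w)
    obtain c where c: "c \<in> A" "src c = y" "tgt c = w" using step(2) by (rule adjE)
    obtain b where b: "b \<in> A" "src b = y" "fst g (tgt b) = tgt b" and y: "fst g y = y" using step by blast
    have gc: "snd g c \<in> A" "src (snd g c) = y" "tgt (snd g c) = fst g w"
      using aut_arc[OF ga c(1)] aut_src[OF ga c(1)] aut_tgt[OF ga c(1)] c y by auto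
    have "fst g w = w"
    proof (rule ccontr)
      assume ne: "fst g w \<noteq> w"
      have "b \<noteq> c" "c \<noteq> snd g c" using ne b c gc by auto
      moreover have "b \<noteq> snd g c"
      proof
        assume "b = snd g c"
        then have "fst g (fst g w) = fst g w" using b(3) gc(3) by simp
        moreover have "w \<in> V" using c by auto
        ultimately show False using ne inj_onD[OF aut_inj[OF ga]] aut_vert[OF ga] by metis
      qed
      ultimately have "branching y" unfolding branching_def using b c gc by metis
      then show False using no by blast
    qed
    moreover have "rv c \<in> A" "src (rv c) = w" "tgt (rv c) = y" using c by auto
    ultimately show ?case using y by blast
  qed
  then have "fst g w = w" if "w \<in> V" for w
    using conn that a by (auto simp: connected_graph_def)
  then have "g = \<one>\<^bsub>AutG\<^esub>"
    using ga AutG.one_closed aut_one(1) by (intro aut_fst_eqI) auto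
  then show False using g(3) by simp
qed

lemma contracts_stabilizers:
  assumes PP: "property_P \<Gamma> G" and N: "subgroup N AutG" "N \<subseteq> G" and con: "contracts N" and z: "branching z"
    and conj: "\<And>s n. \<lbrakk>s \<in> Gp; n \<in> N\<rbrakk> \<Longrightarrow> s \<otimes>\<^bsub>AutG\<^esub> n \<otimes>\<^bsub>AutG\<^esub> inv\<^bsub>AutG\<^esub> s \<in> N"
    and a: "a \<in> A" and g: "g \<in> G" "snd g a = a"
  shows "g \<in> N"
proof -
  have fix_half: "h \<in> N" if b: "b \<in> A" and h: "h \<in> G" "\<And>v. v \<in> half b \<Longrightarrow> fst h v = v" for b h
  proof -
    obtain k P D where k: "k \<in> N" and P: "axis P" "D > 0" "\<And>i. fst k (P i) = P (i + D)" and sub: "range P \<subseteq> half b"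
      using axis_in_half[OF N(1) con z b] by metis
    have kG: "k \<in> G" using k N(2) by blast
    have hS: "h \<in> pointwise_stab G (range P)" using h sub by (auto simp: pointwise_stab_def)
    obtain s where s: "s \<in> pointwise_stab G (range P)"
      and eq: "h = k \<otimes>\<^bsub>AutG\<^esub> s \<otimes>\<^bsub>AutG\<^esub> inv\<^bsub>AutG\<^esub> k \<otimes>\<^bsub>AutG\<^esub> inv\<^bsub>AutG\<^esub> s"
      using pointwise_stab_commutator[OF PP P(1) kG P(2,3) hS] by blast
    have sG: "s \<in> G" "fst s (P 0) = P 0" "fst s (P 1) = P 1" using s by (auto simp: pointwise_stab_def)
    have "(P 0, P (0 + 1)) \<in> E" using P(1) unfolding axis_def by blast
    then obtain c where c: "c \<in> A" "src c = P 0" "tgt c = P 1" by (auto elim: adjE)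
    have "snd s c = c" using aut_snd_eqI[OF G_aut[OF sG(1)] c(1) c(1)] c sG by simp
    \<comment> \<open>An element fixing the axis fixes an arc, so it normalises \<open>N\<close>;
      hence \<open>k\<close> times the conjugate of its inverse stays in \<open>N\<close>.\<close>
    then have sGp: "s \<in> Gp" using Gp_incl[OF c(1) sG(1)] by simp
    have "s \<otimes>\<^bsub>AutG\<^esub> inv\<^bsub>AutG\<^esub> k \<otimes>\<^bsub>AutG\<^esub> inv\<^bsub>AutG\<^esub> s \<in> N"
      using conj[OF sGp] subgroup_aut_mem(4)[OF N(1) k] by blast
    then have "k \<otimes>\<^bsub>AutG\<^esub> (s \<otimes>\<^bsub>AutG\<^esub> inv\<^bsub>AutG\<^esub> k \<otimes>\<^bsub>AutG\<^esub> inv\<^bsub>AutG\<^esub> s) \<in> N"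
      using subgroup_aut_mem(3)[OF N(1) k] by blast
    moreover have "h = k \<otimes>\<^bsub>AutG\<^esub> (s \<otimes>\<^bsub>AutG\<^esub> inv\<^bsub>AutG\<^esub> k \<otimes>\<^bsub>AutG\<^esub> inv\<^bsub>AutG\<^esub> s)"
      using eq G_aut[OF kG] G_aut[OF sG(1)] aut_inv_closed aut_mult_closed by (simp add: AutG.m_assoc)
    ultimately show ?thesis by simp
  qed
  note ga = G_aut[OF g(1)]
  let ?L = "{src a, tgt a}"
  have LV: "?L \<subseteq> V" using a by auto
  have gL: "g \<in> pointwise_stab G ?L"
    using g aut_src[OF ga a] aut_tgt[OF ga a] by (simp add: pointwise_stab_def)
  have 1: "\<one>\<^bsub>AutG\<^esub> \<in> pointwise_stab G ?L"
    using pointwise_stab_subgroup[OF LV] by (rule subgroup.one_closed)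
  \<comment> \<open>\<open>s\<close> agrees with \<open>g\<close> on the side of
    \<open>src a\<close> and is trivial on the side of \<open>tgt a\<close>; then the inverse of
    \<open>s\<close> times \<open>g\<close> is trivial on the side of \<open>src a\<close>.\<close>
  obtain s where s: "s \<in> pointwise_stab G ?L"
    and sv: "\<And>v. v \<in> V \<Longrightarrow> fst s v = fst (if closest \<Gamma> ?L v = src a then g else \<one>\<^bsub>AutG\<^esub>) v"
    using property_P_glue[OF PP arc_path_sets[OF a], of "\<lambda>x. if x = src a then g else \<one>\<^bsub>AutG\<^esub>"]
      gL 1 closest_arc[OF a] by (metis insertI1 insertI2)
  have sG: "s \<in> G" using s by (simp add: pointwise_stab_def)
  note sa = G_aut[OF sG]
  have s_half: "fst s v = v" if "v \<in> half a" for v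
    using sv[of v] closest_arc[OF a, of v] that half_sub[of a] no_loop[OF a] aut_one(1) by auto
  have s_half': "fst s v = fst g v" if "v \<in> half (rv a)" for v
    using sv[of v] closest_arc[OF a, of v] that half_rv[OF a] by auto
  have sN: "s \<in> N" by (rule fix_half[OF a sG s_half])
  have "inv\<^bsub>AutG\<^esub> s \<otimes>\<^bsub>AutG\<^esub> g \<in> N"
  proof (rule fix_half[OF rv_in[OF a]])
    show "inv\<^bsub>AutG\<^esub> s \<otimes>\<^bsub>AutG\<^esub> g \<in> G" using G_mult G_inv sG g by blast
    fix v assume v: "v \<in> half (rv a)"
    then have vV: "v \<in> V" using half_sub by blast
    show "fst (inv\<^bsub>AutG\<^esub> s \<otimes>\<^bsub>AutG\<^esub> g) v = v"
      using aut_mult(1)[OF aut_inv_closed[OF sa] ga vV] s_half'[OF v] aut_inv(1)[OF sa vV] by simp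
  qed
  then have "s \<otimes>\<^bsub>AutG\<^esub> (inv\<^bsub>AutG\<^esub> s \<otimes>\<^bsub>AutG\<^esub> g) \<in> N" using subgroup_aut_mem(3)[OF N(1) sN] by blast
  moreover have "s \<otimes>\<^bsub>AutG\<^esub> (inv\<^bsub>AutG\<^esub> s \<otimes>\<^bsub>AutG\<^esub> g) = g"
    using sa ga aut_inv_closed by (simp add: AutG.m_assoc[symmetric])
  ultimately show ?thesis by simp
qed

theorem G_plus_simple:
  assumes PP: "property_P \<Gamma> G" and dense: "geometrically_dense \<Gamma> G" and nontriv: "Gp \<noteq> {\<one>\<^bsub>AutG\<^esub>}"
  shows "abstractly_simple (sub_group \<Gamma> Gp)"
  unfolding abstractly_simple_def
proof (intro conjI allI impI)
  show grp: "group (sub_group \<Gamma> Gp)"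
    by (rule subgroup.subgroup_is_group[OF Gp_subgroup group_aut])
  show "carrier (sub_group \<Gamma> Gp) \<noteq> {\<one>\<^bsub>sub_group \<Gamma> Gp\<^esub>}" using nontriv by simp
  fix N assume N: "N \<lhd> sub_group \<Gamma> Gp"
  have sub: "subgroup N AutG"
    using AutG.incl_subgroup[OF Gp_subgroup normal_imp_subgroup[OF N]] .
  have NGp: "N \<subseteq> Gp" using subgroup.subset[OF normal_imp_subgroup[OF N]] by simp
  have conj: "s \<otimes>\<^bsub>AutG\<^esub> n \<otimes>\<^bsub>AutG\<^esub> inv\<^bsub>AutG\<^esub> s \<in> N" if "s \<in> Gp" "n \<in> N" for s n
    using normal.inv_op_closed2[OF N, of s n] that AutG.m_inv_consistent[OF Gp_subgroup that(1)] by simp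
  show "N = {\<one>\<^bsub>sub_group \<Gamma> Gp\<^esub>} \<or> N = carrier (sub_group \<Gamma> Gp)"
  proof (cases "N = {\<one>\<^bsub>AutG\<^esub>}")
    case False
    then obtain n where n: "n \<in> N" "n \<noteq> \<one>\<^bsub>AutG\<^esub>" using subgroup_aut_mem(2)[OF sub] by blast
    \<comment> \<open>If all arc stabilisers were trivial, so would be the group they generate; a
      nontrivial one provides a branching vertex.\<close>
    have "\<exists>a\<in>A. \<exists>g\<in>G. snd g a = a \<and> g \<noteq> \<one>\<^bsub>AutG\<^esub>"
    proof (rule ccontr)
      assume "\<not> ?thesis"
      then have "Gp \<subseteq> {\<one>\<^bsub>AutG\<^esub>}" by (intro Gp_least AutG.triv_subgroup) blast
      then show False using nontriv subgroup_aut_mem(2)[OF Gp_subgroup] by blast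
    qed
    then obtain z where z: "branching z" using stabilizer_branching by blast
    have GpA: "Gp \<subseteq> aut \<Gamma>" "N \<subseteq> aut \<Gamma>" using Gp_G NGp G_aut by auto
    \<comment> \<open>\<open>n\<close> lies in \<open>Gp\<close> too, so the same element passes
      contraction from \<open>G\<close> to \<open>Gp\<close> and from there to \<open>N\<close>.
      There are two passes since \<open>N\<close> is known to be normalised by \<open>Gp\<close> but
      not by \<open>G\<close>.\<close>
    have "contracts Gp"
      using contracts_normalised[OF subgroup dense_contracts[OF dense] z GpA(1) _ n(2) Gp_normalised] n(1) NGp by blast
    then have "contracts N" by (rule contracts_normalised[OF Gp_subgroup _ z GpA(2) n conj])
    then have "Gp \<subseteq> N"
      using contracts_stabilizers[OF PP sub _ _ z conj] Gp_G NGp by (intro Gp_least[OF sub]) blast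
    then show ?thesis using NGp by auto
  qed simp
qed

end

theorem corollary1p5:
  fixes T :: "('v, 'a) agraph"
    and G :: "(('v \<Rightarrow> 'v) \<times> ('a \<Rightarrow> 'a)) set"
    and \<Delta> :: "('v set, 'a set, 'a) diagram"
  assumes "is_tree T"
    and "subgroup G (aut_group T)"
    and "property_P T G"
    and "is_local_action_diagram T G \<Delta>"
  shows "(\<not> is_focal_cycle \<Delta> \<and> (\<nexists>\<xi>. is_horocyclic_end \<Delta> \<xi>) \<and>
            (\<nexists>a. is_stray_half_tree \<Delta> a) \<and> (\<nexists>v. is_stray_leaf \<Delta> v)
          \<longleftrightarrow> geometrically_dense T G) \<and>
         (\<not> is_focal_cycle \<Delta> \<and> (\<nexists>\<xi>. is_horocyclic_end \<Delta> \<xi>) \<and>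
            (\<nexists>a. is_stray_half_tree \<Delta> a) \<and> (\<nexists>v. is_stray_leaf \<Delta> v)
          \<longrightarrow> abstractly_simple (sub_group T (G_plus T G)) \<or>
              G_plus T G = {\<one>\<^bsub>aut_group T\<^esub>})"
proof -
  interpret tree_action T G
    using assms(1,2) by (simp add: tree_action_def tree_action_axioms_def tree_iff)
  have base: "base \<Delta> = quotient_graph T G" using assms(4) by (simp add: is_local_action_diagram_def)
  have "\<not> is_focal_cycle \<Delta> \<and> (\<nexists>\<xi>. is_horocyclic_end \<Delta> \<xi>) \<and>
            (\<nexists>a. is_stray_half_tree \<Delta> a) \<and> (\<nexists>v. is_stray_leaf \<Delta> v)
          \<longleftrightarrow> geometrically_dense T G"
    unfolding geometrically_dense_iff_quotient[OF assms(4)]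
      conn_graph.confluent_iff_special[OF conn_graph_Q base] by blast
  then show ?thesis using G_plus_simple[OF assms(3)] by blast
qed

end
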